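(* As $n\to\infty$, $$S(n)\sim \frac{24}{\pi A^5}\,\sigma^{-n}n^{-5}=\frac{24(165\pi-512)^5}{\pi(1280-405\pi)^5}\,\sigma^{-n}n^{-5}.$$
   Context: Let ${}_2F_1$ be the Gauss hypergeometric function. Let $F$ be the ordinary generating function of 3-noncrossing matchings counted by number of arcs, given by $$F(z)=\frac1{4z^2}\left(1+6z-{}_2F_1\left(-\tfrac12,-\tfrac12;1;16z\right)-2z\,{}_2F_1\left(-\tfrac12,\tfrac32;3;16z\right)\right),$$ with removable value $F(0)=1$; its Taylor expansion begins $F(z)=1+z+3z^2+14z^3+84z^4+\cdots$. The formal power series $S(y)=\sum_{n\ge0}S(n)y^n$ (whose coefficients count 3-noncrossing skeleton matchings with $n$ arcs, with the conventions $S(0)=S(1)=1$) is uniquely determined by $S\bigl(zF(z)^2\bigr)=F(z)$. Constants: $\rho=\frac1{16}$, $F_0=F(\rho)$, $\sigma=\rho F_0^2$, $A=1+\frac{2\rho F'(\rho)}{F_0}$, where $F(\rho)$ and $F'(\rho)$ are the sums at $z=\rho$ of the (convergent) Taylor series of $F$ and of its termwise derivative. Explicitly $$F_0=88-\frac{4096}{15\pi},\qquad A=\frac{1280-405\pi}{165\pi-512}>0,\qquad \sigma=\frac{4(165\pi-512)^2}{225\pi^2}.$$ *)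

theory Defs
  imports "HOL-Analysis.Analysis" "HOL-Library.Landau_Symbols"
begin

text \<open>
  \<open>F(z)\<close> is represented by its Taylor series at 0. The numerator below is divisible by \<open>4z\<^sup>2\<close>
  (lemma \<open>noncrossing3_gf_exact\<close>), so the truncating division of formal power series is exact
  and \<open>noncrossing3_gf\<close> is the Taylor series of the function with its removable singularity
  filled in. The third argument of \<^const>\<open>fps_hypergeo\<close> rescales the variable:
  \<open>fps_hypergeo [a, b] [c] 16\<close> is the series of \<open>\<^sub>2F\<^sub>1(a, b; c; 16z)\<close>.
\<close>

definition noncrossing3_numer :: "real fps" where
  "noncrossing3_numer =
     1 + 6 * fps_X
     - fps_hypergeo [-1/2, -1/2] [1] 16
     - 2 * fps_X * fps_hypergeo [-1/2, 3/2] [3] 16"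

definition noncrossing3_gf :: "real fps" where
  "noncrossing3_gf = noncrossing3_numer / (4 * fps_X ^ 2)"

definition skeleton_gf :: "real fps" where
  "skeleton_gf = (THE S. S oo (fps_X * noncrossing3_gf ^ 2) = noncrossing3_gf)"

definition skeleton_count :: "nat \<Rightarrow> real" where
  "skeleton_count n = fps_nth skeleton_gf n"

definition rho :: real where
  "rho = 1 / 16"

text \<open>
  The number \<open>rho\<close> is exactly the radius of convergence of \<^const>\<open>noncrossing3_gf\<close>. The values
  at \<open>rho\<close> are sums of series on the boundary of the disc of convergence;
  \<^const>\<open>eval_fps\<close> is that sum (\<open>suminf\<close>) without any restriction to the open disc.
\<close>

definition F0_const :: real where
  "F0_const = eval_fps noncrossing3_gf rho"

definition sigma_const :: real where
  "sigma_const = rho * F0_const ^ 2"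

definition A_const :: real where
  "A_const = 1 + 2 * rho * eval_fps (fps_deriv noncrossing3_gf) rho / F0_const"


lemma fps_nth_two_X_mult:
  "fps_nth (2 * fps_X * f) n = (if n = 0 then 0 else 2 * fps_nth f (n - 1))" for f :: "real fps"
  by (simp add: mult.assoc numeral_fps_const)

lemma noncrossing3_numer_nth:
  "fps_nth noncrossing3_numer n =
     (if n = 0 then 1 else if n = 1 then 6 else 0)
     - pochhammer (-1/2) n * pochhammer (-1/2) n * 16 ^ n / (pochhammer 1 n * fact n)
     - (if n = 0 then 0
        else 2 * (pochhammer (-1/2) (n - 1) * pochhammer (3/2) (n - 1) * 16 ^ (n - 1)
                  / (pochhammer 3 (n - 1) * fact (n - 1))))"
  unfolding noncrossing3_numer_def fps_sub_nth fps_nth_two_X_mult fps_hypergeo_nth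
  by (auto simp: numeral_fps_const)

lemma four_X_sq: "4 * fps_X ^ 2 = fps_const 4 * (fps_X ^ 2 :: real fps)"
  by (simp add: numeral_fps_const)

lemma noncrossing3_gf_exact: "4 * fps_X ^ 2 * noncrossing3_gf = noncrossing3_numer"
proof -
  have nth: "fps_nth noncrossing3_numer n = 0" if "n < 2" for n
  proof -
    from that have "n = 0 \<or> n = 1" by auto
    then show ?thesis
      by (auto simp: noncrossing3_numer_nth)
  qed
  have cancel: "4 * fps_X ^ 2 * (fps_const (1/4) * f) = fps_X ^ 2 * f" for f :: "real fps"
  proof -
    have "4 * fps_X ^ 2 * (fps_const (1/4) * f) = fps_const 4 * fps_const (1/4) * (fps_X ^ 2 * f)"
      unfolding four_X_sq by (simp only: ac_simps)
    then show ?thesis by simp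
  qed
  have "noncrossing3_numer = 4 * fps_X ^ 2 * (fps_const (1/4) * fps_shift 2 noncrossing3_numer)"
    unfolding cancel
  proof (rule fps_ext)
    fix n
    show "fps_nth noncrossing3_numer n = fps_nth (fps_X ^ 2 * fps_shift 2 noncrossing3_numer) n"
    proof (cases "n < 2")
      case True
      then show ?thesis by (simp add: nth fps_X_power_mult_nth)
    next
      case False
      then show ?thesis
        by (simp add: fps_X_power_mult_nth del: add_2_eq_Suc add_2_eq_Suc')
    qed
  qed
  then have "4 * fps_X ^ 2 dvd noncrossing3_numer"
    by (rule dvdI)
  then show ?thesis
    by (simp add: noncrossing3_gf_def)
qed

lemma noncrossing3_gf_nth: "fps_nth noncrossing3_gf n = fps_nth noncrossing3_numer (n + 2) / 4"
proof -
  have "fps_nth (fps_const 4 * (fps_X ^ 2 * noncrossing3_gf)) (n + 2)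
          = fps_nth noncrossing3_numer (n + 2)"
    using noncrossing3_gf_exact by (simp add: four_X_sq mult.assoc)
  then show ?thesis
    by (simp add: fps_X_power_mult_nth del: add_2_eq_Suc')
qed

lemma noncrossing3_gf_initial:
  "fps_nth noncrossing3_gf 0 = 1" "fps_nth noncrossing3_gf 1 = 1"
  "fps_nth noncrossing3_gf 2 = 3" "fps_nth noncrossing3_gf 3 = 14"
  "fps_nth noncrossing3_gf 4 = 84"
  unfolding noncrossing3_gf_nth noncrossing3_numer_nth
  by (simp_all add: eval_nat_numeral pochhammer_Suc fact_Suc)

lemma skeleton_gf_ex1: "\<exists>!S. S oo (fps_X * noncrossing3_gf ^ 2) = noncrossing3_gf"
proof -
  define g where "g = fps_X * noncrossing3_gf ^ 2"
  have g0: "fps_nth g 0 = 0" and g1: "fps_nth g 1 \<noteq> 0"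
    by (simp_all add: g_def noncrossing3_gf_initial fps_power_zeroth)
  show ?thesis unfolding g_def[symmetric]
  proof (rule ex1I[of _ "noncrossing3_gf oo fps_inv g"])
    have "fps_nth (fps_inv g) 0 = 0"
      by (simp add: fps_inv_def)
    then show "(noncrossing3_gf oo fps_inv g) oo g = noncrossing3_gf"
      using fps_compose_assoc[of g "fps_inv g" noncrossing3_gf] fps_inv[OF g0 g1] g0
      by (simp flip: fps_compose_assoc)
    then show "S = noncrossing3_gf oo fps_inv g" if "S oo g = noncrossing3_gf" for S
      using fps_compose_inj_right[OF g0 g1] that by metis
  qed
qed

lemma skeleton_gf_eq: "skeleton_gf oo (fps_X * noncrossing3_gf ^ 2) = noncrossing3_gf"
  unfolding skeleton_gf_def by (rule theI'[OF skeleton_gf_ex1])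

lemma skeleton_count_initial: "skeleton_count 0 = 1" "skeleton_count 1 = 1"
proof -
  have S0: "fps_nth skeleton_gf 0 = 1"
    using arg_cong[OF skeleton_gf_eq, of "\<lambda>f. fps_nth f 0"]
    by (simp add: noncrossing3_gf_initial)
  have "fps_nth skeleton_gf 1 = 1"
    using arg_cong[OF skeleton_gf_eq, of "\<lambda>f. fps_nth f 1"]
    by (simp add: noncrossing3_gf_initial[simplified] fps_compose_nth fps_power_zeroth)
  with S0 show "skeleton_count 0 = 1" "skeleton_count 1 = 1"
    by (simp_all add: skeleton_count_def)
qed

end

theory Submission
  imports Defs "HOL-Complex_Analysis.Complex_Analysis" "HOL-Real_Asymp.Real_Asymp"
begin

text \<open>
  After the scaling \<open>Z = 16z\<close> the coefficients of \<open>F\<close> are the moments of a measure \<open>M\<close> on \<open>(0,1)\<close> (the law of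
  a product of two independent beta variables), so \<open>F(Z) = \<integral> dM(t) / (1 - Zt)\<close> continues to \<open>Re Z < 1\<close>.
  By Lagrange inversion \<open>(1 - 2n) S(n)\<close> is the \<open>n\<close>-th coefficient of \<open>F(z) ^ (1 - 2n)\<close>. The contour is
  the circle through \<open>r \<approx> 1\<close> centred at \<open>-2r\<close>, on which \<open>|Z| |F(Z)|\<^sup>2 \<ge> r F(r)\<^sup>2\<close>.

  Split \<open>F = F\<^sub>1 + F\<^sub>2\<close> at \<open>t = 1 - \<delta>\<close> with \<open>\<delta> = n\<close> to the power \<open>-4/5\<close>. Then \<open>F\<^sub>1\<close> is holomorphic slightly beyond
  \<open>1\<close>, which makes the coefficient of \<open>F\<^sub>1 ^ (1 - 2n)\<close> negligible; the terms of order at least two in \<open>F\<^sub>2\<close> are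
  \<open>O(n\<^sup>2 \<delta> ^ 8)\<close>; and the residue at \<open>Z = 1/t\<close> turns the linear term into
  \<open>\<integral> t ^ n F\<^sub>1(1/t) ^ (-2n) dM(t)\<close>. Near \<open>t = 1\<close> the integrand is \<open>F(1) ^ (-2n) t ^ (nA)\<close> up to
  lower order, so the integral behaves like the moment of order \<open>nA\<close>, which is asymptotic to \<open>24 / (\<pi> (nA) ^ 5)\<close>.
\<close>

section \<open>Coefficients of the generating function\<close>

text \<open>The coefficients decay like n^(-5), so F and its first derivatives are finite at Z = 1,
  and Z = 1 is not a saddle point of Z F(Z)^2: the logarithmic derivative of that function there is
  A > 0. The asymptotics therefore come from the singularity of F alone, and all information about
  it is drawn from the moments of M.

  A circle centred at 0 points the wrong way: F has positive coefficients, so |F| is largest at Z =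
  r, whereas a negative power needs it smallest there. Shifting the centre to -2r lets |Z| grow from
  r to 5r away from the contact point, which outweighs the drop of |F|. This comparison is
  numerical; it is the reason for the tight bounds on F(1) and for the exact relations that express
  F'(1) and F''(1) by F(1).

  The exponent 4/5 lies between 3/4 and 1. Below 1, the factors (1 + \<delta>/800)^(-n) beat every
  power of n; above 3/4, the quadratic error, of size n \<delta>^8 after division by 2n - 1, is
  o(n^(-5)).\<close>

definition gf_coeff :: "nat \<Rightarrow> real" where
  "gf_coeff n = pochhammer (1/2) n * pochhammer (3/2) n / (pochhammer 3 n * pochhammer 4 n)"

lemma gf_coeff_pos: "gf_coeff n > 0"
  by (simp add: gf_coeff_def pochhammer_pos)

lemma gf_coeff_0 [simp]: "gf_coeff 0 = 1"
  by (simp add: gf_coeff_def)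

lemma gf_coeff_Suc:
  "(real n + 3) * (real n + 4) * gf_coeff (Suc n) = (real n + 1/2) * (real n + 3/2) * gf_coeff n"
proof -
  have "pochhammer (3::real) n > 0" "pochhammer (4::real) n > 0"
    by (simp_all add: pochhammer_pos)
  then show ?thesis
    by (simp add: gf_coeff_def pochhammer_Suc divide_simps) (simp add: algebra_simps)
qed

text \<open>The two hypergeometric coefficients have the common factor P Q, and their difference
  collapses to a single hypergeometric term. Its shape, two Pochhammer quotients, is what allows a
  representation by beta moments.\<close>

lemma noncrossing3_gf_nth_gf_coeff: "fps_nth noncrossing3_gf n = 16 ^ n * gf_coeff n"
proof -
  define P where "P = pochhammer (1/2::real) n"
  define Q where "Q = pochhammer (3/2::real) n"
  \<comment> \<open>(1/2)_(n+1), split off at either end.\<close>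
  have PQ: "P * (1/2 + real n) = Q / 2"
    using pochhammer_rec[of "1/2::real" n] pochhammer_Suc[of "1/2::real" n]
    by (simp add: P_def Q_def)
  have 1: "pochhammer (-1/2::real) (Suc n) = - P / 2"
    by (simp add: pochhammer_rec P_def)
  have 2: "pochhammer (-1/2::real) (Suc (Suc n)) = - Q / 4"
    by (subst pochhammer_rec) (simp add: pochhammer_Suc PQ[unfolded P_def])
  have 3: "pochhammer (3/2::real) (Suc n) = Q * (3/2 + real n)"
    by (simp add: Q_def pochhammer_Suc)
  define f where "f = (fact n :: real)"
  have f: "f > 0" by (simp add: f_def)
  have 4: "pochhammer (3::real) n = f * (real n + 1) * (real n + 2) / 2"
    unfolding f_def by (induction n) (simp_all add: pochhammer_Suc algebra_simps)
  have 5: "pochhammer (4::real) n = f * (real n + 1) * (real n + 2) * (real n + 3) / 6"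
    unfolding f_def by (induction n) (simp_all add: pochhammer_Suc algebra_simps)
  have 6: "pochhammer (3::real) (Suc n) = f * (real n + 1) * (real n + 2) * (real n + 3) / 2"
    using 4 by (simp add: pochhammer_Suc algebra_simps)
  have 7: "pochhammer (1::real) (Suc (Suc n)) = f * (real n + 1) * (real n + 2)"
    "(fact (Suc n) :: real) = f * (real n + 1)"
    "(fact (Suc (Suc n)) :: real) = f * (real n + 1) * (real n + 2)"
    by (simp_all add: f_def pochhammer_fact [symmetric] algebra_simps)
  have Q: "Q = P * (1 + 2 * real n)" using PQ by (simp add: algebra_simps)
  have "fps_nth noncrossing3_gf n =
      (- ((- Q / 4) * (- Q / 4) * (256 * 16 ^ n) / ((f * (real n + 1) * (real n + 2)) * (f * (real n + 1) * (real n + 2))))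
       - 2 * ((- P / 2) * (Q * (3/2 + real n)) * (16 * 16 ^ n) /
           ((f * (real n + 1) * (real n + 2) * (real n + 3) / 2) * (f * (real n + 1))))) / 4"
    unfolding noncrossing3_gf_nth noncrossing3_numer_nth add_2_eq_Suc' diff_Suc_1 1 2 3 6 7
    by simp
  also have "\<dots> = 16 ^ n * (P * Q / ((f * (real n + 1) * (real n + 2) / 2) * (f * (real n + 1) * (real n + 2) * (real n + 3) / 6)))"
    unfolding Q using f by (simp add: divide_simps) (simp add: algebra_simps power2_eq_square)
  finally show ?thesis
    unfolding gf_coeff_def 4 5 P_def Q_def .
qed

text \<open>In a quotient of four \<open>rGamma_series\<close> the factorials cancel, two against
  two, and the powers of n combine to the exponent c + d - a - b.\<close>

lemma LIMSEQ_pochhammer_ratio: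
  fixes a b c d :: real
  assumes "c > 0" "d > 0"
  shows "(\<lambda>n. pochhammer a (Suc n) * pochhammer b (Suc n) / (pochhammer c (Suc n) * pochhammer d (Suc n))
           * exp ((c + d - a - b) * ln (real n))) \<longlonglongrightarrow> Gamma c * Gamma d * rGamma a * rGamma b"
proof -
  have "(\<lambda>n. rGamma_series a n * rGamma_series b n / (rGamma_series c n * rGamma_series d n))
          \<longlonglongrightarrow> rGamma a * rGamma b / (rGamma c * rGamma d)"
    using assms by (intro tendsto_intros rGamma_series_LIMSEQ)
       (auto simp: rGamma_eq_zero_iff nonpos_Ints_def)
  also have "(\<lambda>n. rGamma_series a n * rGamma_series b n / (rGamma_series c n * rGamma_series d n)) =
    (\<lambda>n. pochhammer a (Suc n) * pochhammer b (Suc n) / (pochhammer c (Suc n) * pochhammer d (Suc n))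
           * exp ((c + d - a - b) * ln (real n)))"
  proof
    fix n
    have "exp ((c + d - a - b) * ln (real n)) =
       exp (c * ln (real n)) * exp (d * ln (real n)) / (exp (a * ln (real n)) * exp (b * ln (real n)))"
      by (simp add: exp_diff [symmetric] exp_add [symmetric] algebra_simps)
    then show "rGamma_series a n * rGamma_series b n / (rGamma_series c n * rGamma_series d n) =
       pochhammer a (Suc n) * pochhammer b (Suc n) / (pochhammer c (Suc n) * pochhammer d (Suc n))
           * exp ((c + d - a - b) * ln (real n))"
      by (simp add: rGamma_series_def divide_simps)
  qed
  finally show ?thesis
    by (simp add: rGamma_inverse_Gamma field_simps)
qed

lemma Gamma_values:
  "Gamma (2::real) = 1" "Gamma (3::real) = 2" "Gamma (4::real) = 6" "Gamma (3/2::real) = sqrt pi / 2"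
  "Gamma (5/2::real) = 3 * sqrt pi / 4" "Gamma (7/2::real) = 15 * sqrt pi / 8"
proof -
  show "Gamma (2::real) = 1" "Gamma (3::real) = 2" "Gamma (4::real) = 6"
    using Gamma_fact[of 1, where ?'a=real] Gamma_fact[of 2, where ?'a=real] Gamma_fact[of 3, where ?'a=real]
    by (simp_all add: eval_nat_numeral)
  have rec: "Gamma (x + 1) = x * Gamma x" if "x > 0" for x :: real
    using Gamma_plus1[of x] nonpos_Ints_nonpos[of x] that by auto
  show 3: "Gamma (3/2::real) = sqrt pi / 2" using rec[of "1/2"] by (simp add: Gamma_one_half_real)
  show 5: "Gamma (5/2::real) = 3 * sqrt pi / 4" using rec[of "3/2"] by (simp add: 3)
  show "Gamma (7/2::real) = 15 * sqrt pi / 8" using rec[of "5/2"] by (simp add: 5)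
qed

text \<open>The exponent is 3 + 4 - 1/2 - 3/2 = 5 and the constant Gamma(3) Gamma(4) / (Gamma(1/2)
  Gamma(3/2)) = 12 / (pi/2). These are the power of n and the factor 24/pi of the theorem.\<close>

lemma gf_coeff_asymp: "(\<lambda>n. real n ^ 5 * gf_coeff n) \<longlonglongrightarrow> 24 / pi"
proof -
  have "(\<lambda>n. gf_coeff (Suc n) * exp (5 * ln (real n))) \<longlonglongrightarrow> Gamma 3 * Gamma 4 * rGamma (1/2) * rGamma (3/2)"
    using LIMSEQ_pochhammer_ratio[of 3 4 "1/2" "3/2"] by (simp add: gf_coeff_def)
  also have "Gamma 3 * Gamma 4 * rGamma (1/2) * rGamma (3/2::real) = 24 / pi"
    by (simp add: Gamma_values rGamma_inverse_Gamma Gamma_one_half_real divide_simps)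
  finally have "(\<lambda>n. gf_coeff (Suc n) * exp (5 * ln (real n))) \<longlonglongrightarrow> 24 / pi" .
  moreover have "(\<lambda>n. (real (Suc n) / real n) ^ 5) \<longlonglongrightarrow> 1 ^ 5"
    by (intro tendsto_power LIMSEQ_Suc_n_over_n)
  ultimately have "(\<lambda>n. gf_coeff (Suc n) * exp (5 * ln (real n)) * (real (Suc n) / real n) ^ 5) \<longlonglongrightarrow> 24 / pi * 1 ^ 5"
    by (rule tendsto_mult)
  moreover have "eventually (\<lambda>n. gf_coeff (Suc n) * exp (5 * ln (real n)) * (real (Suc n) / real n) ^ 5 =
      real (Suc n) ^ 5 * gf_coeff (Suc n)) sequentially"
    using eventually_gt_at_top[of 0]
  proof eventually_elim
    case (elim n)
    then have "exp (5 * ln (real n)) = real n ^ 5"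
      using exp_of_nat_mult[of 5 "ln (real n)"] by simp
    with elim show ?case by (simp add: field_simps)
  qed
  ultimately have "(\<lambda>n. real (Suc n) ^ 5 * gf_coeff (Suc n)) \<longlonglongrightarrow> 24 / pi * 1 ^ 5"
    by (rule Lim_transform_eventually)
  then have "(\<lambda>n. real (Suc n) ^ 5 * gf_coeff (Suc n)) \<longlonglongrightarrow> 24 / pi" by simp
  then show ?thesis by (rule LIMSEQ_imp_Suc)
qed

lemma gf_coeff_decay:
  assumes "k < 5"
  shows "(\<lambda>n. real n ^ k * gf_coeff n) \<longlonglongrightarrow> 0"
proof -
  have "(\<lambda>n. (real n ^ 5 * gf_coeff n) * inverse (real n) ^ (5 - k)) \<longlonglongrightarrow> 24 / pi * 0 ^ (5 - k)"
    by (intro tendsto_intros gf_coeff_asymp lim_inverse_n)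
  moreover have "eventually (\<lambda>n. (real n ^ 5 * gf_coeff n) * inverse (real n) ^ (5 - k) = real n ^ k * gf_coeff n) sequentially"
    using eventually_gt_at_top[of 0]
  proof eventually_elim
    case (elim n)
    have "real n ^ 5 = real n ^ (5 - k) * real n ^ k"
      using assms by (simp flip: power_add)
    with elim show ?case by (simp add: field_simps power_inverse)
  qed
  ultimately have "(\<lambda>n. real n ^ k * gf_coeff n) \<longlonglongrightarrow> 24 / pi * 0 ^ (5 - k)"
    by (rule Lim_transform_eventually)
  then show ?thesis using assms by (simp add: power_0_left)
qed

lemma gf_coeff_bound: "\<exists>C>0. \<forall>n. real n ^ 5 * gf_coeff n \<le> C"
proof -
  have "Bseq (\<lambda>n. real n ^ 5 * gf_coeff n)"
    using gf_coeff_asymp convergent_def convergent_imp_Bseq by blast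
  then obtain K where "K > 0" "\<And>n. norm (real n ^ 5 * gf_coeff n) \<le> K"
    by (auto elim!: BseqE)
  then have "K > 0 \<and> (\<forall>n. real n ^ 5 * gf_coeff n \<le> K)" by (simp add: abs_le_iff)
  then show ?thesis by blast
qed

section \<open>Linear relations between F(1), F'(1) and F''(1), and numerical bounds\<close>

lemma gf_coeff_tail_sums:
  "(\<lambda>n. (3 * real (n + N) + 21/4) * gf_coeff (n + N)) sums ((real N + 2) * (real N + 3) * gf_coeff N)"
proof -
  \<comment> \<open>By \<open>gf_coeff_Suc\<close>, u (n + 1) is a monic quadratic in n times
    \<open>gf_coeff n\<close>, so the squares cancel in u n - u (n + 1) and a linear weight remains.
    N = 0 relates F(1) to F'(1); larger N bounds tails.\<close>
  define u where "u n = (real n + 2) * (real n + 3) * gf_coeff n" for n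
  have "(\<lambda>n. real n ^ 2 * gf_coeff n + 5 * (real n ^ 1 * gf_coeff n) + 6 * (real n ^ 0 * gf_coeff n)) \<longlonglongrightarrow> 0 + 5 * 0 + 6 * 0"
    by (intro tendsto_intros gf_coeff_decay) auto
  then have "u \<longlonglongrightarrow> 0"
    unfolding u_def by (simp add: algebra_simps power2_eq_square)
  then have "(\<lambda>n. u (n + N)) \<longlonglongrightarrow> 0" by (rule LIMSEQ_ignore_initial_segment)
  from telescope_sums'[OF this] have "(\<lambda>n. u (n + N) - u (Suc n + N)) sums u N" by simp
  also have "(\<lambda>n. u (n + N) - u (Suc n + N)) = (\<lambda>n. (3 * real (n + N) + 21/4) * gf_coeff (n + N))"
  proof
    fix n
    show "u (n + N) - u (Suc n + N) = (3 * real (n + N) + 21/4) * gf_coeff (n + N)"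
      using gf_coeff_Suc[of "n + N"] by (simp add: u_def algebra_simps)
  qed
  finally show ?thesis by (simp add: u_def)
qed

text \<open>The telescoping sequence of \<open>gf_coeff_tail_sums\<close> multiplied by n. Its
  boundary term at 0 vanishes, and the quadratic weight brings in the sum of n^2
  \<open>gf_coeff n\<close>.\<close>

lemma gf_coeff_quadratic_sums:
  "(\<lambda>n. (2 * real n ^ 2 + 13/4 * real n - 3/4) * gf_coeff n) sums 0"
proof -
  define u where "u n = real n * (real n + 2) * (real n + 3) * gf_coeff n" for n
  have "(\<lambda>n. real n ^ 3 * gf_coeff n + 5 * (real n ^ 2 * gf_coeff n) + 6 * (real n ^ 1 * gf_coeff n)) \<longlonglongrightarrow> 0 + 5 * 0 + 6 * 0"
    by (intro tendsto_intros gf_coeff_decay) auto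
  then have "u \<longlonglongrightarrow> 0"
    unfolding u_def by (simp add: algebra_simps power2_eq_square power3_eq_cube)
  from telescope_sums'[OF this] have "(\<lambda>n. u n - u (Suc n)) sums 0" by (simp add: u_def)
  also have "(\<lambda>n. u n - u (Suc n)) = (\<lambda>n. (2 * real n ^ 2 + 13/4 * real n - 3/4) * gf_coeff n)"
  proof
    fix n
    have "u (Suc n) = (real n + 1) * ((real n + 3) * (real n + 4) * gf_coeff (Suc n))"
      by (simp add: u_def algebra_simps)
    also have "\<dots> = (real n + 1) * (real n ^ 2 + 2 * real n + 3/4) * gf_coeff n"
      unfolding gf_coeff_Suc by (simp add: power2_eq_square algebra_simps)
    finally show "u n - u (Suc n) = (2 * real n ^ 2 + 13/4 * real n - 3/4) * gf_coeff n"
      by (simp add: u_def power2_eq_square ring_distribs mult_ac add_divide_distrib)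
  qed
  finally show ?thesis .
qed

lemma summable_gf_coeff:
  assumes "k \<le> 3"
  shows "summable (\<lambda>n. real n ^ k * gf_coeff n)"
proof -
  obtain C where C: "C > 0" "\<And>n. real n ^ 5 * gf_coeff n \<le> C"
    using gf_coeff_bound by blast
  have "norm (real n ^ k * gf_coeff n) \<le> C * inverse (real n ^ 2)" if "n \<ge> 1" for n
  proof -
    have "real n ^ k * gf_coeff n \<le> real n ^ 3 * gf_coeff n"
      using that assms less_imp_le[OF gf_coeff_pos[of n]] by (intro mult_right_mono power_increasing) auto
    also have "\<dots> \<le> C * inverse (real n ^ 2)"
    proof -
      have "(real n ^ 3 * gf_coeff n) * real n ^ 2 = real n ^ 5 * gf_coeff n"
        by (simp add: eval_nat_numeral)
      also have "\<dots> \<le> C" by (rule C(2))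
      finally show ?thesis using that by (simp add: pos_le_divide_eq flip: divide_inverse)
    qed
    finally show ?thesis using gf_coeff_pos[of n] by simp
  qed
  moreover have "summable (\<lambda>n. C * inverse (real n ^ 2))"
    by (intro summable_mult inverse_power_summable) auto
  ultimately show ?thesis
    by (rule summable_comparison_test'[where N = 1, rotated])
qed

text \<open>In the scaled variable these are F, Z F' and (Z d/dZ)^2 F at Z = 1. In the original
  variable \<open>gf_sum\<close> is F_0 and \<open>gf_sum1\<close> is rho F'(rho).\<close>

definition gf_sum :: real where "gf_sum = (\<Sum>n. gf_coeff n)"
definition gf_sum1 :: real where "gf_sum1 = (\<Sum>n. real n * gf_coeff n)"
definition gf_sum2 :: real where "gf_sum2 = (\<Sum>n. real n ^ 2 * gf_coeff n)"

lemma gf_sum_sums: "gf_coeff sums gf_sum"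
  and gf_sum1_sums: "(\<lambda>n. real n * gf_coeff n) sums gf_sum1"
  and gf_sum2_sums: "(\<lambda>n. real n ^ 2 * gf_coeff n) sums gf_sum2"
  using summable_gf_coeff[of 0] summable_gf_coeff[of 1] summable_gf_coeff[of 2]
  by (auto simp: gf_sum_def gf_sum1_def gf_sum2_def summable_sums)

lemma gf_sum1_eq: "gf_sum1 = 2 - 7/4 * gf_sum"
proof -
  have "(\<lambda>n. 3 * (real n * gf_coeff n) + 21/4 * gf_coeff n) sums (3 * gf_sum1 + 21/4 * gf_sum)"
    by (intro sums_add sums_mult gf_sum_sums gf_sum1_sums)
  moreover have "(\<lambda>n. 3 * (real n * gf_coeff n) + 21/4 * gf_coeff n) sums 6"
    using gf_coeff_tail_sums[of 0] by (simp add: algebra_simps gf_coeff_0)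
  ultimately have "3 * gf_sum1 + 21/4 * gf_sum = 6" by (rule sums_unique2)
  then show ?thesis by simp
qed

lemma gf_sum2_eq: "gf_sum2 = 3/8 * gf_sum - 13/8 * gf_sum1"
proof -
  have "(\<lambda>n. 2 * (real n ^ 2 * gf_coeff n) + 13/4 * (real n * gf_coeff n) - 3/4 * gf_coeff n) sums
      (2 * gf_sum2 + 13/4 * gf_sum1 - 3/4 * gf_sum)"
    by (intro sums_add sums_diff sums_mult gf_sum_sums gf_sum1_sums gf_sum2_sums)
  moreover have "(\<lambda>n. 2 * (real n ^ 2 * gf_coeff n) + 13/4 * (real n * gf_coeff n) - 3/4 * gf_coeff n) sums 0"
    using gf_coeff_quadratic_sums by (simp add: algebra_simps)
  ultimately have "2 * gf_sum2 + 13/4 * gf_sum1 - 3/4 * gf_sum = 0" by (rule sums_unique2)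
  then show ?thesis by simp
qed

text \<open>The bound replaces the weights 3 n + 21/4 of the exact tail identity by the smallest
  one, at n = N.\<close>

lemma gf_coeff_tail:
  "(\<lambda>n. gf_coeff (n + N)) sums (gf_sum - sum gf_coeff {..<N})"
  "gf_sum - sum gf_coeff {..<N} \<le> (real N + 2) * (real N + 3) * gf_coeff N / (3 * real N + 21/4)"
proof -
  show *: "(\<lambda>n. gf_coeff (n + N)) sums (gf_sum - sum gf_coeff {..<N})"
    using gf_sum_sums by (simp add: sums_iff_shift)
  have "(3 * real N + 21/4) * (gf_sum - sum gf_coeff {..<N}) \<le> (real N + 2) * (real N + 3) * gf_coeff N"
    by (rule sums_le[OF _ sums_mult[OF *] gf_coeff_tail_sums])
       (use gf_coeff_pos in \<open>auto intro!: mult_right_mono simp: less_imp_le\<close>)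
  then show "gf_sum - sum gf_coeff {..<N} \<le> (real N + 2) * (real N + 3) * gf_coeff N / (3 * real N + 21/4)"
    by (simp add: field_simps)
qed

text \<open>This precision is what the inequalities on the circle consume, through
  \<open>gf_sum1_eq\<close> and \<open>gf_sum2_eq\<close>. Six terms give the lower bound; the tail
  bound at N = 6 is added for the upper one.\<close>

lemma gf_sum_bounds: "10794/10000 \<le> gf_sum" "gf_sum \<le> 10804/10000"
proof -
  have rec: "gf_coeff (Suc n) = (real n + 1/2) * (real n + 3/2) / ((real n + 3) * (real n + 4)) * gf_coeff n" for n
    using gf_coeff_Suc[of n] by (simp add: nonzero_eq_divide_eq add_nonneg_eq_0_iff mult.commute)
  have s: "sum gf_coeff {..<6} = 1 + 1/16 + 3/16^2 + 14/16^3 + 84/16^4 + 594/16^5" "gf_coeff 6 = 4719 / 16^6"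
  proof -
    have 1: "gf_coeff (Suc 0) = 1/16" using rec[of 0] by simp
    have 2: "gf_coeff (Suc (Suc 0)) = 3/256" unfolding rec[of "Suc 0"] 1 by simp
    have 3: "gf_coeff (Suc (Suc (Suc 0))) = 14/4096" unfolding rec[of "Suc (Suc 0)"] 2 by simp
    have 4: "gf_coeff (Suc (Suc (Suc (Suc 0)))) = 84/65536" unfolding rec[of "Suc (Suc (Suc 0))"] 3 by simp
    have 5: "gf_coeff (Suc (Suc (Suc (Suc (Suc 0))))) = 594/1048576" unfolding rec[of "Suc (Suc (Suc (Suc 0)))"] 4 by simp
    have 6: "gf_coeff (Suc (Suc (Suc (Suc (Suc (Suc 0)))))) = 4719/16777216"
      unfolding rec[of "Suc (Suc (Suc (Suc (Suc 0))))"] 5 by simp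
    have "sum gf_coeff {..<6} = sum gf_coeff {..<Suc (Suc (Suc (Suc (Suc (Suc 0)))))}"
      by (simp only: numeral_eq_Suc pred_numeral_simps BitM.simps)
    also have "\<dots> = 1 + 1/16 + 3/16^2 + 14/16^3 + 84/16^4 + 594/16^5"
      by (simp only: sum.lessThan_Suc 1 2 3 4 5) simp
    finally show "sum gf_coeff {..<6} = 1 + 1/16 + 3/16^2 + 14/16^3 + 84/16^4 + 594/16^5" .
    have "gf_coeff 6 = 4719/16777216"
      using 6 by (simp only: numeral_eq_Suc pred_numeral_simps BitM.simps)
    then show "gf_coeff 6 = 4719 / 16^6" by simp
  qed
  have "sum gf_coeff {..<6} \<le> gf_sum"
    unfolding gf_sum_def using gf_sum_sums gf_coeff_pos 
    by (intro sum_le_suminf) (auto simp: sums_iff less_imp_le)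
  then show "10794/10000 \<le> gf_sum" unfolding s by simp
  show "gf_sum \<le> 10804/10000"
    using gf_coeff_tail(2)[of 6] unfolding s by simp
qed

section \<open>The closed form of F(1), by Gauss's summation of 2F1(-3/2, -1/2; c; 1)\<close>

definition gauss_term :: "real \<Rightarrow> nat \<Rightarrow> real" where
  "gauss_term c m = pochhammer (-3/2) m * pochhammer (-1/2) m / (pochhammer c m * fact m)"

lemma gauss_term_0 [simp]: "gauss_term c 0 = 1"
  by (simp add: gauss_term_def)

lemma gauss_term_Suc:
  assumes "c > 0"
  shows "(c + real m) * (real m + 1) * gauss_term c (Suc m) = (real m - 3/2) * (real m - 1/2) * gauss_term c m"
proof -
  have "pochhammer c m > 0" "c + real m > 0" using assms by (auto intro: pochhammer_pos)
  moreover have "1 + real m > 0" by simp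
  moreover have "(fact (Suc m) :: real) = (1 + real m) * fact m" by simp
  ultimately show ?thesis
    unfolding gauss_term_def pochhammer_Suc by (simp add: divide_simps del: fact_Suc)
qed

text \<open>F(1) is a 3F2 at 1 with an upper parameter equal to 1, and such a series is the tail of
  a 2F1 that starts two places earlier. Both sides obey the same first-order recurrence.\<close>

lemma gauss_term_gf_coeff: "gauss_term 2 (Suc (Suc n)) = - gf_coeff n / 64"
proof (induction n)
  case 0
  then show ?case by (simp add: gauss_term_def pochhammer_Suc)
next
  case (Suc n)
  define k where "k = real n"
  have k: "k \<ge> 0" by (simp add: k_def)
  have "(k + 4) * (k + 3) * gauss_term 2 (Suc (Suc (Suc n))) = (k + 1/2) * (k + 3/2) * gauss_term 2 (Suc (Suc n))"
    using gauss_term_Suc[of 2 "Suc (Suc n)"] by (simp add: k_def add_ac)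
  also have "\<dots> = - ((k + 1/2) * (k + 3/2) * gf_coeff n) / 64"
    unfolding Suc.IH by simp
  also have "\<dots> = - ((k + 3) * (k + 4) * gf_coeff (Suc n)) / 64"
    unfolding k_def gf_coeff_Suc ..
  finally have "(k + 4) * (k + 3) * gauss_term 2 (Suc (Suc (Suc n))) = (k + 4) * (k + 3) * (- gf_coeff (Suc n) / 64)"
    by (simp add: mult_ac)
  moreover have "(k + 4) * (k + 3) \<noteq> 0" using k by simp
  ultimately show ?case using mult_left_cancel by blast
qed

lemma gauss_term_shift:
  assumes "c > 0"
  shows "(c + real m) * gauss_term (c + 1) m = c * gauss_term c m"
proof -
  have "pochhammer c m > 0" "pochhammer (c + 1) m > 0" using assms by (auto intro: pochhammer_pos)
  moreover have "c * pochhammer (c + 1) m = (c + real m) * pochhammer c m"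
    using pochhammer_rec[of c m] pochhammer_Suc[of c m] by (simp add: mult.commute)
  ultimately show ?thesis
    unfolding gauss_term_def by (simp add: divide_simps)
qed

text \<open>The first factor of (c)_m is c instead of 2, and the others are no smaller than those of
  (2)_m. The factor 2 / c drives \<open>gauss_sum c\<close> to 1 as c grows.\<close>

lemma abs_gauss_term_le:
  assumes "c \<ge> 2" "m > 0"
  shows "\<bar>gauss_term c m\<bar> \<le> 2 / c * \<bar>gauss_term 2 m\<bar>"
proof -
  obtain k where m: "m = Suc k" using assms(2) by (cases m) auto
  have "c * pochhammer 2 m \<le> 2 * pochhammer c m"
  proof -
    have "pochhammer (2 + 1) k \<le> pochhammer (c + 1) k"
      using assms unfolding pochhammer_prod by (intro prod_mono) auto
    then show ?thesis using assms(1) unfolding m pochhammer_rec by simp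
  qed
  moreover have "pochhammer c m > 0" "pochhammer (2::real) m > 0" using assms by (auto intro: pochhammer_pos)
  ultimately have "1 / pochhammer c m \<le> 2 / c * (1 / pochhammer 2 m)"
    using assms by (simp add: field_simps)
  then have "\<bar>pochhammer (-3/2) m * pochhammer (-1/2) m / fact m\<bar> * (1 / pochhammer c m) \<le>
     \<bar>pochhammer (-3/2) m * pochhammer (-1/2) m / fact m\<bar> * (2 / c * (1 / pochhammer 2 m))"
    by (intro mult_left_mono) auto
  then show ?thesis
    using \<open>pochhammer c m > 0\<close> \<open>pochhammer (2::real) m > 0\<close>
    by (simp add: gauss_term_def abs_mult mult_ac)
qed

lemma summable_gauss_term:
  assumes "c \<ge> 2"
  shows "summable (\<lambda>m. \<bar>gauss_term c m\<bar>)" and "(\<lambda>m. real m * gauss_term c m) \<longlonglongrightarrow> 0"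
proof -
  have "summable (\<lambda>n. \<bar>gauss_term 2 (n + 2)\<bar>)"
    using gf_sum_sums gf_coeff_pos
    by (simp add: gauss_term_gf_coeff abs_mult sums_iff less_imp_le summable_divide)
  then have 2: "summable (\<lambda>n. 2 / c * \<bar>gauss_term 2 n\<bar>)"
    using summable_iff_shift[of "\<lambda>n. \<bar>gauss_term 2 n\<bar>" 2] by (intro summable_mult) blast
  show "summable (\<lambda>m. \<bar>gauss_term c m\<bar>)"
    by (rule summable_comparison_test'[OF 2, where N = 1]) (use abs_gauss_term_le assms in auto)
  have "(\<lambda>m. 2 / c * (real (m + 2) * \<bar>gauss_term 2 (m + 2)\<bar>)) \<longlonglongrightarrow> 2 / c * 0"
  proof (intro tendsto_mult tendsto_const)
    have "(\<lambda>m. (real m ^ 1 * gf_coeff m + 2 * (real m ^ 0 * gf_coeff m)) / 64) \<longlonglongrightarrow> (0 + 2 * 0) / 64"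
      by (intro tendsto_intros gf_coeff_decay) auto
    then show "(\<lambda>m. real (m + 2) * \<bar>gauss_term 2 (m + 2)\<bar>) \<longlonglongrightarrow> 0"
      using gf_coeff_pos by (simp add: gauss_term_gf_coeff abs_mult algebra_simps less_imp_le)
  qed
  then have "(\<lambda>m. real (m + 2) * gauss_term c (m + 2)) \<longlonglongrightarrow> 0"
  proof (rule Lim_null_comparison[rotated, OF tendsto_eq_rhs])
    show "\<forall>\<^sub>F m in sequentially. norm (real (m + 2) * gauss_term c (m + 2)) \<le> 2 / c * (real (m + 2) * \<bar>gauss_term 2 (m + 2)\<bar>)"
    proof (intro always_eventually allI)
      fix m
      have "real (m + 2) * \<bar>gauss_term c (m + 2)\<bar> \<le> real (m + 2) * (2 / c * \<bar>gauss_term 2 (m + 2)\<bar>)"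
        by (intro mult_left_mono abs_gauss_term_le assms) auto
      then show "norm (real (m + 2) * gauss_term c (m + 2)) \<le> 2 / c * (real (m + 2) * \<bar>gauss_term 2 (m + 2)\<bar>)"
        by (simp add: abs_mult mult_ac)
    qed
  qed simp
  then show "(\<lambda>m. real m * gauss_term c m) \<longlonglongrightarrow> 0"
    by (rule LIMSEQ_offset)
qed

definition gauss_sum :: "real \<Rightarrow> real" where "gauss_sum c = (\<Sum>m. gauss_term c m)"

lemma gauss_sum_sums: "c \<ge> 2 \<Longrightarrow> gauss_term c sums gauss_sum c"
  unfolding gauss_sum_def using summable_gauss_term(1) summable_rabs_cancel summable_sums by blast

text \<open>Gauss's contiguous relation at argument 1, with the factors c (c - a - b) and (c - a) (c
  - b) for a = -3/2 and b = -1/2. It comes from telescoping c m \<open>gauss_term c m\<close>, which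
  tends to 0.\<close>

lemma gauss_sum_rec:
  assumes "c \<ge> 2"
  shows "c * (c + 2) * gauss_sum c = (c + 3/2) * (c + 1/2) * gauss_sum (c + 1)"
proof -
  have "(\<lambda>m. c * (c + 2) * gauss_term c m - (c + 3/2) * (c + 1/2) * gauss_term (c + 1) m) sums
      (c * (c + 2) * gauss_sum c - (c + 3/2) * (c + 1/2) * gauss_sum (c + 1))"
    using assms by (intro sums_diff sums_mult gauss_sum_sums) auto
  moreover have "(\<lambda>m. c * (c + 2) * gauss_term c m - (c + 3/2) * (c + 1/2) * gauss_term (c + 1) m) sums 0"
  proof -
    have "(\<lambda>m. c * (real m * gauss_term c m)) \<longlonglongrightarrow> c * 0"
      using assms by (intro tendsto_intros summable_gauss_term)
    then have "(\<lambda>m. c * (real m * gauss_term c m)) \<longlonglongrightarrow> 0" by simp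
    from telescope_sums'[OF this]
    have "(\<lambda>m. c * (real m * gauss_term c m) - c * (real (Suc m) * gauss_term c (Suc m))) sums 0" by simp
    moreover have "c * (real m * gauss_term c m) - c * (real (Suc m) * gauss_term c (Suc m)) =
        c * (c + 2) * gauss_term c m - (c + 3/2) * (c + 1/2) * gauss_term (c + 1) m" for m
    proof -
      define k where "k = real m"
      have ck: "c + k > 0" using assms by (simp add: k_def)
      have 1: "(c + k) * ((k + 1) * gauss_term c (Suc m)) = (k - 3/2) * (k - 1/2) * gauss_term c m"
        using gauss_term_Suc[of c m] assms by (simp add: k_def mult_ac)
      have 2: "(c + k) * gauss_term (c + 1) m = c * gauss_term c m"
        using gauss_term_shift[of c m] assms by (simp add: k_def)
      have "(c + k) * (c * (k * gauss_term c m) - c * ((k + 1) * gauss_term c (Suc m))) =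
          c * ((c + k) * k * gauss_term c m - (c + k) * ((k + 1) * gauss_term c (Suc m)))"
        by (simp add: algebra_simps)
      also have "\<dots> = c * (c + 2) * (c + k) * gauss_term c m - (c + 3/2) * (c + 1/2) * (c * gauss_term c m)"
        unfolding 1 by (simp add: ring_distribs mult_ac add_divide_distrib diff_divide_distrib)
      also have "\<dots> = (c + k) * (c * (c + 2) * gauss_term c m - (c + 3/2) * (c + 1/2) * gauss_term (c + 1) m)"
        unfolding 2 [symmetric] by (simp add: right_diff_distrib mult_ac)
      finally show ?thesis using ck by (simp add: k_def add_ac)
    qed
    ultimately show ?thesis by simp
  qed
  ultimately have "c * (c + 2) * gauss_sum c - (c + 3/2) * (c + 1/2) * gauss_sum (c + 1) = 0"
    by (rule sums_unique2)
  then show ?thesis by simp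
qed

lemma gauss_sum_tendsto: "(\<lambda>N. gauss_sum (2 + real N)) \<longlonglongrightarrow> 1"
proof (rule LIM_zero_cancel, rule Lim_null_comparison)
  define K where "K = (\<Sum>m. \<bar>gauss_term 2 (Suc m)\<bar>)"
  have s2: "summable (\<lambda>m. \<bar>gauss_term 2 (Suc m)\<bar>)"
    using summable_gauss_term(1)[of 2] summable_Suc_iff[of "\<lambda>m. \<bar>gauss_term 2 m\<bar>"] by simp
  show "\<forall>\<^sub>F N in sequentially. norm (gauss_sum (2 + real N) - 1) \<le> 2 / (2 + real N) * K"
  proof (intro always_eventually allI)
    fix N
    define c where "c = 2 + real N"
    have c: "c \<ge> 2" by (simp add: c_def)
    have s: "summable (\<lambda>m. \<bar>gauss_term c (Suc m)\<bar>)"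
      using summable_gauss_term(1)[OF c] summable_Suc_iff[of "\<lambda>m. \<bar>gauss_term c m\<bar>"] by simp
    have "gauss_sum c - 1 = (\<Sum>m. gauss_term c (Suc m))"
      using gauss_sum_sums[OF c] by (simp add: sums_iff suminf_split_head)
    also have "norm \<dots> \<le> (\<Sum>m. \<bar>gauss_term c (Suc m)\<bar>)"
      using s by (simp add: summable_rabs)
    also have "\<dots> \<le> (\<Sum>m. 2 / c * \<bar>gauss_term 2 (Suc m)\<bar>)"
      by (intro suminf_le s summable_mult s2 abs_gauss_term_le c) auto
    also have "\<dots> = 2 / c * K"
      unfolding K_def by (rule suminf_mult[OF s2])
    finally show "norm (gauss_sum (2 + real N) - 1) \<le> 2 / (2 + real N) * K"
      by (simp add: c_def)
  qed
  show "(\<lambda>N. 2 / (2 + real N) * K) \<longlonglongrightarrow> 0"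
    by real_asymp
qed

text \<open>N steps of the relation move c from 2 to 2 + N, where the sum tends to 1; the
  accumulated product tends to Gamma(2) Gamma(4) / (Gamma(7/2) Gamma(5/2)).\<close>

lemma gauss_sum_2: "gauss_sum 2 = 64 / (15 * pi)"
proof -
  define P where "P N = pochhammer (7/2::real) N * pochhammer (5/2) N / (pochhammer 2 N * pochhammer 4 N)" for N
  have *: "gauss_sum 2 = P N * gauss_sum (2 + real N)" for N
  proof (induction N)
    case 0
    then show ?case by (simp add: P_def)
  next
    case (Suc N)
    define c where "c = 2 + real N"
    have c: "c \<ge> 2" by (simp add: c_def)
    have pos: "pochhammer (2::real) N > 0" "pochhammer (4::real) N > 0" by (auto intro: pochhammer_pos)
    have "P (Suc N) = P N * ((c + 3/2) * (c + 1/2)) / (c * (c + 2))"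
      using pos c by (simp add: P_def pochhammer_Suc c_def divide_simps)
    moreover have "gauss_sum c = (c + 3/2) * (c + 1/2) / (c * (c + 2)) * gauss_sum (c + 1)"
      using gauss_sum_rec[OF c] c by (simp add: nonzero_eq_divide_eq mult_ac)
    ultimately show ?case unfolding Suc.IH by (simp add: c_def add_ac)
  qed
  have "(\<lambda>N. P (Suc N) * gauss_sum (2 + real (Suc N))) \<longlonglongrightarrow> (Gamma 2 * Gamma 4 * rGamma (7/2) * rGamma (5/2)) * 1"
    using LIMSEQ_pochhammer_ratio[of 2 4 "7/2" "5/2"]
    by (intro tendsto_mult LIMSEQ_Suc[OF gauss_sum_tendsto]) (simp add: P_def)
  then have "gauss_sum 2 = Gamma 2 * Gamma 4 * rGamma (7/2) * rGamma (5/2)"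
    unfolding *[symmetric] by (simp add: LIMSEQ_const_iff)
  also have "\<dots> = 64 / (15 * pi)"
    by (simp add: Gamma_values rGamma_inverse_Gamma divide_simps)
  finally show ?thesis .
qed

text \<open>The two omitted terms 1 and 3/8 of the Gauss series, times 64, give the 88.\<close>

lemma gf_sum_closed_form: "gf_sum = 88 - 4096 / (15 * pi)"
proof -
  have "(\<lambda>n. gauss_term 2 (n + 2)) sums (gauss_sum 2 - (\<Sum>m<2. gauss_term 2 m))"
    using gauss_sum_sums[of 2] by (simp add: sums_iff_shift del: add_2_eq_Suc')
  then have "(\<lambda>n. -64 * gauss_term 2 (n + 2)) sums (-64 * (gauss_sum 2 - (\<Sum>m<2. gauss_term 2 m)))"
    by (rule sums_mult)
  then have "gf_coeff sums (-64 * (gauss_sum 2 - (\<Sum>m<2. gauss_term 2 m)))"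
    by (simp add: gauss_term_gf_coeff)
  then have "gf_sum = -64 * (gauss_sum 2 - (\<Sum>m<2. gauss_term 2 m))"
    using gf_sum_sums sums_unique2 by blast
  then show ?thesis
    by (simp add: gauss_sum_2 numeral_2_eq_2 gauss_term_def)
qed

section \<open>The coefficients as moments of a product of two beta variables\<close>

definition beta_density :: "real \<Rightarrow> real \<Rightarrow> real \<Rightarrow> real" where
  "beta_density a b x = (if 0 < x \<and> x < 1 then x powr (a - 1) * (1 - x) powr (b - 1) / Beta a b else 0)"

definition beta_measure :: "real \<Rightarrow> real \<Rightarrow> real measure" where
  "beta_measure a b = density lborel (\<lambda>x. ennreal (beta_density a b x))"

lemma Beta_real_pos: "a > 0 \<Longrightarrow> b > 0 \<Longrightarrow> Beta a b > (0::real)"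
  by (simp add: Beta_def Gamma_real_pos)

lemma beta_density_measurable [measurable]: "beta_density a b \<in> borel_measurable borel"
  unfolding beta_density_def by measurable

lemma sets_beta_measure [measurable_cong, simp]: "sets (beta_measure a b) = sets borel"
  by (simp add: beta_measure_def)

lemma space_beta_measure [simp]: "space (beta_measure a b) = UNIV"
  by (simp add: beta_measure_def)

lemma Beta_shift:
  fixes a b :: real
  assumes "a > 0" "b > 0"
  shows "Beta (a + real n) b = pochhammer a n / pochhammer (a + b) n * Beta a b"
proof -
  have "Gamma (x + real n) = pochhammer x n * Gamma x" if "x > 0" for x :: real
  proof -
    have "x \<notin> \<int>\<^sub>\<le>\<^sub>0" using nonpos_Ints_nonpos[of x] that by auto
    from pochhammer_Gamma[OF this, of n] Gamma_real_pos[OF that] show ?thesis by simp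
  qed
  from this[of a] this[of "a + b"] assms
  have "Gamma (a + real n) = pochhammer a n * Gamma a" "Gamma (a + real n + b) = pochhammer (a + b) n * Gamma (a + b)"
    by (simp_all add: add_ac)
  then show ?thesis by (simp add: Beta_def)
qed

text \<open>The absolute value keeps the integrand nonnegative and multiplicative on the whole line,
  so the moments of a product of two variables factor inside \<open>ennreal\<close>.\<close>

lemma beta_measure_moment:
  assumes "a > 0" "b > 0"
  shows "(\<integral>\<^sup>+x. ennreal (\<bar>x\<bar> ^ n) \<partial>beta_measure a b) = ennreal (pochhammer a n / pochhammer (a + b) n)"
proof -
  have B: "Beta a b > 0" by (intro Beta_real_pos assms)
  let ?f = "\<lambda>x. if x \<in> {0<..<1} then x powr (a + real n - 1) * (1 - x) powr (b - 1) / Beta a b else 0"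
  have "((\<lambda>x. x powr (a + real n - 1) * (1 - x) powr (b - 1)) has_integral Beta (a + real n) b) {0<..<1}"
    using has_integral_Beta_real[of "a + real n" b] assms by (simp add: has_integral_Icc_iff_Ioo)
  then have "((\<lambda>x. x powr (a + real n - 1) * (1 - x) powr (b - 1) / Beta a b) has_integral Beta (a + real n) b / Beta a b) {0<..<1}"
    by (rule has_integral_divide)
  then have int: "(?f has_integral Beta (a + real n) b / Beta a b) UNIV"
    by (simp only: has_integral_restrict_UNIV)
  have "(\<integral>\<^sup>+x. ennreal (\<bar>x\<bar> ^ n) \<partial>beta_measure a b) = (\<integral>\<^sup>+x. ennreal (?f x) \<partial>lborel)"
    unfolding beta_measure_def
  proof (subst nn_integral_density, (measurable; fail), measurable, rule nn_integral_cong)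
    fix x :: real
    show "ennreal (beta_density a b x) * ennreal (\<bar>x\<bar> ^ n) = ennreal (?f x)"
    proof (cases "0 < x \<and> x < 1")
      case True
      have "x powr (a + real n - 1) = x powr (a - 1) * x ^ n"
        using True by (simp add: powr_realpow [symmetric] flip: powr_add) (simp add: algebra_simps)
      with True B show ?thesis
        by (simp add: beta_density_def ennreal_mult' [symmetric] mult_ac)
    qed (auto simp: beta_density_def)
  qed
  also have "\<dots> = ennreal (Beta (a + real n) b / Beta a b)"
    using B by (intro nn_integral_has_integral_lborel int) auto
  finally show ?thesis using B by (simp add: Beta_shift assms)
qed

lemma AE_beta_measure: "AE x in beta_measure a b. 0 < x \<and> x < 1"
  unfolding beta_measure_def by (subst AE_density) (auto simp: beta_density_def)

lemma finite_measure_beta_measure: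
  assumes "a > 0" "b > 0"
  shows "finite_measure (beta_measure a b)"
  using beta_measure_moment[OF assms, of 0] by (intro finite_measureI) simp

text \<open>(1/2)_n / (3)_n and (3/2)_n / (4)_n are the moments of Beta(1/2, 5/2) and Beta(3/2,
  5/2), and moments of independent factors multiply.\<close>

lemma gf_coeff_moments:
  "\<exists>M :: real measure. finite_measure M \<and> sets M = sets borel \<and> (AE t in M. 0 < t \<and> t < 1) \<and>
     (\<forall>n. (\<integral>\<^sup>+t. ennreal (\<bar>t\<bar> ^ n) \<partial>M) = ennreal (gf_coeff n))"
proof -
  define M1 M2 where "M1 = beta_measure (1/2) (5/2)" and "M2 = beta_measure (3/2) (5/2)"
  interpret M1: finite_measure M1 unfolding M1_def by (rule finite_measure_beta_measure) auto
  interpret M2: finite_measure M2 unfolding M2_def by (rule finite_measure_beta_measure) auto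
  interpret pair: pair_sigma_finite M1 M2 ..
  have [measurable_cong, simp]: "sets M1 = sets borel" "sets M2 = sets borel" by (simp_all add: M1_def M2_def)
  have [simp]: "space M1 = UNIV" "space M2 = UNIV" by (simp_all add: M1_def M2_def)
  define M where "M = distr (M1 \<Otimes>\<^sub>M M2) borel (\<lambda>z. fst z * snd z)"
  have [simp]: "sets M = sets borel" by (simp add: M_def)
  have "AE t in M. 0 < t \<and> t < 1"
  proof -
    have "AE z in M1 \<Otimes>\<^sub>M M2. 0 < fst z * snd z \<and> fst z * snd z < 1"
    proof (rule pair.AE_pair_measure)
      show "{x \<in> space (M1 \<Otimes>\<^sub>M M2). 0 < fst x * snd x \<and> fst x * snd x < 1} \<in> sets (M1 \<Otimes>\<^sub>M M2)"
        by measurable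
      have 2: "AE y in M2. 0 < y \<and> y < 1" unfolding M2_def by (rule AE_beta_measure)
      have "AE x in M1. 0 < x \<and> x < 1" unfolding M1_def by (rule AE_beta_measure)
      then show "AE x in M1. AE y in M2. 0 < fst (x, y) * snd (x, y) \<and> fst (x, y) * snd (x, y) < 1"
      proof eventually_elim
        case (elim x)
        from 2 show ?case
        proof eventually_elim
          case (elim y)
          with \<open>0 < x \<and> x < 1\<close> have "x * y < 1 * 1" by (intro mult_strict_mono) auto
          with elim \<open>0 < x \<and> x < 1\<close> show ?case by simp
        qed
      qed
    qed
    then show ?thesis unfolding M_def by (subst AE_distr_iff) auto
  qed
  moreover have mom: "(\<integral>\<^sup>+t. ennreal (\<bar>t\<bar> ^ n) \<partial>M) = ennreal (gf_coeff n)" for n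
  proof -
    have "(\<integral>\<^sup>+t. ennreal (\<bar>t\<bar> ^ n) \<partial>M) = (\<integral>\<^sup>+z. ennreal (\<bar>fst z\<bar> ^ n) * ennreal (\<bar>snd z\<bar> ^ n) \<partial>(M1 \<Otimes>\<^sub>M M2))"
      unfolding M_def by (subst nn_integral_distr) (auto simp: abs_mult power_mult_distrib ennreal_mult')
    also have "\<dots> = (\<integral>\<^sup>+x. \<integral>\<^sup>+y. ennreal (\<bar>x\<bar> ^ n) * ennreal (\<bar>y\<bar> ^ n) \<partial>M2 \<partial>M1)"
      by (subst M2.nn_integral_fst [symmetric]) auto
    also have "\<dots> = (\<integral>\<^sup>+x. ennreal (\<bar>x\<bar> ^ n) \<partial>M1) * (\<integral>\<^sup>+y. ennreal (\<bar>y\<bar> ^ n) \<partial>M2)"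
      by (simp add: nn_integral_cmult nn_integral_multc)
    also have "\<dots> = ennreal (gf_coeff n)"
      unfolding M1_def M2_def by (simp add: beta_measure_moment gf_coeff_def pochhammer_pos less_imp_le flip: ennreal_mult)
    finally show ?thesis .
  qed
  moreover from mom[of 0] have "finite_measure M" by (intro finite_measureI) simp
  ultimately show ?thesis using \<open>sets M = sets borel\<close> by blast
qed

section \<open>Lagrange inversion\<close>

lemma fps_compose_mult_nth:
  fixes T g W :: "'a::field fps"
  assumes "fps_nth g 0 = 0"
  shows "fps_nth ((T oo g) * W) N = (\<Sum>k\<le>N. fps_nth T k * fps_nth (g ^ k * W) N)"
proof -
  have "fps_nth (T oo g) j = (\<Sum>k\<le>N. fps_nth T k * fps_nth (g ^ k) j)" if "j \<le> N" for j
    unfolding fps_compose_nth using that startsby_zero_power_prefix[OF assms]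
    by (intro sum.mono_neutral_left) auto
  then have "fps_nth ((T oo g) * W) N = (\<Sum>j=0..N. (\<Sum>k\<le>N. fps_nth T k * fps_nth (g ^ k) j) * fps_nth W (N - j))"
    unfolding fps_mult_nth by (intro sum.cong) auto
  also have "\<dots> = (\<Sum>k\<le>N. \<Sum>j=0..N. fps_nth T k * fps_nth (g ^ k) j * fps_nth W (N - j))"
    unfolding sum_distrib_right by (rule sum.swap)
  also have "\<dots> = (\<Sum>k\<le>N. fps_nth T k * fps_nth (g ^ k * W) N)"
    unfolding fps_mult_nth sum_distrib_left by (simp add: mult_ac)
  finally show ?thesis .
qed

lemma fps_deriv_inverse_power:
  fixes F :: "'a::field_char_0 fps"
  assumes "fps_nth F 0 \<noteq> 0" "k > 0"
  shows "fps_deriv (inverse F ^ k) = - of_nat k * inverse F ^ Suc k * fps_deriv F"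
proof -
  have "fps_deriv (inverse F ^ k) = of_nat k * (- fps_deriv F * (inverse F)\<^sup>2) * inverse F ^ (k - 1)"
    by (simp add: fps_deriv_power fps_inverse_deriv[OF assms(1)] fps_of_nat)
  also have "\<dots> = - of_nat k * (inverse F ^ 2 * inverse F ^ (k - 1)) * fps_deriv F"
    by (simp add: mult_ac)
  also have "inverse F ^ 2 * inverse F ^ (k - 1) = inverse F ^ Suc k"
    using assms(2) by (simp flip: power_add)
  finally show ?thesis .
qed

text \<open>In the expansion of \<open>S' \<circ> g\<close> the terms with \<open>k < n - 1\<close> vanish because they are residues of derivatives.\<close>

lemma lagrange_inversion_square:
  fixes F S :: "'a::field_char_0 fps"
  assumes F0: "fps_nth F 0 \<noteq> 0" and S: "S oo (fps_X * F ^ 2) = F" and n: "n > 0"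
  shows "(1 - 2 * of_nat n) * fps_nth S n = fps_nth (inverse F ^ (2 * n - 1)) n"
proof -
  define u where "u = inverse F"
  define g where "g = fps_X * F ^ 2"
  have uF: "u * F = 1" unfolding u_def using F0 by (rule inverse_mult_eq_1)
  have uFk: "u ^ k * F ^ k = 1" for k using uF by (simp flip: power_mult_distrib)
  have g0: "fps_nth g 0 = 0" by (simp add: g_def)
  have dg: "fps_deriv g = F ^ 2 + 2 * fps_X * F * fps_deriv F"
    by (simp add: g_def fps_deriv_power power2_eq_square algebra_simps fps_of_nat numeral_fps_const)
  \<comment> \<open>With m = n - 1 - k the series is X^k times u^(2m) + 2 X u^(2m+1) F'. For m > 0
    the second summand is -X (u^(2m))' / m, whose m-th coefficient cancels that of u^(2m).\<close>
  have coeff: "fps_nth (g ^ k * (fps_deriv g * u ^ (2 * n))) (n - 1) = (if k = n - 1 then 1 else 0)"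
    if k: "k \<le> n - 1" for k
  proof -
    define m where "m = n - 1 - k"
    have nk: "n = Suc (k + m)" using k n by (simp add: m_def)
    have "g ^ k * (fps_deriv g * u ^ (2 * n)) =
        fps_X ^ k * (u ^ (2 * m) * ((u ^ 2 * F ^ 2) * (u ^ (2 * k) * F ^ (2 * k))) +
          2 * fps_X * (u ^ Suc (2 * m) * (u * F) * (u ^ (2 * k) * F ^ (2 * k)) * fps_deriv F))"
      unfolding dg nk by (simp add: g_def power_mult_distrib power_add power_mult power2_eq_square algebra_simps)
    also have "\<dots> = fps_X ^ k * (u ^ (2 * m) + 2 * fps_X * (u ^ Suc (2 * m) * fps_deriv F))"
      unfolding uF uFk by simp
    finally have "fps_nth (g ^ k * (fps_deriv g * u ^ (2 * n))) (n - 1) =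
        fps_nth (u ^ (2 * m) + 2 * fps_X * (u ^ Suc (2 * m) * fps_deriv F)) m"
      using nk by (simp add: fps_X_power_mult_nth)
    also have "\<dots> = (if k = n - 1 then 1 else 0)"
    proof (cases "m = 0")
      case True
      with nk show ?thesis by (simp add: mult.assoc numeral_fps_const)
    next
      case False
      have "of_nat (2 * m) * (u ^ Suc (2 * m) * fps_deriv F) = - fps_deriv (u ^ (2 * m))"
        using fps_deriv_inverse_power[OF F0, of "2 * m"] False by (simp add: u_def mult_ac)
      then have "fps_nth (of_nat (2 * m) * (u ^ Suc (2 * m) * fps_deriv F)) (m - 1) = - of_nat m * fps_nth (u ^ (2 * m)) m"
        using False by simp
      then have "2 * of_nat m * fps_nth (u ^ Suc (2 * m) * fps_deriv F) (m - 1) = - of_nat m * fps_nth (u ^ (2 * m)) m"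
        by (simp add: fps_of_nat [symmetric] del: of_nat_mult) simp
      then have "of_nat m * (fps_nth (u ^ (2 * m)) m + 2 * fps_nth (u ^ Suc (2 * m) * fps_deriv F) (m - 1)) = 0"
        by (simp add: algebra_simps)
      then have "fps_nth (u ^ (2 * m)) m + 2 * fps_nth (u ^ Suc (2 * m) * fps_deriv F) (m - 1) = 0"
        using False by simp
      moreover have "fps_nth (2 * fps_X * (u ^ Suc (2 * m) * fps_deriv F)) m = 2 * fps_nth (u ^ Suc (2 * m) * fps_deriv F) (m - 1)"
        using False by (simp add: mult.assoc numeral_fps_const del: power_Suc)
      moreover have "k \<noteq> n - 1" using False by (simp add: m_def)
      ultimately show ?thesis by simp
    qed
    finally show ?thesis .
  qed
  have "fps_deriv F = (fps_deriv S oo g) * fps_deriv g"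
    using fps_compose_deriv[OF g0, of S] S by (simp add: g_def)
  then have "fps_nth (fps_deriv F * u ^ (2 * n)) (n - 1) = fps_nth ((fps_deriv S oo g) * (fps_deriv g * u ^ (2 * n))) (n - 1)"
    by (simp add: mult.assoc)
  also have "\<dots> = (\<Sum>k\<le>n - 1. fps_nth (fps_deriv S) k * (if k = n - 1 then 1 else 0))"
    unfolding fps_compose_mult_nth[OF g0] by (intro sum.cong refl, subst coeff) auto
  also have "\<dots> = of_nat n * fps_nth S n"
    using n by (simp add: if_distrib cong: if_cong)
  finally have 1: "fps_nth (fps_deriv F * u ^ (2 * n)) (n - 1) = of_nat n * fps_nth S n" .
  \<comment> \<open>Up to the factor -(2n - 1), F' F^(-2n) is the derivative of F^(1-2n). This turns
    the coefficient at n - 1 into n times the coefficient at n, and the n cancels.\<close>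
  have "of_nat (2 * n - 1) * (fps_deriv F * u ^ (2 * n)) = - fps_deriv (u ^ (2 * n - 1))"
  proof -
    define j where "j = 2 * n - 1"
    have j: "j > 0" "2 * n = Suc j" using n by (auto simp: j_def)
    have "of_nat j * (fps_deriv F * u ^ Suc j) = - fps_deriv (u ^ j)"
      unfolding u_def fps_deriv_inverse_power[OF F0 j(1)] by (simp add: mult_ac)
    then show ?thesis unfolding j(2) diff_Suc_1 .
  qed
  then have "fps_nth (of_nat (2 * n - 1) * (fps_deriv F * u ^ (2 * n))) (n - 1) = - (of_nat n * fps_nth (u ^ (2 * n - 1)) n)"
    using n by simp
  then have "of_nat (2 * n - 1) * (of_nat n * fps_nth S n) = - (of_nat n * fps_nth (u ^ (2 * n - 1)) n)"
    using 1 by (simp add: fps_of_nat [symmetric])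
  then have "of_nat n * ((1 - 2 * of_nat n) * fps_nth S n) = of_nat n * fps_nth (u ^ (2 * n - 1)) n"
    using n by (simp add: of_nat_diff algebra_simps)
  then show ?thesis using n by (simp add: u_def)
qed

lemma skeleton_count_lagrange:
  assumes "n > 0"
  shows "(1 - 2 * real n) * skeleton_count n = fps_nth (inverse noncrossing3_gf ^ (2 * n - 1)) n"
  using lagrange_inversion_square[OF _ skeleton_gf_eq assms]
  by (simp add: skeleton_count_def noncrossing3_gf_initial)

section \<open>Stieltjes transforms and the lower bound on a circle\<close>

locale finite_borel_measure = finite_measure M for M :: "real measure" +
  assumes sets_M [measurable_cong, simp]: "sets M = sets borel"
begin

text \<open>The kernel 1 / (1 - z t) makes this the generating function of the moments of M on B,
  analytic at 0. The set is an argument because the measure will be cut at 1 - \<delta>.\<close>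

definition stieltjes :: "real set \<Rightarrow> complex \<Rightarrow> complex" where
  "stieltjes B z = (LINT t:B|M. 1 / (1 - z * of_real t))"

definition stieltjes_real :: "real set \<Rightarrow> real \<Rightarrow> real" where
  "stieltjes_real B r = (LINT t:B|M. 1 / (1 - r * t))"

lemma space_M [simp]: "space M = UNIV"
  using sets_eq_imp_space_eq[OF sets_M] by simp

lemma set_integrable_bounded:
  fixes f :: "real \<Rightarrow> 'b::{second_countable_topology, banach}"
  assumes "B \<in> sets borel" "f \<in> borel_measurable borel" "\<And>t. t \<in> B \<Longrightarrow> norm (f t) \<le> K"
  shows "set_integrable M B f"
  unfolding set_integrable_def
proof (rule integrable_const_bound[where B = "max K 0"])
  show "AE t in M. norm (indicator B t *\<^sub>R f t) \<le> max K 0"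
    using assms(3) by (intro AE_I2) (auto simp: indicator_def le_max_iff_disj)
  show "(\<lambda>t. indicator B t *\<^sub>R f t) \<in> borel_measurable M"
    using assms(1,2) by measurable
qed

lemma set_integral_norm_le:
  fixes f :: "real \<Rightarrow> 'b::{second_countable_topology, banach}"
  assumes B: "B \<in> sets borel" and f: "f \<in> borel_measurable borel" and K: "\<And>t. t \<in> B \<Longrightarrow> norm (f t) \<le> K"
    and "K \<ge> 0"
  shows "norm (LINT t:B|M. f t) \<le> K * measure M B"
proof -
  have "norm (LINT t:B|M. f t) \<le> (LINT t:B|M. norm (f t))"
    by (intro set_integral_norm_bound set_integrable_bounded[OF B f K])
  also have "\<dots> \<le> (LINT t:B|M. K)"
    using B f K \<open>K \<ge> 0\<close> by (intro set_integral_mono set_integrable_bounded[where K = K]) auto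
  also have "\<dots> = K * measure M B"
    using B by (simp add: set_lebesgue_integral_def)
  finally show ?thesis .
qed

lemma set_integral_ge_const:
  fixes f :: "real \<Rightarrow> real"
  assumes B: "B \<in> sets borel" and f: "f \<in> borel_measurable borel"
    and K: "\<And>t. t \<in> B \<Longrightarrow> \<bar>f t\<bar> \<le> K" and c: "\<And>t. t \<in> B \<Longrightarrow> c \<le> f t"
  shows "c * measure M B \<le> (LINT t:B|M. f t)"
proof -
  have "c * measure M B = (LINT t:B|M. c)"
    using B by (simp add: set_lebesgue_integral_def)
  also have "\<dots> \<le> (LINT t:B|M. f t)"
    using B f K c by (intro set_integral_mono set_integrable_bounded[where K = "max \<bar>c\<bar> K"]) (auto simp: le_max_iff_disj)
  finally show ?thesis .
qed

end

lemma Re_kernel_ge: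
  fixes t \<tau> :: real and z :: complex
  assumes "0 \<le> t" "t \<le> \<tau>"
  shows "min 1 (1 - \<tau> * Re z) \<le> Re (1 - z * of_real t)"
proof (cases "Re z \<ge> 0")
  case True
  with assms have "t * Re z \<le> \<tau> * Re z" by (intro mult_right_mono)
  then show ?thesis by (simp add: mult.commute)
next
  case False
  with assms have "t * Re z \<le> 0" by (simp add: mult_nonneg_nonpos)
  then show ?thesis by (simp add: mult.commute)
qed

lemma norm_kernel_ge:
  fixes t \<tau> :: real and z :: complex
  assumes "0 \<le> t" "t \<le> \<tau>"
  shows "min 1 (1 - \<tau> * Re z) \<le> norm (1 - z * of_real t)"
  using Re_kernel_ge[OF assms, of z] complex_Re_le_cmod[of "1 - z * of_real t"] by linarith

text \<open>For 0 <= t <= \<tau> the factor 1 - z t has positive real part here. Hence the transform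
  of a nonzero measure on [0, \<tau>] is holomorphic and free of zeros, and its negative powers are
  holomorphic too.\<close>

definition half_plane :: "real \<Rightarrow> complex set" where
  "half_plane \<tau> = {z. \<tau> * Re z < 1}"

lemma open_half_plane: "open (half_plane \<tau>)"
  unfolding half_plane_def by (intro open_Collect_less continuous_intros)

locale stieltjes_support = finite_borel_measure +
  fixes B :: "real set" and \<tau> :: real
  assumes B_borel [measurable, simp]: "B \<in> sets borel" and B_sub: "B \<subseteq> {0..\<tau>}" and \<tau>_pos: "\<tau> > 0"
begin

lemma B_bounds: "t \<in> B \<Longrightarrow> 0 \<le> t \<and> t \<le> \<tau>"
  using B_sub by auto

lemma kernel_integrable:
  assumes "z \<in> half_plane \<tau>"
  shows "set_integrable M B (\<lambda>t. 1 / (1 - z * of_real t))"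
proof (rule set_integrable_bounded)
  fix t assume "t \<in> B"
  define d where "d = min 1 (1 - \<tau> * Re z)"
  have "d > 0" using assms by (simp add: d_def half_plane_def)
  moreover have "d \<le> norm (1 - z * of_real t)"
    unfolding d_def using B_bounds[OF \<open>t \<in> B\<close>] by (intro norm_kernel_ge) auto
  ultimately show "norm (1 / (1 - z * of_real t)) \<le> 1 / d"
    by (simp add: norm_divide frac_le)
qed auto

text \<open>The difference quotient of the kernel minus its derivative is t^2 (w - z) / ((1 - z t)^2
  (1 - w t)). This is O(|w - z|) uniformly in t, since |1 - w t| stays above d / 2 for w near
  z.\<close>

lemma stieltjes_holomorphic: "stieltjes B holomorphic_on half_plane \<tau>"
proof (rule holomorphic_onI)
  fix z assume z: "z \<in> half_plane \<tau>"
  define d where "d = min 1 (1 - \<tau> * Re z)"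
  have d: "d > 0" using z by (simp add: d_def half_plane_def)
  have ge: "d \<le> norm (1 - z * of_real t)" if "t \<in> B" for t
    unfolding d_def using B_bounds[OF that] by (intro norm_kernel_ge) auto
  define D where "D = (LINT t:B|M. of_real t / (1 - z * of_real t)^2)"
  have D_int: "set_integrable M B (\<lambda>t. of_real t / (1 - z * of_real t)^2)"
  proof (rule set_integrable_bounded)
    fix t assume t: "t \<in> B"
    have "d ^ 2 \<le> norm (1 - z * of_real t) ^ 2" using ge[OF t] d by (intro power_mono) auto
    then show "norm (of_real t / (1 - z * of_real t)^2 :: complex) \<le> \<tau> / d ^ 2"
      using B_bounds[OF t] d by (auto simp: norm_divide norm_power intro!: frac_le)
  qed auto
  define K where "K = \<tau>\<^sup>2 / (d ^ 2 * (d / 2)) * measure M B"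
  have bound: "norm ((stieltjes B w - stieltjes B z) / (w - z) - D) \<le> K * norm (w - z)"
    if w: "w \<noteq> z" "norm (w - z) < d / (2 * \<tau>)" for w
  proof -
    have ge_w: "d / 2 \<le> norm (1 - w * of_real t)" if t: "t \<in> B" for t
    proof -
      have "norm ((w - z) * of_real t) = norm (w - z) * t"
        using B_bounds[OF t] by (simp add: norm_mult)
      also have "\<dots> \<le> d / (2 * \<tau>) * \<tau>"
        using B_bounds[OF t] w \<tau>_pos d by (intro mult_mono) auto
      also have "\<dots> = d / 2" using \<tau>_pos by simp
      finally have 1: "norm ((w - z) * of_real t) \<le> d / 2" .
      have "norm (1 - z * of_real t) \<le> norm (1 - w * of_real t) + norm ((w - z) * of_real t)"
        using norm_triangle_ineq[of "1 - w * of_real t" "(w - z) * of_real t"] by (simp add: algebra_simps)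
      with 1 ge[OF t] show ?thesis by simp
    qed
    have w_hp: "set_integrable M B (\<lambda>t. 1 / (1 - w * of_real t))"
    proof (rule set_integrable_bounded)
      fix t assume "t \<in> B"
      then show "norm (1 / (1 - w * of_real t)) \<le> 1 / (d / 2)"
        using ge_w[of t] d by (auto simp only: norm_divide norm_one intro!: frac_le)
    qed auto
    have "(stieltjes B w - stieltjes B z) / (w - z) - D =
        (LINT t:B|M. (1 / (1 - w * of_real t) - 1 / (1 - z * of_real t)) / (w - z) - of_real t / (1 - z * of_real t)^2)"
      unfolding stieltjes_def D_def
      using w_hp kernel_integrable[OF z] D_int
      by (simp add: set_integral_diff)
    also have "norm \<dots> \<le> (\<tau>\<^sup>2 / (d ^ 2 * (d / 2)) * norm (w - z)) * measure M B"
    proof (rule set_integral_norm_le)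
      fix t assume t: "t \<in> B"
      have nz: "1 - w * of_real t \<noteq> 0" "1 - z * of_real t \<noteq> 0"
        using ge[OF t] ge_w[OF t] d by auto
      have "(1 / (1 - w * of_real t) - 1 / (1 - z * of_real t)) / (w - z) - of_real t / (1 - z * of_real t)^2 =
         of_real t ^ 2 * (w - z) / ((1 - z * of_real t)^2 * (1 - w * of_real t))"
        using nz w(1) by (simp add: divide_simps) (simp add: algebra_simps power2_eq_square)
      also have "norm \<dots> = t ^ 2 * norm (w - z) / (norm (1 - z * of_real t) ^ 2 * norm (1 - w * of_real t))"
        by (simp add: norm_divide norm_mult norm_power)
      also have "\<dots> \<le> \<tau>\<^sup>2 * norm (w - z) / (d ^ 2 * (d / 2))"
        using B_bounds[OF t] ge[OF t] ge_w[OF t] d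
        by (intro frac_le mult_mono mult_nonneg_nonneg mult_pos_pos power_mono) auto
      finally show "norm ((1 / (1 - w * of_real t) - 1 / (1 - z * of_real t)) / (w - z) - of_real t / (1 - z * of_real t)^2)
          \<le> \<tau>\<^sup>2 / (d ^ 2 * (d / 2)) * norm (w - z)" by (simp add: mult_ac)
    qed (use d in auto)
    finally show ?thesis by (simp add: K_def mult_ac)
  qed
  have "((\<lambda>w. (stieltjes B w - stieltjes B z) / (w - z)) \<longlongrightarrow> D) (at z)"
  proof (rule LIM_zero_cancel, rule Lim_null_comparison)
    have "\<forall>\<^sub>F w in at z. w \<in> ball z (d / (2 * \<tau>))"
      using d \<tau>_pos by (intro eventually_at_in_open') auto
    then show "\<forall>\<^sub>F w in at z. norm ((stieltjes B w - stieltjes B z) / (w - z) - D) \<le> K * norm (w - z)"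
      using eventually_neq_at_within[of z z UNIV]
    proof eventually_elim
      case (elim w)
      then show ?case by (intro bound) (auto simp: dist_norm norm_minus_commute)
    qed
    show "((\<lambda>w. K * norm (w - z)) \<longlongrightarrow> 0) (at z)"
      by (intro tendsto_eq_intros) auto
  qed
  then have "(stieltjes B has_field_derivative D) (at z)"
    by (simp add: has_field_derivative_iff)
  then show "stieltjes B field_differentiable at z within half_plane \<tau>"
    by (auto simp: field_differentiable_def intro: has_field_derivative_at_within)
qed

lemma set_integrable_sum:
  fixes f :: "'i \<Rightarrow> real \<Rightarrow> complex"
  assumes "\<And>i. i \<in> I \<Longrightarrow> set_integrable M B (f i)"
  shows "set_integrable M B (\<lambda>t. \<Sum>i\<in>I. f i t)"
  using assms unfolding set_integrable_def scaleR_sum_right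
  by (intro Bochner_Integration.integrable_sum)

lemma stieltjes_sums:
  assumes z: "norm z * \<tau> < 1"
  shows "(\<lambda>n. of_real (LINT t:B|M. t ^ n) * z ^ n) sums stieltjes B z"
proof -
  define q where "q = norm z * \<tau>"
  have q: "0 \<le> q" "q < 1" using z \<tau>_pos by (auto simp: q_def)
  have zt: "norm (z * of_real t) \<le> q" if "t \<in> B" for t
    using B_bounds[OF that] by (auto simp: q_def norm_mult intro!: mult_left_mono)
  have ge: "1 - q \<le> norm (1 - z * of_real t)" if "t \<in> B" for t
    using zt[OF that] norm_triangle_ineq2[of 1 "z * of_real t"] by simp
  have int_z: "set_integrable M B (\<lambda>t. 1 / (1 - z * of_real t))"
  proof (rule set_integrable_bounded)
    fix t assume "t \<in> B"
    then show "norm (1 / (1 - z * of_real t)) \<le> 1 / (1 - q)"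
      using ge[of t] q by (auto simp only: norm_divide norm_one intro!: frac_le)
  qed auto
  have int_pow: "set_integrable M B (\<lambda>t. of_real t ^ k * z ^ k)" for k
  proof (rule set_integrable_bounded)
    fix t assume "t \<in> B"
    then show "norm (of_real t ^ k * z ^ k) \<le> q ^ k"
      using zt[of t] by (simp add: norm_mult norm_power mult.commute flip: power_mult_distrib) (auto intro!: power_mono)
  qed auto
  have "norm (stieltjes B z - (\<Sum>k<n. of_real (LINT t:B|M. t ^ k) * z ^ k)) \<le> q ^ n / (1 - q) * measure M B" for n
  proof -
    have "(\<Sum>k<n. of_real (LINT t:B|M. t ^ k) * z ^ k) = (\<Sum>k<n. (LINT t:B|M. of_real t ^ k * z ^ k))"
      by (intro sum.cong refl) (simp add: set_integral_complex_of_real [symmetric])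
    also have "\<dots> = (LINT t:B|M. (\<Sum>k<n. of_real t ^ k * z ^ k))"
      using int_pow unfolding set_lebesgue_integral_def set_integrable_def scaleR_sum_right
      by (intro Bochner_Integration.integral_sum [symmetric]) auto
    finally have sum_eq: "(\<Sum>k<n. of_real (LINT t:B|M. t ^ k) * z ^ k) = (LINT t:B|M. (\<Sum>k<n. of_real t ^ k * z ^ k))" .
    have "stieltjes B z - (\<Sum>k<n. of_real (LINT t:B|M. t ^ k) * z ^ k) =
        (LINT t:B|M. 1 / (1 - z * of_real t) - (\<Sum>k<n. of_real t ^ k * z ^ k))"
      unfolding stieltjes_def sum_eq
      by (rule set_integral_diff(2) [symmetric, OF int_z set_integrable_sum]) (rule int_pow)
    also have "norm \<dots> \<le> q ^ n / (1 - q) * measure M B"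
    proof (rule set_integral_norm_le)
      fix t assume t: "t \<in> B"
      have nz: "1 - z * of_real t \<noteq> 0" using ge[OF t] q by auto
      have "(\<Sum>k<n. of_real t ^ k * z ^ k) = (\<Sum>k<n. (z * of_real t) ^ k)"
        by (simp add: power_mult_distrib mult.commute)
      also have "\<dots> = (1 - (z * of_real t) ^ n) / (1 - z * of_real t)"
        using nz by (subst sum_gp_strict) auto
      finally have "(\<Sum>k<n. of_real t ^ k * z ^ k) = (1 - (z * of_real t) ^ n) / (1 - z * of_real t)" .
      then have "1 / (1 - z * of_real t) - (\<Sum>k<n. of_real t ^ k * z ^ k) = (z * of_real t) ^ n / (1 - z * of_real t)"
        by (simp add: diff_divide_distrib)
      also have "norm \<dots> \<le> q ^ n / (1 - q)"
        using ge[OF t] zt[OF t] q unfolding norm_divide norm_power by (intro frac_le power_mono) auto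
      finally show "norm (1 / (1 - z * of_real t) - (\<Sum>k<n. of_real t ^ k * z ^ k)) \<le> q ^ n / (1 - q)" .
    qed (use q in auto)
    finally show ?thesis .
  qed
  then have bound: "\<forall>\<^sub>F n in sequentially. norm (stieltjes B z - (\<Sum>k<n. of_real (LINT t:B|M. t ^ k) * z ^ k)) \<le> q ^ n / (1 - q) * measure M B"
    by (rule always_eventually[OF allI])
  have "(\<lambda>n. q ^ n / (1 - q) * measure M B) \<longlonglongrightarrow> 0 / (1 - q) * measure M B"
    using q by (intro tendsto_intros LIMSEQ_power_zero) auto
  then have "(\<lambda>n. q ^ n / (1 - q) * measure M B) \<longlonglongrightarrow> 0" by simp
  from Lim_null_comparison[OF bound this]
  have "(\<lambda>n. stieltjes B z - (\<Sum>k<n. of_real (LINT t:B|M. t ^ k) * z ^ k)) \<longlonglongrightarrow> 0" .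
  then have "(\<lambda>n. stieltjes B z - (stieltjes B z - (\<Sum>k<n. of_real (LINT t:B|M. t ^ k) * z ^ k))) \<longlonglongrightarrow> stieltjes B z - 0"
    by (intro tendsto_intros)
  then show ?thesis by (simp add: sums_def)
qed

lemma stieltjes_fps_expansion:
  "stieltjes B has_fps_expansion Abs_fps (\<lambda>n. of_real (LINT t:B|M. t ^ n))"
proof (rule has_fps_expansionI)
  have "\<forall>\<^sub>F z in nhds 0. z \<in> ball 0 (1 / \<tau>)"
    using \<tau>_pos by (intro eventually_nhds_in_open) auto
  then show "\<forall>\<^sub>F z in nhds 0. (\<lambda>n. fps_nth (Abs_fps (\<lambda>n. of_real (LINT t:B|M. t ^ n))) n * z ^ n) sums stieltjes B z"
  proof eventually_elim
    case (elim z)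
    then have "norm z * \<tau> < 1" using \<tau>_pos by (simp add: field_simps)
    then show ?case unfolding fps_nth_Abs_fps by (rule stieltjes_sums)
  qed
qed

text \<open>Re (1 / v) = Re v / |v|^2 is bounded below by a positive constant on B. This is the
  source of the nonvanishing of F and F1.\<close>

lemma Re_stieltjes_pos:
  assumes z: "z \<in> half_plane \<tau>" and "measure M B > 0"
  shows "Re (stieltjes B z) > 0"
proof -
  define d where "d = min 1 (1 - \<tau> * Re z)"
  have d: "d > 0" using z by (simp add: d_def half_plane_def)
  define c where "c = d / (1 + norm z * \<tau>) ^ 2"
  have "1 + norm z * \<tau> > 0" using \<tau>_pos by (simp add: add_pos_nonneg)
  then have c: "c > 0" using d by (simp add: c_def)
  have "Re (stieltjes B z) = (LINT t:B|M. Re (1 / (1 - z * of_real t)))"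
    using kernel_integrable[OF z] unfolding stieltjes_def set_lebesgue_integral_def set_integrable_def
    by (simp flip: integral_Re)
  moreover have "c * measure M B \<le> (LINT t:B|M. Re (1 / (1 - z * of_real t)))"
  proof (rule set_integral_ge_const)
    fix t assume t: "t \<in> B"
    have ge: "d \<le> Re (1 - z * of_real t)" "d \<le> norm (1 - z * of_real t)"
      unfolding d_def using B_bounds[OF t] Re_kernel_ge[of t \<tau> z] norm_kernel_ge[of t \<tau> z] by blast+
    have le: "norm (1 - z * of_real t) \<le> 1 + norm z * \<tau>"
      using norm_triangle_ineq4[of 1 "z * of_real t"] B_bounds[OF t] mult_left_mono[of t \<tau> "norm z"] by (simp add: norm_mult)
    have "\<bar>Re (1 / (1 - z * of_real t))\<bar> \<le> norm (1 / (1 - z * of_real t))" by (rule abs_Re_le_cmod)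
    also have "\<dots> \<le> 1 / d"
      using ge d by (auto simp only: norm_divide norm_one intro!: frac_le)
    finally show "\<bar>Re (1 / (1 - z * of_real t))\<bar> \<le> 1 / d" .
    have "c \<le> Re (1 - z * of_real t) / norm (1 - z * of_real t) ^ 2"
      unfolding c_def using ge le d by (intro frac_le power_mono) auto
    also have "\<dots> = Re (1 / (1 - z * of_real t))"
      by (simp only: Re_divide cmod_power2) simp
    finally show "c \<le> Re (1 / (1 - z * of_real t))" .
  qed auto
  moreover have "c * measure M B > 0" using c assms by simp
  ultimately show ?thesis by linarith
qed

lemma stieltjes_nonzero: "z \<in> half_plane \<tau> \<Longrightarrow> measure M B > 0 \<Longrightarrow> stieltjes B z \<noteq> 0"
  using Re_stieltjes_pos by force

lemma stieltjes_of_real: "stieltjes B (of_real r) = of_real (stieltjes_real B r)"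
  unfolding stieltjes_def stieltjes_real_def by (simp flip: set_integral_complex_of_real)

end

text \<open>
  On the circle through \<open>r\<close> centred at \<open>-2r\<close>, write \<open>z = r(1 - \<omega>)\<close> and \<open>x = Re \<omega>\<close>; then
  \<open>|\<omega>|\<^sup>2 = 6x\<close> and \<open>|z|\<^sup>2 = r\<^sup>2(1 + 4x)\<close>.
\<close>

lemma circle_facts:
  fixes z :: complex and r :: real
  assumes r: "r > 0" and z: "norm (z + 2 * of_real r) = 3 * r"
  defines "x \<equiv> 1 - Re z / r"
  shows "0 \<le> x" "x \<le> 6" "norm z ^ 2 = r ^ 2 * (1 + 4 * x)" "Re z = r * (1 - x)"
    "Re z \<le> r" "r \<le> norm z" "norm z \<le> 5 * r"
proof -
  have Rez: "Re z = r * (1 - x)" using r by (simp add: x_def)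
  then show "Re z = r * (1 - x)" .
  have sq: "(Re z + 2 * r) ^ 2 + Im z ^ 2 = (3 * r) ^ 2"
    using arg_cong[OF z, of "\<lambda>u. u ^ 2"] by (simp add: cmod_power2)
  then show nz: "norm z ^ 2 = r ^ 2 * (1 + 4 * x)"
    unfolding cmod_power2 Rez by (simp add: algebra_simps power2_eq_square)
  have "\<bar>Re z + 2 * r\<bar> \<le> \<bar>3 * r\<bar>"
    using sq zero_le_power2[of "Im z"] unfolding abs_le_square_iff by linarith
  then have "\<bar>r * (1 - x) + 2 * r\<bar> \<le> 3 * r" using r unfolding Rez by simp
  then have "- (3 * r) \<le> r * (1 - x) + 2 * r" "r * (1 - x) + 2 * r \<le> 3 * r"
    by linarith+
  then have "r * x \<le> r * 6" "r * 0 \<le> r * x" by (simp_all add: algebra_simps)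
  then show x: "0 \<le> x" "x \<le> 6" using r mult_le_cancel_left_pos by blast+
  show "Re z \<le> r" using x r by (simp add: Rez mult_left_le)
  have "r ^ 2 * 1 \<le> r ^ 2 * (1 + 4 * x)" "r ^ 2 * (1 + 4 * x) \<le> r ^ 2 * 5 ^ 2"
    using x by (intro mult_left_mono; simp)+
  then have "r ^ 2 \<le> norm z ^ 2" "norm z ^ 2 \<le> (5 * r) ^ 2" by (simp_all add: nz power_mult_distrib)
  then show "r \<le> norm z" "norm z \<le> 5 * r" using r by (auto intro: power2_le_imp_le)
qed

text \<open>With s = 1 - p one has |1 - z t|^2 = s^2 + 2 s p x + 6 p^2 x >= s^2. Putting s^2 for
  this denominator in the exact difference from 1 / s leaves a bound linear in x, ready for
  integration over t.\<close>

lemma kernel_on_circle: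
  fixes z :: complex and r t :: real
  assumes r: "r > 0" and z: "norm (z + 2 * of_real r) = 3 * r" and t: "0 \<le> t" "r * t < 1"
  defines "x \<equiv> 1 - Re z / r" and "p \<equiv> r * t"
  shows "Re (1 - z * of_real t) = 1 - p + p * x"
    and "Re (1 / (1 - z * of_real t)) \<ge> 1 / (1 - p) - (p / (1 - p)^2 + 6 * (p ^ 2 / (1 - p)^3)) * x"
proof -
  note c = circle_facts[OF r z, folded x_def]
  have p: "0 \<le> p" "p < 1" using r t by (auto simp: p_def)
  define s where "s = 1 - p"
  have s: "s > 0" "p = 1 - s" using p by (auto simp: s_def)
  have re: "Re (1 - z * of_real t) = s + p * x"
    by (simp add: s_def p_def c(4) algebra_simps)
  then show "Re (1 - z * of_real t) = 1 - p + p * x" by (simp add: s_def)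
  have "norm (1 - z * of_real t) ^ 2 = (1 - t * Re z) ^ 2 + (t * Im z) ^ 2"
    by (simp add: cmod_power2 mult.commute)
  also have "\<dots> = 1 - 2 * t * Re z + t ^ 2 * norm z ^ 2"
    by (simp only: cmod_power2) (simp add: algebra_simps power2_eq_square)
  also have "\<dots> = s ^ 2 + 2 * s * p * x + 6 * p ^ 2 * x"
    unfolding c(3,4) by (simp add: s_def p_def algebra_simps power2_eq_square)
  finally have D: "norm (1 - z * of_real t) ^ 2 = s ^ 2 + 2 * s * p * x + 6 * p ^ 2 * x" .
  define D where "D = s ^ 2 + 2 * s * p * x + 6 * p ^ 2 * x"
  have D_ge: "s ^ 2 \<le> D" using s p c by (simp add: D_def)
  have D_pos: "D > 0" using D_ge s by (smt (verit) zero_less_power)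
  have "1 / s - (s + p * x) / D = (s * p * x + 6 * p ^ 2 * x) / (s * D)"
    using s D_pos by (simp add: field_simps) (simp add: D_def power2_eq_square algebra_simps)
  also have "\<dots> \<le> (s * p * x + 6 * p ^ 2 * x) / (s * s ^ 2)"
    using s p c D_ge by (intro divide_left_mono mult_left_mono mult_pos_pos D_pos) auto
  also have "\<dots> = (p / s^2 + 6 * (p ^ 2 / s^3)) * x"
    using s by (simp add: field_simps power2_eq_square power3_eq_cube)
  finally have "1 / s - (p / s^2 + 6 * (p ^ 2 / s^3)) * x \<le> (s + p * x) / D" by simp
  also have "\<dots> = Re (1 / (1 - z * of_real t))"
    unfolding Re_divide using re D by (simp add: D_def cmod_power2)
  finally show "Re (1 / (1 - z * of_real t)) \<ge> 1 / (1 - p) - (p / (1 - p)^2 + 6 * (p ^ 2 / (1 - p)^3)) * x"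
    by (simp add: s_def)
qed

text \<open>To first order, q^2 gains 4 x while m^4 loses a relative 4 (K / G) x. As K / G is below
  1/2, the gain prevails up to x = 45/100.\<close>

lemma circle_inequality_near:
  fixes G K m x q :: real
  assumes "G \<ge> 99/100" "K \<le> 4852/10000" "0 \<le> x" "x \<le> 45/100" "G - K * x \<le> m" "q ^ 2 = 1 + 4 * x" "q \<ge> 0"
  shows "G ^ 2 \<le> q * m ^ 2"
proof -
  \<comment> \<open>Slightly above 4852/9900, the largest possible K / G.\<close>
  define b where "b = (4902/10000 :: real)"
  have "K * x \<le> 4852/10000 * x" using assms by (intro mult_right_mono)
  also have "\<dots> \<le> (b * x) * (99/100)" using assms by (simp add: b_def)
  also have "\<dots> \<le> (b * x) * G" using assms by (intro mult_left_mono) (auto simp: b_def)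
  finally have m: "G * (1 - b * x) \<le> m" using assms(5) by (simp add: algebra_simps)
  have bx1: "0 \<le> 1 - b * x" using assms by (simp add: b_def)
  have "1 \<le> (1 - b * x) ^ 4 * (1 + 4 * x)"
  proof -
    \<comment> \<open>x h is (1 - b x)^4 (1 + 4 x) - 1 without the nonnegative part b^4 x^4 (1 + 4
      x). The tangent of x^2 at 45/100 and the chord of x^3 over [0, 45/100] make h >= 0 a linear
      question.\<close>
    define h where "h = (4 - 4 * b) + (6 * b^2 - 16 * b) * x + (24 * b^2 - 4 * b^3) * x^2 - 16 * b^3 * x^3"
    have x2: "x ^ 2 \<ge> 9/10 * x - 2025/10000" using zero_le_power2[of "x - 45/100"] by (simp add: power2_eq_square algebra_simps)
    have x3: "x ^ 3 \<le> (45/100) ^ 2 * x"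
      using assms power_mono[of x "45/100" 2] mult_right_mono[of "x^2" "(45/100)^2" x] by (simp add: power2_eq_square power3_eq_cube)
    have "h \<ge> 0"
      using x2 x3 assms(3,4) unfolding h_def b_def by (simp add: power2_eq_square power3_eq_cube)
    then have "x * h \<ge> 0" using assms by simp
    moreover have "(1 - b * x) ^ 4 * (1 + 4 * x) = 1 + x * h + b^4 * x^4 * (1 + 4 * x)"
      by (simp add: h_def algebra_simps eval_nat_numeral)
    moreover have "b^4 * x^4 * (1 + 4 * x) \<ge> 0" using assms by (simp add: b_def)
    ultimately show ?thesis by linarith
  qed
  then have "G ^ 4 * 1 \<le> G ^ 4 * ((1 - b * x) ^ 4 * (1 + 4 * x))" by (intro mult_left_mono) auto
  also have "\<dots> = q ^ 2 * (G * (1 - b * x)) ^ 4" by (simp add: assms(6) power_mult_distrib mult_ac)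
  also have "\<dots> \<le> q ^ 2 * m ^ 4" using m bx1 assms by (intro mult_left_mono power_mono) auto
  finally have "(G ^ 2) ^ 2 \<le> (q * m ^ 2) ^ 2" by (simp add: power_mult_distrib flip: power_mult)
  then show ?thesis by (rule power2_le_imp_le) (use assms in auto)
qed

text \<open>Here p0 is the mass and E the excess of the value at r over it. The worst case is p0 =
  99/100, E = 85/1000, where (p0 - q E) / (p0 + E) equals \<open>v\<close>. The range of q is that
  of sqrt (1 + 4 x) for 45/100 <= x <= 6, with the lower end rounded down.\<close>

lemma circle_inequality_far:
  fixes p0 E m q :: real
  assumes "99/100 \<le> p0" "0 \<le> E" "E \<le> 85/1000" "1673/1000 \<le> q" "q \<le> 5" "p0 - q * E \<le> m"
  shows "(p0 + E) ^ 2 \<le> q * m ^ 2"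
proof -
  define c where "c = (85/1000 :: real)"
  define v where "v = (99/100 - c * q) / (1075/1000)"
  have v: "0 \<le> v" "v \<le> 1" using assms by (auto simp: v_def c_def)
  have "(p0 + E) * v \<le> (p0 + c) * v" using assms v by (intro mult_right_mono) (auto simp: c_def)
  also have "\<dots> = (99/100 + c) * v + (p0 - 99/100) * v" by (simp add: algebra_simps)
  also have "\<dots> \<le> (99/100 - c * q) + (p0 - 99/100) * 1"
    using assms v by (intro add_mono mult_left_mono) (auto simp: v_def c_def)
  also have "\<dots> \<le> p0 - q * E" using mult_left_mono[of E c q] assms by (simp add: c_def mult_ac)
  finally have m: "(p0 + E) * v \<le> m" using assms(6) by linarith
  have "1 \<le> q * v ^ 2"
  proof -
    \<comment> \<open>The cubic q (99/100 - c q)^2 is bounded below by a linear function: q^2 by its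
      chord over [167/100, 5], q^3 by its tangent at 256/100.\<close>
    have q2: "(q - 167/100) * (5 - q) \<ge> 0" using assms by auto
    have q3: "q ^ 3 \<ge> 3 * (256/100)^2 * q - 2 * (256/100)^3"
    proof -
      have "3 * a^2 * q - 2 * a^3 \<le> q^3" if "a \<ge> 0" for a :: real
      proof -
        have "(q - a) ^ 2 * (q + 2 * a) \<ge> 0" using assms that by simp
        then show ?thesis by (simp add: power2_eq_square power3_eq_cube algebra_simps)
      qed
      from this[of "256/100"] show ?thesis by simp
    qed
    have q2': "q ^ 2 \<le> 667/100 * q - 835/100" using q2 by (simp add: power2_eq_square field_simps)
    have "(1075/1000)^2 \<le> 9801/10000 * q - 2 * (99/100) * (85/1000) * q^2 + (85/1000)^2 * q^3"
      using q2' q3 assms(4,5) by (simp add: power_divide)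
    also have "\<dots> = q * (99/100 - c * q) ^ 2"
      unfolding c_def by (simp add: power2_eq_square power3_eq_cube algebra_simps)
    finally have "(1075/1000)^2 \<le> q * (99/100 - c * q) ^ 2" .
    moreover have "q * v ^ 2 = q * (99/100 - c * q) ^ 2 / (1075/1000)^2"
      unfolding v_def power_divide by simp
    ultimately show ?thesis by (simp only: le_divide_eq_1) simp
  qed
  then have "(p0 + E) ^ 2 * 1 \<le> (p0 + E) ^ 2 * (q * v ^ 2)" by (intro mult_left_mono) auto
  also have "\<dots> = q * ((p0 + E) * v) ^ 2" by (simp add: power_mult_distrib)
  also have "\<dots> \<le> q * m ^ 2" using m v assms by (intro mult_left_mono power_mono) auto
  finally show ?thesis by simp
qed

context stieltjes_support
begin

text \<open>For the transform f of M on B these are f(r) - f(0), r f'(r) and r^2 f''(r) / 2.\<close>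

definition excess0 :: "real \<Rightarrow> real" where "excess0 r = (LINT t:B|M. r * t / (1 - r * t))"
definition excess1 :: "real \<Rightarrow> real" where "excess1 r = (LINT t:B|M. r * t / (1 - r * t)^2)"
definition excess2 :: "real \<Rightarrow> real" where "excess2 r = (LINT t:B|M. (r * t)^2 / (1 - r * t)^3)"

lemma real_kernel_integrable:
  assumes r: "r \<ge> 0" "r * \<tau> < 1"
  shows "set_integrable M B (\<lambda>t. (r * t) ^ j / (1 - r * t) ^ k)"
proof (rule set_integrable_bounded)
  fix t assume t: "t \<in> B"
  have "r * t \<le> r * \<tau>" "r * t \<ge> 0" using B_bounds[OF t] r by (auto intro!: mult_left_mono)
  moreover have "0 < 1 - r * \<tau>" using r by simp
  ultimately show "norm ((r * t) ^ j / (1 - r * t) ^ k) \<le> 1 / (1 - r * \<tau>) ^ k"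
    using r by (auto simp: norm_divide intro!: frac_le power_mono power_le_one)
qed auto

lemma stieltjes_real_eq:
  assumes r: "r \<ge> 0" "r * \<tau> < 1"
  shows "stieltjes_real B r = measure M B + excess0 r"
proof -
  have 1: "set_integrable M B (\<lambda>t. 1 :: real)"
    by (rule set_integrable_bounded[where K = 1]) auto
  have "measure M B + excess0 r = (LINT t:B|M. 1) + (LINT t:B|M. r * t / (1 - r * t))"
    unfolding excess0_def by (simp add: set_lebesgue_integral_def)
  also have "\<dots> = (LINT t:B|M. 1 + r * t / (1 - r * t))"
    using 1 real_kernel_integrable[OF r, of 1 1] by (intro set_integral_add(2) [symmetric]) auto
  also have "\<dots> = stieltjes_real B r"
    unfolding stieltjes_real_def
  proof (rule set_lebesgue_integral_cong)
    show "\<forall>t. t \<in> B \<longrightarrow> 1 + r * t / (1 - r * t) = 1 / (1 - r * t)"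
    proof (intro allI impI)
      fix t assume t: "t \<in> B"
      have "r * t \<le> r * \<tau>" using B_bounds[OF t] r by (auto intro!: mult_left_mono)
      then show "1 + r * t / (1 - r * t) = 1 / (1 - r * t)" using r by (simp add: field_simps)
    qed
  qed simp
  finally show ?thesis by simp
qed

text \<open>For x <= 45/100 the linear kernel bound controls how far Re f drops below f(r), f being
  the transform. Further away, |1 - z t| >= 1 - r t gives |f(z) - f(0)| <= q
  \<open>excess0 r\<close>. In both ranges the factor q = |z| / r pays for the loss.\<close>

lemma circle_bound:
  assumes r: "r > 0" "r * \<tau> < 1" and z: "norm (z + 2 * of_real r) = 3 * r"
    and mass: "99/100 \<le> measure M B" and e0: "excess0 r \<le> 85/1000"
    and e12: "excess1 r + 6 * excess2 r \<le> 4852/10000"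
  shows "r * stieltjes_real B r ^ 2 \<le> norm z * norm (stieltjes B z) ^ 2"
proof -
  define x where "x = 1 - Re z / r"
  note c = circle_facts[OF r(1) z, folded x_def]
  define q where "q = norm z / r"
  have q: "q ^ 2 = 1 + 4 * x" "q \<ge> 0" using c(3) r by (auto simp: q_def power_divide)
  have "\<tau> * Re z \<le> \<tau> * r" using \<tau>_pos c(5) by simp
  then have hp: "z \<in> half_plane \<tau>" using r by (simp add: half_plane_def mult.commute)
  have rt: "0 \<le> r * t \<and> r * t < 1" if "t \<in> B" for t
  proof -
    have "r * t \<le> r * \<tau>" using B_bounds[OF that] r by (intro mult_left_mono) auto
    also have "\<dots> < 1" by (rule r)
    finally show ?thesis using B_bounds[OF that] r by simp
  qed
  have r0: "r \<ge> 0" using r by simp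
  have e0_nonneg: "excess0 r \<ge> 0"
    unfolding excess0_def set_lebesgue_integral_def
    by (rule integral_nonneg_AE) (use rt in \<open>auto simp: indicator_def less_imp_le\<close>)
  have G: "stieltjes_real B r = measure M B + excess0 r" by (rule stieltjes_real_eq[OF r0 r(2)])
  have near: "stieltjes_real B r - (excess1 r + 6 * excess2 r) * x \<le> norm (stieltjes B z)"
  proof -
    have i0: "set_integrable M B (\<lambda>t. 1 / (1 - r * t))"
      using real_kernel_integrable[OF r0 r(2), of 0 1] by simp
    have i1: "set_integrable M B (\<lambda>t. r * t / (1 - r * t)^2)"
      using real_kernel_integrable[OF r0 r(2), of 1 2] by simp
    have i2: "set_integrable M B (\<lambda>t. (r * t)^2 / (1 - r * t)^3)"
      using real_kernel_integrable[OF r0 r(2), of 2 3] by simp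
    have i12: "set_integrable M B (\<lambda>t. r * t / (1 - r * t)^2 + 6 * ((r * t)^2 / (1 - r * t)^3))"
      by (intro set_integral_add(1) set_integrable_mult_right i1 i2)
    have "stieltjes_real B r - (excess1 r + 6 * excess2 r) * x =
        (LINT t:B|M. 1 / (1 - r * t) - (r * t / (1 - r * t)^2 + 6 * ((r * t)^2 / (1 - r * t)^3)) * x)"
    proof -
      have "excess1 r + 6 * excess2 r = (LINT t:B|M. r * t / (1 - r * t)^2 + 6 * ((r * t)^2 / (1 - r * t)^3))"
        unfolding excess1_def excess2_def
        by (subst set_integral_add(2)[OF i1 set_integrable_mult_right[OF i2]]) (simp del: times_divide_eq_right)
      then have "(excess1 r + 6 * excess2 r) * x = (LINT t:B|M. (r * t / (1 - r * t)^2 + 6 * ((r * t)^2 / (1 - r * t)^3)) * x)"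
        by (simp del: times_divide_eq_right)
      then show ?thesis
        unfolding stieltjes_real_def
        by (simp only: set_integral_diff(2)[OF i0 set_integrable_mult_left[OF i12]])
    qed
    also have "\<dots> \<le> (LINT t:B|M. Re (1 / (1 - z * of_real t)))"
    proof (rule set_integral_mono)
      show "set_integrable M B (\<lambda>t. 1 / (1 - r * t) - (r * t / (1 - r * t)^2 + 6 * ((r * t)^2 / (1 - r * t)^3)) * x)"
        using i0 i12 by (intro set_integral_diff(1) set_integrable_mult_left)
      show "set_integrable M B (\<lambda>t. Re (1 / (1 - z * of_real t)))"
        using integrable_Re[OF kernel_integrable[OF hp, unfolded set_integrable_def]] unfolding set_integrable_def by simp
    next
      fix t assume t: "t \<in> B"
      show "1 / (1 - r * t) - (r * t / (1 - r * t)^2 + 6 * ((r * t)^2 / (1 - r * t)^3)) * x \<le> Re (1 / (1 - z * of_real t))"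
        unfolding x_def using B_bounds[OF t] rt[OF t] by (intro kernel_on_circle(2)[OF r(1) z]) auto
    qed
    also have "\<dots> = Re (stieltjes B z)"
      using kernel_integrable[OF hp] unfolding stieltjes_def set_lebesgue_integral_def set_integrable_def
      by (simp flip: integral_Re)
    also have "\<dots> \<le> norm (stieltjes B z)" by (rule complex_Re_le_cmod)
    finally show ?thesis .
  qed
  have far: "measure M B - q * excess0 r \<le> norm (stieltjes B z)"
  proof -
    have i0: "set_integrable M B (\<lambda>t. r * t / (1 - r * t))"
      using real_kernel_integrable[OF r0 r(2), of 1 1] by simp
    have i1: "set_integrable M B (\<lambda>t. 1 :: complex)"
      by (rule set_integrable_bounded[where K = 1]) auto
    have diff: "set_integrable M B (\<lambda>t. 1 / (1 - z * of_real t) - 1)"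
      by (intro set_integral_diff(1) kernel_integrable hp i1)
    have "stieltjes B z - of_real (measure M B) = (LINT t:B|M. 1 / (1 - z * of_real t)) - (LINT t:B|M. 1)"
      unfolding stieltjes_def by (simp add: set_lebesgue_integral_def scaleR_conv_of_real)
    also have "\<dots> = (LINT t:B|M. 1 / (1 - z * of_real t) - 1)"
      by (intro set_integral_diff(2) [symmetric] kernel_integrable hp i1)
    also have "norm \<dots> \<le> (LINT t:B|M. norm (1 / (1 - z * of_real t) - 1))"
      by (rule set_integral_norm_bound[OF diff])
    also have "\<dots> \<le> (LINT t:B|M. q * (r * t / (1 - r * t)))"
    proof (rule set_integral_mono)
      show "set_integrable M B (\<lambda>t. norm (1 / (1 - z * of_real t) - 1))"
        by (rule set_integrable_norm[OF diff])
      show "set_integrable M B (\<lambda>t. q * (r * t / (1 - r * t)))"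
        by (intro set_integrable_mult_right i0)
    next
      fix t assume t: "t \<in> B"
      have s: "1 - r * t > 0" using rt[OF t] by simp
      have "1 - r * t \<le> 1 - r * t + r * t * x" using rt[OF t] c by simp
      also have "\<dots> = Re (1 - z * of_real t)"
        unfolding x_def using B_bounds[OF t] rt[OF t] by (intro kernel_on_circle(1)[OF r(1) z, symmetric]) auto
      also have "\<dots> \<le> norm (1 - z * of_real t)" by (rule complex_Re_le_cmod)
      finally have ge: "1 - r * t \<le> norm (1 - z * of_real t)" .
      then have "1 - z * of_real t \<noteq> 0" using s by auto
      then have "1 / (1 - z * of_real t) - 1 = z * of_real t / (1 - z * of_real t)"
        by (simp add: field_simps)
      also have "norm \<dots> = norm z * t / norm (1 - z * of_real t)"
        using B_bounds[OF t] by (simp add: norm_divide norm_mult)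
      also have "\<dots> \<le> norm z * t / (1 - r * t)"
        using ge s B_bounds[OF t] by (intro divide_left_mono mult_pos_pos) auto
      also have "\<dots> = q * (r * t / (1 - r * t))" using r by (simp add: q_def)
      finally show "norm (1 / (1 - z * of_real t) - 1) \<le> q * (r * t / (1 - r * t))" .
    qed
    also have "\<dots> = q * excess0 r" unfolding excess0_def by (rule set_integral_mult_right)
    finally have "norm (stieltjes B z - of_real (measure M B)) \<le> q * excess0 r" .
    then show ?thesis
      using norm_triangle_ineq2[of "of_real (measure M B)" "stieltjes B z"]
      by (simp add: norm_minus_commute)
  qed
  have "stieltjes_real B r ^ 2 \<le> q * norm (stieltjes B z) ^ 2"
  proof (cases "x \<le> 45/100")
    case True
    show ?thesis
      by (rule circle_inequality_near[OF _ e12 c(1) True near q]) (use G mass e0_nonneg in simp)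
  next
    case False
    have "(1673/1000) ^ 2 \<le> q ^ 2" "q ^ 2 \<le> 5 ^ 2"
      using False c q by (auto simp: power2_eq_square)
    then have "1673/1000 \<le> q" "q \<le> 5"
      using q(2) power2_le_imp_le[of "1673/1000" q] power2_le_imp_le[of q 5] by auto
    then show ?thesis
      unfolding G by (intro circle_inequality_far mass e0 e0_nonneg far)
  qed
  then have "r * stieltjes_real B r ^ 2 \<le> r * (q * norm (stieltjes B z) ^ 2)"
    using r by simp
  also have "\<dots> = norm z * norm (stieltjes B z) ^ 2" using r by (simp add: q_def)
  finally show ?thesis .
qed

end

section \<open>Moment sums\<close>

locale gf_measure = finite_borel_measure +
  assumes AE_unit: "AE t in M. 0 < t \<and> t < 1"
    and nn_moments: "(\<integral>\<^sup>+t. ennreal (\<bar>t\<bar> ^ n) \<partial>M) = ennreal (gf_coeff n)"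
begin

lemma moment_integrable: "integrable M (\<lambda>t. t ^ n)"
  and moment_eq: "(\<integral>t. t ^ n \<partial>M) = gf_coeff n"
proof -
  have 1: "(\<integral>\<^sup>+t. ennreal (norm (t ^ n)) \<partial>M) = ennreal (gf_coeff n)"
    by (simp add: power_abs nn_moments)
  then show "integrable M (\<lambda>t. t ^ n)" by (intro integrableI_bounded) auto
  have "(\<integral>\<^sup>+t. ennreal (t ^ n) \<partial>M) = (\<integral>\<^sup>+t. ennreal (\<bar>t\<bar> ^ n) \<partial>M)"
    using AE_unit by (intro nn_integral_cong_AE) (auto elim!: eventually_mono)
  then show "(\<integral>t. t ^ n \<partial>M) = gf_coeff n"
    using AE_unit gf_coeff_pos[of n]
    by (subst integral_eq_nn_integral) (auto simp: nn_moments less_imp_le elim!: eventually_mono)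
qed

lemma unit_moment: "(LINT t:{0..<1}|M. t ^ n) = gf_coeff n"
proof -
  have "AE t in M. indicator {0..<1} t *\<^sub>R t ^ n = t ^ n"
    using AE_unit by eventually_elim auto
  then have "(LINT t:{0..<1}|M. t ^ n) = (\<integral>t. t ^ n \<partial>M)"
    unfolding set_lebesgue_integral_def by (intro integral_cong_AE) auto
  then show ?thesis by (simp add: moment_eq)
qed

lemma measure_unit: "measure M {0..<1} = 1"
  using unit_moment[of 0] by (simp add: set_lebesgue_integral_def)

lemma power_set_integrable:
  assumes "B \<in> sets borel" "B \<subseteq> {0..<1}"
  shows "set_integrable M B (\<lambda>t. t ^ n)"
  using assms by (intro set_integrable_bounded[where K = 1]) (auto simp: abs_le_iff power_le_one subset_iff)

lemma sub_moment:
  assumes B: "B \<in> sets borel" "B \<subseteq> {0..<1}"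
  shows "0 \<le> (LINT t:B|M. t ^ n)" "(LINT t:B|M. t ^ n) \<le> gf_coeff n"
proof -
  show "0 \<le> (LINT t:B|M. t ^ n)"
    unfolding set_lebesgue_integral_def
    by (rule Bochner_Integration.integral_nonneg) (use B in \<open>auto simp: indicator_def\<close>)
  have "(LINT t:B|M. t ^ n) \<le> (LINT t:{0..<1}|M. t ^ n)"
    unfolding set_lebesgue_integral_def
  proof (rule integral_mono)
    show "integrable M (\<lambda>t. indicator B t *\<^sub>R t ^ n)" "integrable M (\<lambda>t. indicator {0..<1} t *\<^sub>R t ^ n)"
      using power_set_integrable[OF B, of n] power_set_integrable[of "{0..<1}" n] by (auto simp: set_integrable_def)
    show "indicator B t *\<^sub>R t ^ n \<le> indicator {0..<1} t *\<^sub>R t ^ n" for t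
      using B by (auto simp: indicator_def)
  qed
  then show "(LINT t:B|M. t ^ n) \<le> gf_coeff n" by (simp add: unit_moment)
qed

text \<open>Nonnegative weights let sum and integral change places, and restriction to B only lowers
  the moments. Integrals over B are thus bounded by sums over \<open>gf_coeff\<close>, uniformly in
  B.\<close>

lemma weighted_moments:
  fixes w :: "nat \<Rightarrow> real" and \<phi> :: "real \<Rightarrow> real"
  assumes B: "B \<in> sets borel" "B \<subseteq> {0..<1}"
    and w: "\<And>n. 0 \<le> w n" and \<phi>: "\<And>t. 0 \<le> t \<Longrightarrow> t < 1 \<Longrightarrow> (\<lambda>n. w n * t ^ n) sums \<phi> t"
    and sm: "summable (\<lambda>n. w n * gf_coeff n)"
  shows "set_integrable M B \<phi>" "(\<lambda>n. w n * (LINT t:B|M. t ^ n)) sums (LINT t:B|M. \<phi> t)"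
    "(LINT t:B|M. \<phi> t) \<le> (\<Sum>n. w n * gf_coeff n)"
proof -
  define f where "f n t = indicator B t * (w n * t ^ n)" for n t
  have int: "integrable M (f n)" for n
    using integrable_mult_right[OF power_set_integrable[OF B, unfolded set_integrable_def], of "w n" n]
    by (simp add: f_def [abs_def] mult_ac del: integrable_mult_right_iff)
  have f_nonneg: "0 \<le> f n t" for n t using B w[of n] by (auto simp: f_def indicator_def)
  have int_f: "(\<integral>t. f n t \<partial>M) = w n * (LINT t:B|M. t ^ n)" for n
    unfolding f_def set_lebesgue_integral_def by (simp add: mult_ac flip: integral_mult_right_zero)
  have sums_f: "(\<lambda>n. f n t) sums (indicator B t * \<phi> t)" for t
    using B \<phi>[of t] by (auto simp: f_def indicator_def)
  have sm_f: "AE t in M. summable (\<lambda>n. norm (f n t))"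
    using sums_f f_nonneg by (intro AE_I2) (auto simp: sums_iff)
  have le: "w n * (LINT t:B|M. t ^ n) \<le> w n * gf_coeff n" for n
    using sub_moment(2)[OF B] w by (intro mult_left_mono)
  have "summable (\<lambda>n. w n * (LINT t:B|M. t ^ n))"
    using le w sub_moment(1)[OF B] by (intro summable_comparison_test'[OF sm, where N = 0]) auto
  then have sm_int: "summable (\<lambda>n. \<integral>t. norm (f n t) \<partial>M)"
    using f_nonneg by (simp add: int_f)
  have "(\<lambda>t. \<Sum>n. f n t) = (\<lambda>t. indicator B t * \<phi> t)"
    using sums_f by (auto simp: sums_iff)
  then show "set_integrable M B \<phi>"
    using integrable_suminf[OF int sm_f sm_int] by (simp add: set_integrable_def)
  show s: "(\<lambda>n. w n * (LINT t:B|M. t ^ n)) sums (LINT t:B|M. \<phi> t)"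
    using sums_integral[OF int sm_f sm_int] \<open>(\<lambda>t. \<Sum>n. f n t) = _\<close>
    by (simp add: int_f set_lebesgue_integral_def)
  show "(LINT t:B|M. \<phi> t) \<le> (\<Sum>n. w n * gf_coeff n)"
    by (rule sums_le[OF le s]) (use sm in \<open>rule summable_sums\<close>)
qed

end

lemma geometric_sums_0: "0 \<le> t \<Longrightarrow> t < 1 \<Longrightarrow> (\<lambda>n. 1 * t ^ n) sums (1 / (1 - t))" for t :: real
  using geometric_sums[of t] by simp

lemma geometric_sums_1:
  assumes "0 \<le> t" "t < (1::real)"
  shows "(\<lambda>n. real n * t ^ n) sums (t / (1 - t)^2)"
proof -
  have "(\<lambda>n. real (Suc n) * t ^ n - 1 * t ^ n) sums (1 / (1 - t)^2 - 1 / (1 - t))"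
    using assms geometric_deriv_sums[of t] by (intro sums_diff geometric_sums_0) auto
  moreover have "1 / (1 - t)^2 - 1 / (1 - t) = t / (1 - t)^2"
  proof -
    define s where "s = 1 - t"
    have s: "s \<noteq> 0" "t = 1 - s" using assms by (auto simp: s_def)
    then show ?thesis unfolding s_def [symmetric] s(2) by (simp add: divide_simps power2_eq_square)
  qed
  ultimately show ?thesis by (simp add: algebra_simps)
qed

lemma geometric_sums_2:
  assumes "0 \<le> t" "t < (1::real)"
  shows "(\<lambda>n. (real n ^ 2 - real n) / 2 * t ^ n) sums (t ^ 2 / (1 - t)^3)"
proof -
  have n: "norm t < 1" using assms by simp
  have "(\<lambda>n. \<Sum>i\<le>n. (real (Suc i) * t ^ i) * t ^ (n - i)) sums ((\<Sum>n. real (Suc n) * t ^ n) * (\<Sum>n. t ^ n))"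
    using assms geometric_deriv_sums[of t] geometric_sums[of t]
    by (intro Cauchy_product_sums) (auto simp: sums_iff abs_mult)
  also have "(\<Sum>n. real (Suc n) * t ^ n) = 1 / (1 - t)^2"
    using geometric_deriv_sums[OF n] by (simp add: sums_iff)
  also have "(\<Sum>n. t ^ n) = 1 / (1 - t)"
    using geometric_sums[OF n] by (simp add: sums_iff)
  also have "(\<lambda>n. \<Sum>i\<le>n. (real (Suc i) * t ^ i) * t ^ (n - i)) = (\<lambda>n. (real n + 1) * (real n + 2) / 2 * t ^ n)"
  proof
    fix n
    have "(\<Sum>i\<le>n. (real (Suc i) * t ^ i) * t ^ (n - i)) = (\<Sum>i\<le>n. real (Suc i)) * t ^ n"
      unfolding sum_distrib_right by (intro sum.cong refl) (simp flip: power_add)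
    also have "(\<Sum>i\<le>n. real (Suc i)) = (real n + 1) * (real n + 2) / 2"
      by (induction n) (simp_all add: algebra_simps add_divide_distrib)
    finally show "(\<Sum>i\<le>n. (real (Suc i) * t ^ i) * t ^ (n - i)) = (real n + 1) * (real n + 2) / 2 * t ^ n" .
  qed
  finally have "(\<lambda>n. (real n + 1) * (real n + 2) / 2 * t ^ n - 2 * (real (Suc n) * t ^ n) + 1 * t ^ n) sums
      (1 / (1 - t)^2 * (1 / (1 - t)) - 2 * (1 / (1 - t)^2) + 1 / (1 - t))"
    using assms geometric_deriv_sums[OF n] by (intro sums_add sums_diff sums_mult geometric_sums_0) auto
  moreover have "1 / (1 - t)^2 * (1 / (1 - t)) - 2 * (1 / (1 - t)^2) + 1 / (1 - t) = t ^ 2 / (1 - t)^3"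
  proof -
    define s where "s = 1 - t"
    have s: "s \<noteq> 0" "t = 1 - s" using assms by (auto simp: s_def)
    then show ?thesis unfolding s_def [symmetric] s(2)
      by (simp add: divide_simps power2_eq_square power3_eq_cube) (simp add: algebra_simps)
  qed
  moreover have "(real n + 1) * (real n + 2) / 2 * t ^ n - 2 * (real (Suc n) * t ^ n) + 1 * t ^ n = (real n ^ 2 - real n) / 2 * t ^ n" for n
  proof -
    have "(real n + 1) * (real n + 2) / 2 - 2 * real (Suc n) + 1 = (real n ^ 2 - real n) / 2"
      by (simp add: power2_eq_square field_simps)
    moreover have "a * t ^ n - 2 * (b * t ^ n) + 1 * t ^ n = (a - 2 * b + 1) * t ^ n" for a b
      by (simp add: algebra_simps)
    ultimately show ?thesis by metis
  qed
  ultimately show ?thesis by (simp only:)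
qed

context gf_measure
begin

text \<open>At r = 1 the excess integrands have power series weights 1 (for n > 0), n and n (n - 1)
  / 2. The decay n^(-5) of the moments keeps the integrals finite although the kernels blow up at t
  = 1.\<close>

lemma excess_integrals:
  assumes B: "B \<in> sets borel" "B \<subseteq> {0..<1}"
  shows "set_integrable M B (\<lambda>t. 1 / (1 - t))"
    and "set_integrable M B (\<lambda>t. t / (1 - t))" "(LINT t:B|M. t / (1 - t)) \<le> gf_sum - 1"
    and "set_integrable M B (\<lambda>t. t / (1 - t)^2)" "(LINT t:B|M. t / (1 - t)^2) \<le> gf_sum1"
    and "set_integrable M B (\<lambda>t. t^2 / (1 - t)^3)" "(LINT t:B|M. t^2 / (1 - t)^3) \<le> (gf_sum2 - gf_sum1) / 2"
proof -
  show "set_integrable M B (\<lambda>t. 1 / (1 - t))"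
    using gf_sum_sums by (intro weighted_moments(1)[OF B _ geometric_sums_0]) (auto simp: sums_iff)
  have s0: "(\<lambda>n. (if n = 0 then 0 else 1) * t ^ n) sums (t / (1 - t))" if "0 \<le> t" "t < 1" for t :: real
  proof -
    have "(\<lambda>n. 1 * t ^ n - (if n = 0 then 1 else 0)) sums (1 / (1 - t) - 1)"
      using that by (intro sums_diff geometric_sums_0 sums_single) auto
    moreover have "1 / (1 - t) - 1 = t / (1 - t)" using that by (simp add: field_simps)
    moreover have "(\<lambda>n. 1 * t ^ n - (if n = 0 then 1 else 0)) = (\<lambda>n. (if n = 0 then 0 else 1) * t ^ n)" by auto
    ultimately show ?thesis by simp
  qed
  have s0': "(\<lambda>n. (if n = 0 then 0 else 1) * gf_coeff n) sums (gf_sum - 1)"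
  proof -
    have "(\<lambda>n. gf_coeff n - (if n = 0 then 1 else 0)) sums (gf_sum - 1)"
      by (intro sums_diff gf_sum_sums sums_single)
    moreover have "(\<lambda>n. gf_coeff n - (if n = 0 then 1 else 0)) = (\<lambda>n. (if n = 0 then 0 else 1) * gf_coeff n)" by auto
    ultimately show ?thesis by simp
  qed
  have s2': "(\<lambda>n. (real n ^ 2 - real n) / 2 * gf_coeff n) sums ((gf_sum2 - gf_sum1) / 2)"
    using sums_divide[OF sums_diff[OF gf_sum2_sums gf_sum1_sums], of 2] by (simp add: left_diff_distrib diff_divide_distrib)
  have nn: "0 \<le> (real n ^ 2 - real n) / 2" for n
    by (cases n) (auto simp: power2_eq_square algebra_simps)
  show "set_integrable M B (\<lambda>t. t / (1 - t))" "(LINT t:B|M. t / (1 - t)) \<le> gf_sum - 1"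
    using s0' weighted_moments(1,3)[OF B _ s0] by (auto simp: sums_iff)
  show "set_integrable M B (\<lambda>t. t / (1 - t)^2)" "(LINT t:B|M. t / (1 - t)^2) \<le> gf_sum1"
    using gf_sum1_sums weighted_moments(1,3)[OF B _ geometric_sums_1] by (auto simp: sums_iff)
  show "set_integrable M B (\<lambda>t. t^2 / (1 - t)^3)" "(LINT t:B|M. t^2 / (1 - t)^3) \<le> (gf_sum2 - gf_sum1) / 2"
    using s2' nn weighted_moments(1,3)[OF B nn geometric_sums_2] by (auto simp: sums_iff)
qed

lemma gf_sum_integral: "(LINT t:{0..<1}|M. 1 / (1 - t)) = gf_sum"
proof -
  have "(\<lambda>n. 1 * (LINT t:{0..<1}|M. t ^ n)) sums (LINT t:{0..<1}|M. 1 / (1 - t))"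
    using gf_sum_sums by (intro weighted_moments(2) geometric_sums_0) (auto simp: sums_iff)
  then show ?thesis using gf_sum_sums by (simp add: unit_moment sums_iff)
qed

lemma gf_sum1_integral: "(LINT t:{0..<1}|M. t / (1 - t)^2) = gf_sum1"
proof -
  have "(\<lambda>n. real n * (LINT t:{0..<1}|M. t ^ n)) sums (LINT t:{0..<1}|M. t / (1 - t)^2)"
    using gf_sum1_sums by (intro weighted_moments(2) geometric_sums_1) (auto simp: sums_iff)
  then show ?thesis using gf_sum1_sums by (simp add: unit_moment sums_iff)
qed

text \<open>
  With \<open>\<kappa> = 1/200\<close>, moving the radius from \<open>1\<close> to \<open>1 + \<kappa>\<delta>\<close> changes \<open>1 - rt\<close> by at most the factor
  \<open>1 - \<kappa>\<close> on \<open>t \<le> 1 - \<delta>\<close>.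
\<close>

lemma gf_circle_bound:
  assumes "stieltjes_support M B \<tau>" and B: "B \<subseteq> {0..<1}" and r: "0 < r" "r \<le> 201/200" "r * \<tau> < 1"
    and den: "\<And>t. t \<in> B \<Longrightarrow> 199/200 * (1 - t) \<le> 1 - r * t"
    and mass: "99/100 \<le> measure M B" and z: "norm (z + 2 * of_real r) = 3 * r"
  shows "r * stieltjes_real B r ^ 2 \<le> norm z * norm (stieltjes B z) ^ 2"
proof -
  interpret stieltjes_support M B \<tau> by fact
  note ex = excess_integrals[OF B_borel B]
  have bds: "0 \<le> t \<and> t < 1" if "t \<in> B" for t using B that by auto
  have r0: "0 \<le> r" using r by simp
  have mono: "(LINT t:B|M. (r * t) ^ j / (1 - r * t) ^ k) \<le> (201/200) ^ j / (199/200) ^ k * (LINT t:B|M. t ^ j / (1 - t) ^ k)"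
    if "set_integrable M B (\<lambda>t. t ^ j / (1 - t) ^ k)" for j k
  proof -
    have "(LINT t:B|M. (r * t) ^ j / (1 - r * t) ^ k) \<le> (LINT t:B|M. (201/200) ^ j / (199/200) ^ k * (t ^ j / (1 - t) ^ k))"
    proof (rule set_integral_mono)
      show "set_integrable M B (\<lambda>t. (r * t) ^ j / (1 - r * t) ^ k)"
        by (rule real_kernel_integrable[OF r0 r(3)])
      show "set_integrable M B (\<lambda>t. (201/200) ^ j / (199/200) ^ k * (t ^ j / (1 - t) ^ k))"
        using that by (intro set_integrable_mult_right)
      fix t assume t: "t \<in> B"
      have "(r * t) ^ j / (1 - r * t) ^ k \<le> (201/200 * t) ^ j / (199/200 * (1 - t)) ^ k"
        using bds[OF t] den[OF t] r by (intro frac_le power_mono mult_right_mono) auto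
      also have "\<dots> = (201/200) ^ j / (199/200) ^ k * (t ^ j / (1 - t) ^ k)"
        unfolding power_mult_distrib by (rule times_divide_times_eq [symmetric])
      finally show "(r * t) ^ j / (1 - r * t) ^ k \<le> (201/200) ^ j / (199/200) ^ k * (t ^ j / (1 - t) ^ k)" .
    qed
    also have "\<dots> = (201/200) ^ j / (199/200) ^ k * (LINT t:B|M. t ^ j / (1 - t) ^ k)"
      by (rule set_integral_mult_right)
    finally show ?thesis .
  qed
  have "excess0 r \<le> 201/199 * (LINT t:B|M. t / (1 - t))"
    using mono[of 1 1] ex(2) by (simp add: excess0_def)
  moreover have "excess1 r \<le> (201/200) / (199/200)^2 * (LINT t:B|M. t / (1 - t)^2)"
    using mono[of 1 2] ex(4) by (simp add: excess1_def)
  moreover have "excess2 r \<le> (201/200)^2 / (199/200)^3 * (LINT t:B|M. t^2 / (1 - t)^3)"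
    using mono[of 2 3] ex(6) by (simp only: excess2_def)
  ultimately have "excess0 r \<le> 201/199 * (gf_sum - 1)" "excess1 r \<le> (201/200) / (199/200)^2 * gf_sum1"
     "excess2 r \<le> (201/200)^2 / (199/200)^3 * ((gf_sum2 - gf_sum1) / 2)"
    using mult_left_mono[OF ex(3), of "201/199"] mult_left_mono[OF ex(5), of "(201/200) / (199/200)^2"]
      mult_left_mono[OF ex(7), of "(201/200)^2 / (199/200)^3"] by (auto intro: order_trans)
  \<comment> \<open>Both bounds are linear in F(1), so the interval of \<open>gf_sum_bounds\<close>
    decides them; the margin covers the factors 201/200 and 199/200.\<close>
  then have "excess0 r \<le> 85/1000" "excess1 r + 6 * excess2 r \<le> 4852/10000"
    using gf_sum_bounds unfolding gf_sum2_eq gf_sum1_eq by (simp_all add: field_simps power2_eq_square power3_eq_cube)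
  then show ?thesis by (intro circle_bound r z mass)
qed

end

section \<open>Truncation of the measure\<close>

text \<open>The second-order Taylor remainder e(N) of the power -N obeys e(N + 1) = u e(N) + (N + 1)
  v^(N+2) u d^2, which yields N (N + 1) / 2 <= N^2. With a = F and b = F1 it collects the terms at
  least quadratic in F2.\<close>

lemma inverse_power_second_difference:
  fixes a b :: complex
  assumes m: "m > 0" "m \<le> norm a" "m \<le> norm b" and N: "N > 0"
  shows "norm (inverse a ^ N - inverse b ^ N + of_nat N * inverse b ^ Suc N * (a - b))
           \<le> real N ^ 2 * norm (a - b) ^ 2 * inverse m ^ (N + 2)"
proof -
  define u v d K where "u = inverse a" and "v = inverse b" and "d = a - b" and "K = inverse m"
  have nz: "a \<noteq> 0" "b \<noteq> 0" using m by auto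
  have K: "K > 0" "norm u \<le> K" "norm v \<le> K"
    using m by (auto simp: K_def u_def v_def norm_inverse intro!: le_imp_inverse_le)
  have uv: "u - v = - d * u * v" using nz by (simp add: u_def v_def d_def field_simps)
  define e where "e N = u ^ N - v ^ N + of_nat N * v ^ Suc N * d" for N
  have e_Suc: "e (Suc N) = u * e N + of_nat (Suc N) * v ^ Suc (Suc N) * u * d ^ 2" for N
  proof -
    have "e (Suc N) = u * e N + v ^ N * (u - v) - of_nat N * v ^ Suc N * d * u + of_nat (Suc N) * v ^ Suc (Suc N) * d"
      by (simp add: e_def algebra_simps)
    also have "\<dots> = u * e N + of_nat (Suc N) * v ^ Suc N * d * (v - u)"
      unfolding uv by (simp add: algebra_simps)
    also have "v - u = d * u * v" using uv by (simp add: algebra_simps)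
    finally show ?thesis by (simp add: power2_eq_square algebra_simps)
  qed
  have "norm (e N) \<le> real N * (real N + 1) / 2 * K ^ (N + 2) * norm d ^ 2" for N
  proof (induction N)
    case 0
    then show ?case by (simp add: e_def)
  next
    case (Suc N)
    have "norm (e (Suc N)) \<le> norm u * norm (e N) + real (Suc N) * norm v ^ Suc (Suc N) * norm u * norm d ^ 2"
      unfolding e_Suc using norm_triangle_ineq[of "u * e N" "of_nat (Suc N) * v ^ Suc (Suc N) * u * d ^ 2"]
      by (simp add: norm_mult norm_power del: of_nat_Suc)
    also have "\<dots> \<le> K * (real N * (real N + 1) / 2 * K ^ (N + 2) * norm d ^ 2) + real (Suc N) * K ^ Suc (Suc N) * K * norm d ^ 2"
      using K Suc.IH by (intro add_mono mult_mono power_mono mult_nonneg_nonneg) auto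
    also have "\<dots> = real (Suc N) * (real (Suc N) + 1) / 2 * K ^ (Suc N + 2) * norm d ^ 2"
      by (simp add: field_simps)
    finally show ?case .
  qed
  from this[of N] have "norm (e N) \<le> real N * (real N + 1) / 2 * K ^ (N + 2) * norm d ^ 2" .
  also have "\<dots> \<le> real N ^ 2 * K ^ (N + 2) * norm d ^ 2"
    using N K by (intro mult_right_mono) (auto simp: power2_eq_square)
  finally show ?thesis by (simp add: e_def u_def v_def d_def K_def mult_ac)
qed

lemma cball_subset_half_plane:
  assumes "r > 0" "r * \<tau> < 1" "\<tau> > 0"
  shows "cball (- 2 * of_real r) (3 * r) \<subseteq> half_plane \<tau>"
proof
  fix z :: complex assume "z \<in> cball (- 2 * of_real r) (3 * r)"
  then have "norm (z + 2 * of_real r) \<le> 3 * r"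
    using norm_minus_commute[of "- 2 * of_real r" z] by (simp add: dist_norm)
  then have "Re (z + 2 * of_real r) \<le> 3 * r" using complex_Re_le_cmod order_trans by blast
  then have "\<tau> * Re z \<le> \<tau> * r" using assms by simp
  also have "\<tau> * r < 1" using assms by (simp add: mult.commute)
  finally show "z \<in> half_plane \<tau>" by (simp add: half_plane_def)
qed

text \<open>Cauchy's formula on the shifted circle, which encloses 0. The growth (|z| / r)^n granted
  to f cancels z^(-n) in the Cauchy kernel; the remaining 1 / |z| <= 1 / r, times the radius 3 r,
  gives the 3.\<close>

lemma coeff_bound_circle:
  assumes hol: "f holomorphic_on half_plane \<tau>" and P: "f has_fps_expansion P"
    and r: "r > 0" "r * \<tau> < 1" "\<tau> > 0" and E: "E \<ge> 0"
    and bound: "\<And>z. norm (z + 2 * of_real r) = 3 * r \<Longrightarrow> norm (f z) \<le> E * (norm z / r) ^ n"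
  shows "norm (fps_nth P n) \<le> 3 * E * inverse r ^ n"
proof -
  let ?c = "- 2 * of_real r :: complex"
  have sub: "cball ?c (3 * r) \<subseteq> half_plane \<tau>" by (rule cball_subset_half_plane[OF r])
  have "((\<lambda>u. f u / (u - 0) ^ Suc n) has_contour_integral ((2 * pi * \<i>) / (fact n) * (deriv ^^ n) f 0)) (circlepath ?c (3 * r))"
  proof (rule Cauchy_has_contour_integral_higher_derivative_circlepath)
    show "continuous_on (cball ?c (3 * r)) f"
      by (rule holomorphic_on_imp_continuous_on[OF holomorphic_on_subset[OF hol sub]])
    show "f holomorphic_on ball ?c (3 * r)"
      using hol sub ball_subset_cball holomorphic_on_subset by blast
    show "0 \<in> ball ?c (3 * r)" using r by (simp add: dist_norm norm_mult)
  qed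
  then have "norm ((2 * pi * \<i>) / (fact n) * (deriv ^^ n) f 0) \<le> (E * inverse r ^ Suc n) * (2 * pi * (3 * r))"
  proof (rule has_contour_integral_bound_circlepath)
    fix z assume "norm (z - ?c) = 3 * r"
    then have z: "norm (z + 2 * of_real r) = 3 * r" by simp
    note c = circle_facts[OF r(1) z]
    note rz = c(6)
    have "norm (f z / (z - 0) ^ Suc n) = norm (f z) / norm z ^ Suc n" by (simp add: norm_divide norm_power norm_mult)
    also have "\<dots> \<le> E * (norm z / r) ^ n / norm z ^ Suc n"
      by (intro divide_right_mono bound z) auto
    also have "\<dots> = E * inverse r ^ n * (1 / norm z)"
      using r rz by (auto simp: field_simps)
    also have "\<dots> \<le> E * inverse r ^ n * (1 / r)"
      using r rz E by (intro mult_left_mono divide_left_mono mult_pos_pos) auto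
    finally show "norm (f z / (z - 0) ^ Suc n) \<le> E * inverse r ^ Suc n"
      by (simp add: field_simps)
  qed (use E r in auto)
  also have "(2 * pi * \<i>) / (fact n) * (deriv ^^ n) f 0 = 2 * pi * \<i> * fps_nth P n"
    by (simp add: fps_nth_fps_expansion[OF P])
  finally have le: "norm (2 * pi * \<i> * fps_nth P n) \<le> E * inverse r ^ Suc n * (2 * pi * (3 * r))" .
  have "2 * pi * norm (fps_nth P n) \<le> 2 * pi * (3 * E * inverse r ^ n)"
  proof -
    have "inverse r * r = 1" using r by simp
    moreover have "E * inverse r ^ Suc n * (2 * pi * (3 * r)) = 2 * pi * (3 * E * (inverse r ^ n * (inverse r * r)))"
      by (simp only: power_Suc mult_ac)
    ultimately have "E * inverse r ^ Suc n * (2 * pi * (3 * r)) = 2 * pi * (3 * E * inverse r ^ n)"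
      by (simp only: mult_1_right)
    moreover have "norm (2 * pi * \<i> * fps_nth P n) = 2 * pi * norm (fps_nth P n)"
      by (simp add: norm_mult)
    ultimately show ?thesis using le by (simp only:)
  qed
  then show ?thesis by simp
qed

definition gf_fps :: "complex fps" where
  "gf_fps = Abs_fps (\<lambda>n. of_real (gf_coeff n))"

text \<open>The map \<open>c\<close> rescales the variable by 1/16 and embeds the reals into the
  complex numbers. It is multiplicative, so it commutes with inverses and powers.\<close>

lemma skeleton_count_gf_fps:
  assumes "n > 0"
  shows "of_real ((1 - 2 * real n) * (skeleton_count n / 16 ^ n)) = fps_nth (inverse gf_fps ^ (2 * n - 1)) n"
proof -
  define c :: "real fps \<Rightarrow> complex fps" where "c f = Abs_fps (\<lambda>n. of_real (fps_nth f n / 16 ^ n))" for f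
  have c_mult: "c (f * g) = c f * c g" for f g
  proof (rule fps_ext)
    fix n
    have "(\<Sum>i=0..n. fps_nth f i * fps_nth g (n - i)) / 16 ^ n = (\<Sum>i=0..n. fps_nth f i / 16 ^ i * (fps_nth g (n - i) / 16 ^ (n - i)))"
      unfolding sum_divide_distrib by (intro sum.cong refl) (simp flip: power_add)
    then show "fps_nth (c (f * g)) n = fps_nth (c f * c g) n"
      unfolding c_def fps_mult_nth fps_nth_Abs_fps by (simp only: of_real_mult [symmetric] of_real_sum [symmetric])
  qed
  have c_1: "c 1 = 1" by (rule fps_ext) (simp add: c_def)
  have c_power: "c (f ^ k) = c f ^ k" for f k by (induction k) (simp_all add: c_mult c_1)
  have c_gf: "c noncrossing3_gf = gf_fps"
    by (rule fps_ext) (simp add: c_def gf_fps_def noncrossing3_gf_nth_gf_coeff)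
  have "c (inverse noncrossing3_gf) * gf_fps = c (inverse noncrossing3_gf * noncrossing3_gf)"
    by (simp add: c_mult c_gf)
  also have "\<dots> = 1" by (simp add: inverse_mult_eq_1 noncrossing3_gf_initial c_1)
  finally have "c (inverse noncrossing3_gf) = inverse gf_fps"
    using fps_inverse_unique mult.commute by metis
  then have "fps_nth (inverse gf_fps ^ (2 * n - 1)) n = fps_nth (c (inverse noncrossing3_gf ^ (2 * n - 1))) n"
    by (simp add: c_power)
  also have "\<dots> = of_real (fps_nth (inverse noncrossing3_gf ^ (2 * n - 1)) n / 16 ^ n)"
    by (simp add: c_def)
  also have "fps_nth (inverse noncrossing3_gf ^ (2 * n - 1)) n / 16 ^ n = (1 - 2 * real n) * (skeleton_count n / 16 ^ n)"
    using skeleton_count_lagrange[OF assms] by simp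
  finally show ?thesis ..
qed

locale truncation = gf_measure +
  fixes \<delta> :: real
  assumes \<delta>: "0 < \<delta>" "\<delta> \<le> 1/2" and mass: "99/100 \<le> measure M {0..1-\<delta>}"
begin

abbreviation "B1 \<equiv> {0..1-\<delta>}"
abbreviation "B2 \<equiv> {1-\<delta><..<1}"
text \<open>For 0 < t < 1, membership means that the pole 1 / t of the kernel is at most 1 +
  \<delta>/400, well inside the circle through 1 + \<delta>/200.\<close>

abbreviation "B3 \<equiv> {1 / (1 + \<delta>/400)..<1}"
abbreviation "F1 \<equiv> stieltjes B1"
abbreviation "F2 \<equiv> stieltjes B2"
abbreviation "F \<equiv> stieltjes {0..<1}"

sublocale T: stieltjes_support M B1 "1 - \<delta>"
  using \<delta> by unfold_locales auto
sublocale U: stieltjes_support M "{0..<1}" 1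
  by unfold_locales auto
sublocale R: stieltjes_support M B2 1
  using \<delta> by unfold_locales auto

text \<open>F1(1) and F2(1); their sum is F(1).\<close>

definition G1 :: real where "G1 = stieltjes_real B1 1"
definition tail0 :: real where "tail0 = (LINT t:B2|M. 1 / (1 - t))"

lemma half_plane_mono: "half_plane 1 \<subseteq> half_plane (1 - \<delta>)"
proof
  fix z assume "z \<in> half_plane 1"
  then have "Re z < 1" by (simp add: half_plane_def)
  have "(1 - \<delta>) * Re z < 1"
  proof (cases "Re z \<ge> 0")
    case True
    then have "(1 - \<delta>) * Re z \<le> 1 * Re z" using \<delta> by (intro mult_right_mono) auto
    with \<open>Re z < 1\<close> show ?thesis by simp
  next
    case False
    then have "(1 - \<delta>) * Re z \<le> 0" using \<delta> by (intro mult_nonneg_nonpos) auto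
    then show ?thesis by simp
  qed
  then show "z \<in> half_plane (1 - \<delta>)" by (simp add: half_plane_def)
qed

lemma radius: "r \<le> 1 + \<delta>/200 \<Longrightarrow> r * (1 - \<delta>) < 1"
proof -
  assume "r \<le> 1 + \<delta>/200"
  then have "r * (1 - \<delta>) \<le> (1 + \<delta>/200) * (1 - \<delta>)" using \<delta> by (intro mult_right_mono) auto
  also have "\<dots> < 1" using \<delta> by (simp add: algebra_simps) (smt (verit) mult_pos_pos)
  finally show ?thesis .
qed

lemma T_circle:
  assumes r: "0 < r" "r \<le> 1 + \<delta>/200" and z: "norm (z + 2 * of_real r) = 3 * r"
  shows "r * stieltjes_real B1 r ^ 2 \<le> norm z * norm (F1 z) ^ 2"
proof (rule gf_circle_bound[OF T.stieltjes_support_axioms])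
  show "199/200 * (1 - t) \<le> 1 - r * t" if "t \<in> B1" for t
  proof -
    have "r * t \<le> (1 + \<delta>/200) * t" using that r by (intro mult_right_mono) auto
    also have "\<dots> \<le> t + \<delta>/200 * 1" using that \<delta> by (simp add: distrib_right mult_left_le)
    finally show ?thesis using that by simp
  qed
qed (use \<delta> r mass z radius in auto)

lemma measure_le_1: "B \<in> sets borel \<Longrightarrow> B \<subseteq> {0..<1} \<Longrightarrow> measure M B \<le> 1"
  using finite_measure_mono[of B "{0..<1}"] by (simp add: measure_unit)

lemma mass_unit: "99/100 \<le> measure M {0..<1}"
  by (simp add: measure_unit)

lemma U_circle:
  assumes r: "0 < r" "r < 1" and z: "norm (z + 2 * of_real r) = 3 * r"
  shows "r * stieltjes_real {0..<1} r ^ 2 \<le> norm z * norm (F z) ^ 2"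
proof (rule gf_circle_bound[OF U.stieltjes_support_axioms])
  show "199/200 * (1 - t) \<le> 1 - r * t" if "t \<in> {0..<1}" for t
  proof -
    have "r * t \<le> 1 * t" using that r by (intro mult_right_mono) auto
    then show ?thesis using that by simp
  qed
qed (use r mass_unit z in auto)

lemma kernel_real_integrable_T:
  assumes "0 < r" "r \<le> 1 + \<delta>/200"
  shows "set_integrable M B1 (\<lambda>t. 1 / (1 - r * t))"
  using T.real_kernel_integrable[of r 0 1] radius assms by simp

lemma T_kernel_pos: "0 < r \<Longrightarrow> r \<le> 1 + \<delta>/200 \<Longrightarrow> t \<in> B1 \<Longrightarrow> r * t < 1"
  using radius[of r] mult_left_mono[of t "1 - \<delta>" r] by (auto intro: le_less_trans[of "r * t" "r * (1 - \<delta>)" 1])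

lemma T_mono:
  assumes "0 < r" "r \<le> s" "s \<le> 1 + \<delta>/200"
  shows "stieltjes_real B1 r \<le> stieltjes_real B1 s"
  unfolding stieltjes_real_def
proof (rule set_integral_mono)
  fix t assume t: "t \<in> B1"
  have "r * t \<le> s * t" using assms t by (intro mult_right_mono) auto
  then show "1 / (1 - r * t) \<le> 1 / (1 - s * t)"
    using T_kernel_pos[of s t] assms t by (intro divide_left_mono mult_pos_pos) auto
qed (use assms kernel_real_integrable_T in auto)

lemma T_ge_mass:
  assumes "0 < r" "r \<le> 1 + \<delta>/200"
  shows "99/100 \<le> stieltjes_real B1 r"
proof -
  have "1 * measure M B1 \<le> stieltjes_real B1 r"
    unfolding stieltjes_real_def
  proof (rule set_integral_ge_const)
    fix t assume t: "t \<in> B1"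
    have 1: "r * t \<le> r * (1 - \<delta>)" "0 \<le> r * t" using t assms by (auto intro!: mult_left_mono)
    have 2: "r * (1 - \<delta>) < 1" using radius assms by simp
    show "\<bar>1 / (1 - r * t)\<bar> \<le> 1 / (1 - r * (1 - \<delta>))" using 1 2 by (simp add: frac_le)
    show "1 \<le> 1 / (1 - r * t)" using 1 2 by simp
  qed auto
  then show ?thesis using mass by simp
qed

lemma G1_pos: "G1 > 0" "G1 \<ge> 99/100"
  using T_ge_mass[of 1] \<delta> by (auto simp: G1_def)

lemma U_ge_T:
  assumes "0 < r" "r < 1"
  shows "stieltjes_real B1 r \<le> stieltjes_real {0..<1} r"
  unfolding stieltjes_real_def set_lebesgue_integral_def
proof (rule integral_mono)
  show "integrable M (\<lambda>t. indicator B1 t *\<^sub>R (1 / (1 - r * t)))"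
    using kernel_real_integrable_T[of r] assms \<delta> by (simp add: set_integrable_def)
  show "integrable M (\<lambda>t. indicator {0..<1} t *\<^sub>R (1 / (1 - r * t)))"
    using U.real_kernel_integrable[of r 0 1] assms by (simp add: set_integrable_def)
  fix t
  have "r * t < 1" if "0 \<le> t" "t < 1" using mult_strict_mono[of r 1 t 1] that assms by auto
  then show "indicator B1 t *\<^sub>R (1 / (1 - r * t)) \<le> indicator {0..<1} t *\<^sub>R (1 / (1 - r * t))"
    using \<delta> by (auto simp: indicator_def)
qed

lemma F_split: "z \<in> half_plane 1 \<Longrightarrow> F z = F1 z + F2 z"
proof -
  assume z: "z \<in> half_plane 1"
  have "{0..<1} = B1 \<union> B2" using \<delta> by auto
  then have "F z = (LINT t:B1 \<union> B2|M. 1 / (1 - z * of_real t))" by (simp add: stieltjes_def)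
  also have "\<dots> = F1 z + F2 z"
    unfolding stieltjes_def using z half_plane_mono
    by (intro set_integral_Un T.kernel_integrable R.kernel_integrable) auto
  finally show ?thesis .
qed

lemma F2_bound:
  assumes "0 < r" "r < 1" and z: "norm (z + 2 * of_real r) = 3 * r"
  shows "norm (F2 z) \<le> tail0"
proof -
  have "z \<in> cball (- 2 * of_real r) (3 * r)" using z norm_minus_commute[of "- 2 * of_real r" z] by (simp add: dist_norm)
  then have hp: "z \<in> half_plane 1" using cball_subset_half_plane[of r 1] assms by auto
  have Re: "Re z \<le> 1" using hp by (simp add: half_plane_def)
  have "norm (F2 z) \<le> (LINT t:B2|M. norm (1 / (1 - z * of_real t)))"
    unfolding stieltjes_def by (intro set_integral_norm_bound R.kernel_integrable hp)
  also have "\<dots> \<le> tail0"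
    unfolding tail0_def
  proof (rule set_integral_mono)
    show "set_integrable M B2 (\<lambda>t. norm (1 / (1 - z * of_real t)))"
      by (rule set_integrable_norm[OF R.kernel_integrable[OF hp]])
    show "set_integrable M B2 (\<lambda>t. 1 / (1 - t))"
      using \<delta> by (intro excess_integrals(1)) auto
    fix t assume t: "t \<in> B2"
    then have t01: "0 \<le> t" "t < 1" using \<delta> by auto
    have "1 - t \<le> Re (1 - z * of_real t)"
      using t01 mult_right_mono[OF Re, of t] by simp
    also have "\<dots> \<le> norm (1 - z * of_real t)" by (rule complex_Re_le_cmod)
    finally show "norm (1 / (1 - z * of_real t)) \<le> 1 / (1 - t)"
      using t01 by (auto simp only: norm_divide norm_one intro!: frac_le)
  qed
  finally show ?thesis .
qed

abbreviation "P1 \<equiv> Abs_fps (\<lambda>n. of_real (LINT t:B1|M. t ^ n)) :: complex fps"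
abbreviation "P2 \<equiv> Abs_fps (\<lambda>n. of_real (LINT t:B2|M. t ^ n)) :: complex fps"

lemma F_expansion: "F has_fps_expansion gf_fps"
  using U.stieltjes_fps_expansion by (simp add: gf_fps_def unit_moment)

lemma P1_0: "fps_nth P1 0 \<noteq> 0"
  using mass by (simp add: set_lebesgue_integral_def)

lemma gf_fps_0: "fps_nth gf_fps 0 \<noteq> 0"
  by (simp add: gf_fps_def)

lemma F1_power_expansion: "(\<lambda>z. inverse (F1 z) ^ k) has_fps_expansion inverse P1 ^ k"
  by (intro has_fps_expansion_power has_fps_expansion_inverse T.stieltjes_fps_expansion P1_0)

lemma F_power_expansion: "(\<lambda>z. inverse (F z) ^ k) has_fps_expansion inverse gf_fps ^ k"
  by (intro has_fps_expansion_power has_fps_expansion_inverse F_expansion gf_fps_0)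

lemma F1_nonzero: "z \<in> half_plane (1 - \<delta>) \<Longrightarrow> F1 z \<noteq> 0"
  using T.stieltjes_nonzero mass by simp

lemma F_nonzero: "z \<in> half_plane 1 \<Longrightarrow> F z \<noteq> 0"
  using U.stieltjes_nonzero mass_unit by simp

lemma F1_power_holomorphic: "(\<lambda>z. inverse (F1 z) ^ k) holomorphic_on half_plane (1 - \<delta>)"
  by (intro holomorphic_intros T.stieltjes_holomorphic F1_nonzero)

lemma F_power_holomorphic: "(\<lambda>z. inverse (F z) ^ k) holomorphic_on half_plane 1"
  by (intro holomorphic_intros U.stieltjes_holomorphic F_nonzero)

lemma circle_in_half_plane:
  assumes "norm (z + 2 * of_real r) = 3 * r" "r > 0" "r * \<tau> < 1" "\<tau> > 0"
  shows "z \<in> half_plane \<tau>"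
  using cball_subset_half_plane[of r \<tau>] assms norm_minus_commute[of "- 2 * of_real r" z]
  by (auto simp: dist_norm)

text \<open>The n-th power of the circle inequality has exactly the growth (|z| / r)^n that
  \<open>coeff_bound_circle\<close> accepts.\<close>

lemma inverse_power_bound:
  fixes a z :: complex
  assumes "r * g ^ 2 \<le> norm z * norm a ^ 2" "r > 0" "g > 0" "a \<noteq> 0"
  shows "inverse (norm a) ^ (2 * n) \<le> inverse g ^ (2 * n) * (norm z / r) ^ n"
proof -
  have "inverse (norm a) ^ 2 \<le> inverse g ^ 2 * (norm z / r)"
    using assms by (simp add: field_simps)
  then have "(inverse (norm a) ^ 2) ^ n \<le> (inverse g ^ 2 * (norm z / r)) ^ n"
    by (intro power_mono) auto
  then show ?thesis by (simp only: power_mult power_mult_distrib)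
qed

lemma F1_power_bound:
  assumes r: "1 \<le> r" "r \<le> 1 + \<delta>/200" and z: "norm (z + 2 * of_real r) = 3 * r"
  shows "norm (inverse (F1 z) ^ (2 * n)) \<le> inverse G1 ^ (2 * n) * (norm z / r) ^ n"
proof -
  have "G1 \<le> stieltjes_real B1 r" unfolding G1_def using r by (intro T_mono) auto
  then have "r * G1 ^ 2 \<le> r * stieltjes_real B1 r ^ 2"
    using r G1_pos by (intro mult_left_mono power_mono) auto
  also have "\<dots> \<le> norm z * norm (F1 z) ^ 2" using r z by (intro T_circle) auto
  finally show ?thesis
    using inverse_power_bound[of r G1 z "F1 z" n] r G1_pos F1_nonzero[OF circle_in_half_plane[OF z]] radius[of r] \<delta>
    by (simp add: norm_power norm_inverse)
qed

text \<open>The circle through 1 + \<delta>/200 yields the exponential gain, while F1(r) >= F1(1)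
  keeps the normalisation at 1. The odd exponent is written as F1^(1-2n) = F1^(-2n) F1, with |F1| <=
  2 / \<delta> on this circle.\<close>

lemma first_term_bound:
  assumes n: "n > 0"
  shows "norm (fps_nth (inverse P1 ^ (2 * n - 1)) n) \<le> inverse G1 ^ (2 * n) * (6 / \<delta>) * inverse (1 + \<delta>/200) ^ n"
proof -
  define r where "r = 1 + \<delta>/200"
  have r: "1 \<le> r" "r \<le> 1 + \<delta>/200" "r > 0" using \<delta> by (auto simp: r_def)
  have "norm (fps_nth (inverse P1 ^ (2 * n - 1)) n) \<le> 3 * (inverse G1 ^ (2 * n) * (2 / \<delta>)) * inverse r ^ n"
  proof (rule coeff_bound_circle[OF F1_power_holomorphic F1_power_expansion])
    show "r > 0" "r * (1 - \<delta>) < 1" "1 - \<delta> > 0" using r radius \<delta> by auto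
    show "0 \<le> inverse G1 ^ (2 * n) * (2 / \<delta>)" using G1_pos \<delta> by simp
    fix z :: complex assume z: "norm (z + 2 * of_real r) = 3 * r"
    have hp: "z \<in> half_plane (1 - \<delta>)" using circle_in_half_plane[OF z] r radius \<delta> by auto
    note c = circle_facts[OF r(3) z]
    have "norm (F1 z) \<le> 2 / \<delta> * measure M B1"
      unfolding stieltjes_def
    proof (rule set_integral_norm_le)
      fix t assume t: "t \<in> B1"
      have "(1 - \<delta>) * Re z \<le> (1 - \<delta>) * r" using \<delta> c(5) by (intro mult_left_mono) auto
      also have "\<dots> \<le> 1 - \<delta>/2"
      proof -
        have "(1 - \<delta>) * r \<le> 1 - \<delta> + \<delta>/200" using \<delta> by (simp add: r_def algebra_simps)
        then show ?thesis using \<delta> by simp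
      qed
      finally have "\<delta>/2 \<le> min 1 (1 - (1 - \<delta>) * Re z)" using \<delta> by simp
      also have "\<dots> \<le> norm (1 - z * of_real t)" using t by (intro norm_kernel_ge) auto
      finally have "norm (1 / (1 - z * of_real t)) \<le> 1 / (\<delta>/2)"
        using \<delta> unfolding norm_divide norm_one by (intro frac_le) auto
      then show "norm (1 / (1 - z * of_real t)) \<le> 2 / \<delta>" by simp
    qed (use \<delta> in auto)
    also have "\<dots> \<le> 2 / \<delta> * 1" using \<delta> by (intro mult_left_mono measure_le_1) auto
    finally have le: "norm (F1 z) \<le> 2 / \<delta>" by simp
    define k where "k = 2 * n - 1"
    have k: "2 * n = Suc k" using n by (simp add: k_def)
    have "inverse (F1 z) ^ (2 * n) * F1 z = inverse (F1 z) ^ k * (inverse (F1 z) * F1 z)"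
      unfolding k by (simp only: power_Suc mult_ac)
    then have "inverse (F1 z) ^ (2 * n - 1) = inverse (F1 z) ^ (2 * n) * F1 z"
      using F1_nonzero[OF hp] by (simp add: k_def)
    then have "norm (inverse (F1 z) ^ (2 * n - 1)) = norm (inverse (F1 z) ^ (2 * n)) * norm (F1 z)"
      by (simp add: norm_mult)
    also have "\<dots> \<le> (inverse G1 ^ (2 * n) * (norm z / r) ^ n) * (2 / \<delta>)"
      using le by (intro mult_mono F1_power_bound r z) (use r G1_pos in auto)
    finally show "norm (inverse (F1 z) ^ (2 * n - 1)) \<le> inverse G1 ^ (2 * n) * (2 / \<delta>) * (norm z / r) ^ n"
      by (simp add: mult_ac)
  qed
  then show ?thesis by (simp add: r_def mult_ac)
qed

text \<open>The expansion involves F, whose half-plane stops at Re z = 1; so circles with r < 1 are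
  used and r tends to 1 from the left. The 9 is the 3 of \<open>coeff_bound_circle\<close> times the
  3 of \<open>inv_m\<close>.\<close>

lemma quadratic_term_bound:
  assumes N: "N = 2 * n - 1" "n > 0"
  shows "norm (fps_nth (inverse gf_fps ^ N - inverse P1 ^ N + of_nat N * inverse P1 ^ Suc N * P2) n)
    \<le> inverse G1 ^ (2 * n) * (9 * real N ^ 2 * tail0 ^ 2)"
proof -
  have Suc_N: "Suc N = 2 * n" using N by simp
  let ?Q = "\<lambda>z. inverse (F z) ^ N - inverse (F1 z) ^ N + of_nat N * inverse (F1 z) ^ Suc N * F2 z"
  have hol: "?Q holomorphic_on half_plane 1"
    by (intro holomorphic_intros F_power_holomorphic R.stieltjes_holomorphic
          holomorphic_on_subset[OF F1_power_holomorphic half_plane_mono])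
  have exp: "?Q has_fps_expansion inverse gf_fps ^ N - inverse P1 ^ N + of_nat N * inverse P1 ^ Suc N * P2"
    unfolding fps_of_nat [symmetric]
    by (intro has_fps_expansion_add has_fps_expansion_diff has_fps_expansion_mult F_power_expansion F1_power_expansion
          R.stieltjes_fps_expansion has_fps_expansion_const)
  define C where "C = norm (fps_nth (inverse gf_fps ^ N - inverse P1 ^ N + of_nat N * inverse P1 ^ Suc N * P2) n)"
  have tail0_nonneg: "tail0 \<ge> 0"
    unfolding tail0_def set_lebesgue_integral_def
    by (rule Bochner_Integration.integral_nonneg) (auto simp: indicator_def)
  have bound: "C \<le> 9 * real N ^ 2 * tail0 ^ 2 * (inverse (stieltjes_real B1 r) ^ (2 * n) * inverse r ^ n)"
    if r: "0 < r" "r < 1" for r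
  proof -
    define g where "g = stieltjes_real B1 r"
    have g: "g \<ge> 99/100" unfolding g_def using r \<delta> by (intro T_ge_mass) auto
    have "C \<le> 3 * (3 * real N ^ 2 * tail0 ^ 2 * inverse g ^ (2 * n)) * inverse r ^ n"
      unfolding C_def
    proof (rule coeff_bound_circle[OF hol exp])
      show "r > 0" "r * 1 < 1" "(1::real) > 0" using r by auto
      show "0 \<le> 3 * real N ^ 2 * tail0 ^ 2 * inverse g ^ (2 * n)" using g by simp
      fix z :: complex assume z: "norm (z + 2 * of_real r) = 3 * r"
      have hp: "z \<in> half_plane 1" using circle_in_half_plane[OF z] r by auto
      note c = circle_facts[OF r(1) z]
      have z_pos: "norm z > 0" using c(6) r by linarith
      \<comment> \<open>A common lower bound for |F1| and |F| at z, from both circle inequalities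
        and F(r) >= F1(r).\<close>
      define m where "m = g * sqrt (r / norm z)"
      have m: "m > 0" using g r z_pos by (simp add: m_def)
      have m2: "m ^ 2 = r * g ^ 2 / norm z" using r z_pos by (simp add: m_def power_mult_distrib)
      have "r * g ^ 2 \<le> norm z * norm (F1 z) ^ 2"
        unfolding g_def using r \<delta> by (intro T_circle z) auto
      then have "m ^ 2 \<le> norm (F1 z) ^ 2" using z_pos by (simp add: m2 field_simps)
      then have m_F1: "m \<le> norm (F1 z)" by (rule power2_le_imp_le) auto
      have "r * g ^ 2 \<le> r * stieltjes_real {0..<1} r ^ 2"
        using r g U_ge_T[of r] by (intro mult_left_mono power_mono) (auto simp: g_def)
      also have "\<dots> \<le> norm z * norm (F z) ^ 2" by (rule U_circle[OF r z])
      finally have "m ^ 2 \<le> norm (F z) ^ 2" using z_pos by (simp add: m2 field_simps)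
      then have m_F: "m \<le> norm (F z)" by (rule power2_le_imp_le) auto
      \<comment> \<open>The exponent N + 2 is 2n + 1. The one factor 1 / m left over is bounded by a
        constant because |z| <= 5 r.\<close>
      have inv_m: "inverse m \<le> 3"
      proof -
        have "1/5 \<le> r / norm z" using z_pos c(7) by (simp add: field_simps)
        moreover have "(99/100)^2 \<le> g ^ 2" using g by (intro power_mono) auto
        ultimately have "(99/100)^2 * (1/5) \<le> g ^ 2 * (r / norm z)" by (intro mult_mono) auto
        also have "g ^ 2 * (r / norm z) = m ^ 2" by (simp add: m2)
        finally have "(1/3)^2 \<le> m ^ 2" by (rule order_trans[rotated]) (simp add: power2_eq_square)
        then have "1/3 \<le> m" by (rule power2_le_imp_le) (use m in auto)
        then show ?thesis using m by (simp add: field_simps)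
      qed
      have "norm (?Q z) = norm (inverse (F z) ^ N - inverse (F1 z) ^ N + of_nat N * inverse (F1 z) ^ Suc N * (F z - F1 z))"
        using F_split[OF hp] by simp
      also have "\<dots> \<le> real N ^ 2 * norm (F z - F1 z) ^ 2 * inverse m ^ (N + 2)"
        using N by (intro inverse_power_second_difference m m_F m_F1) auto
      also have "\<dots> = real N ^ 2 * norm (F2 z) ^ 2 * (inverse m ^ (2 * n) * inverse m)"
        using F_split[OF hp] Suc_N by (simp add: Suc_N [symmetric])
      also have "inverse m ^ (2 * n) = inverse g ^ (2 * n) * (norm z / r) ^ n"
      proof -
        have "inverse m ^ 2 = inverse (r * g ^ 2 / norm z)" by (simp only: power_inverse m2)
        also have "\<dots> = inverse g ^ 2 * (norm z / r)" using g r z_pos by (simp add: field_simps)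
        finally have "inverse m ^ 2 = inverse g ^ 2 * (norm z / r)" .
        then have "(inverse m ^ 2) ^ n = (inverse g ^ 2 * (norm z / r)) ^ n" by simp
        then show ?thesis by (simp only: power_mult power_mult_distrib)
      qed
      also have "real N ^ 2 * norm (F2 z) ^ 2 * (inverse g ^ (2 * n) * (norm z / r) ^ n * inverse m) \<le>
          real N ^ 2 * tail0 ^ 2 * (inverse g ^ (2 * n) * (norm z / r) ^ n * 3)"
        using F2_bound[OF r z] inv_m g r m tail0_nonneg
        by (intro mult_mono mult_nonneg_nonneg power_mono zero_le_power divide_nonneg_nonneg) auto
      finally show "norm (?Q z) \<le> 3 * real N ^ 2 * tail0 ^ 2 * inverse g ^ (2 * n) * (norm z / r) ^ n"
        by (simp add: mult_ac)
    qed
    then show ?thesis by (simp add: g_def mult_ac)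
  qed
  have "((\<lambda>r. stieltjes_real B1 r) \<longlongrightarrow> G1) (at_left 1)"
  proof -
    have "of_real 1 \<in> half_plane (1 - \<delta>)" using \<delta> by (simp add: half_plane_def)
    then have "isCont F1 (of_real 1)"
      using holomorphic_on_imp_continuous_on[OF T.stieltjes_holomorphic]
        continuous_on_eq_continuous_at[OF open_half_plane] by blast
    then have "((\<lambda>r. F1 (of_real r)) \<longlongrightarrow> F1 (of_real 1)) (at 1)"
      by (rule isCont_tendsto_compose[OF _ tendsto_of_real[OF tendsto_ident_at]])
    then have "((\<lambda>r. Re (F1 (of_real r))) \<longlongrightarrow> Re (F1 (of_real 1))) (at 1)"
      by (rule tendsto_Re)
    then have "(stieltjes_real B1 \<longlongrightarrow> stieltjes_real B1 1) (at 1)"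
      unfolding T.stieltjes_of_real by simp
    then show ?thesis unfolding G1_def by (rule filterlim_mono) (auto simp: at_within_le_at)
  qed
  then have "((\<lambda>r. 9 * real N ^ 2 * tail0 ^ 2 * (inverse (stieltjes_real B1 r) ^ (2 * n) * inverse r ^ n)) \<longlongrightarrow>
      9 * real N ^ 2 * tail0 ^ 2 * (inverse G1 ^ (2 * n) * inverse 1 ^ n)) (at_left 1)"
    using G1_pos by (intro tendsto_intros) auto
  moreover have "\<forall>\<^sub>F r in at_left 1. C \<le> 9 * real N ^ 2 * tail0 ^ 2 * (inverse (stieltjes_real B1 r) ^ (2 * n) * inverse r ^ n)"
    using eventually_at_left_real[of 0 "1::real"] bound by (auto elim!: eventually_mono)
  ultimately have "C \<le> 9 * real N ^ 2 * tail0 ^ 2 * (inverse G1 ^ (2 * n) * inverse 1 ^ n)"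
    by (intro tendsto_lowerbound) auto
  then show ?thesis by (simp add: C_def mult_ac)
qed

end

section \<open>The linear term\<close>

context truncation
begin

abbreviation geo :: "real \<Rightarrow> complex fps" where
  "geo t \<equiv> Abs_fps (\<lambda>k. of_real (t ^ k))"

lemma geo_expansion:
  assumes "0 \<le> t" "t < 1"
  shows "(\<lambda>z. 1 / (1 - z * of_real t)) has_fps_expansion geo t"
proof (rule has_fps_expansionI)
  have "\<forall>\<^sub>F z in nhds 0. z \<in> ball (0::complex) 1"
    by (intro eventually_nhds_in_open) auto
  then show "\<forall>\<^sub>F z in nhds 0. (\<lambda>n. fps_nth (geo t) n * z ^ n) sums (1 / (1 - z * of_real t))"
  proof eventually_elim
    case (elim z)
    then have "norm z * t \<le> norm z * 1" using assms by (intro mult_left_mono) auto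
    then have "norm (z * of_real t) < 1" using elim assms by (simp add: norm_mult)
    from geometric_sums[OF this] show ?case by (simp add: power_mult_distrib mult.commute)
  qed
qed

text \<open>Up to sign, the residue at z = 1 / t of F1(z)^(-2n) / (z^(n+1) (1 - z t)). Off
  \<open>B3\<close> the circle chosen later leaves the pole outside, hence the value 0.\<close>

definition bulk :: "nat \<Rightarrow> real \<Rightarrow> real" where
  "bulk n t = indicator B3 t * (t ^ n * inverse (stieltjes_real B1 (1 / t)) ^ (2 * n))"

lemma B3_sub_B2: "B3 \<subseteq> B2"
proof -
  have "1 < 1 / ((1 - \<delta>) * (1 + \<delta>/400))" if "(1 - \<delta>) * (1 + \<delta>/400) < 1"
    using that \<delta> by simp
  moreover have "(1 - \<delta>) * (1 + \<delta>/400) < 1" using radius[of "1 + \<delta>/400"] \<delta> by (simp add: mult.commute)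
  ultimately have "1 - \<delta> < 1 / (1 + \<delta>/400)" using \<delta> by (simp add: field_simps)
  then show ?thesis by auto
qed

lemma B3_inverse: "t \<in> B3 \<Longrightarrow> 0 < t \<and> t < 1 \<and> 1 < 1 / t \<and> 1 / t \<le> 1 + \<delta>/400"
proof -
  assume t: "t \<in> B3"
  have "0 < 1 / (1 + \<delta>/400)" using \<delta> by simp
  moreover have "1 / (1 + \<delta>/400) \<le> t" using t by simp
  ultimately have "0 < t" by linarith
  moreover have "1 \<le> t * (1 + \<delta>/400)" using t \<delta> by (simp add: field_simps)
  ultimately show ?thesis using t by (simp add: field_simps)
qed

lemma bulk_measurable [measurable]: "bulk n \<in> borel_measurable borel"
proof -
  have nz0: "t \<noteq> 0" if "t \<in> B3" for t using B3_inverse[OF that] by auto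
  have cont: "continuous_on B3 (\<lambda>t. Re (F1 (of_real (1 / t))))"
  proof (intro continuous_on_Re continuous_on_compose2[OF holomorphic_on_imp_continuous_on[OF T.stieltjes_holomorphic]])
    show "continuous_on B3 (\<lambda>t. complex_of_real (1 / t))"
      by (intro continuous_intros ballI) (rule nz0)
    show "(\<lambda>t. complex_of_real (1 / t)) ` B3 \<subseteq> half_plane (1 - \<delta>)"
    proof
      fix z assume "z \<in> (\<lambda>t. complex_of_real (1 / t)) ` B3"
      then obtain t where t: "t \<in> B3" "z = of_real (1 / t)" by auto
      have "1 / t * (1 - \<delta>) < 1" using B3_inverse[OF t(1)] \<delta> by (intro radius) auto
      then show "z \<in> half_plane (1 - \<delta>)" by (simp add: half_plane_def t(2))
    qed
  qed
  have nz: "stieltjes_real B1 (1 / t) \<noteq> 0" if "t \<in> B3" for t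
    using T_ge_mass[of "1 / t"] B3_inverse[OF that] \<delta> by auto
  have "continuous_on B3 (\<lambda>t. t ^ n * inverse (stieltjes_real B1 (1 / t)) ^ (2 * n))"
    using cont nz unfolding T.stieltjes_of_real by (intro continuous_intros) auto
  then have "(\<lambda>t. indicator B3 t *\<^sub>R (t ^ n * inverse (stieltjes_real B1 (1 / t)) ^ (2 * n))) \<in> borel_measurable borel"
    by (intro borel_measurable_continuous_on_indicator) auto
  then show ?thesis by (simp add: bulk_def [abs_def])
qed

lemma bulk_bounds: "0 \<le> bulk n t" "bulk n t \<le> inverse G1 ^ (2 * n)"
proof -
  have "stieltjes_real B1 (1 / t) \<ge> G1" if "t \<in> B3"
    unfolding G1_def using B3_inverse[OF that] \<delta> by (intro T_mono) auto
  then have le: "inverse (stieltjes_real B1 (1 / t)) ^ (2 * n) \<le> inverse G1 ^ (2 * n)"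
      "0 \<le> inverse (stieltjes_real B1 (1 / t)) ^ (2 * n)" if "t \<in> B3"
    using that G1_pos by (auto intro!: power_mono le_imp_inverse_le intro: order_trans[of 0 G1])
  have "0 \<le> bulk n t \<and> bulk n t \<le> inverse G1 ^ (2 * n)"
  proof (cases "t \<in> B3")
    case True
    then have t: "0 \<le> t ^ n" "t ^ n \<le> 1" using B3_inverse[OF True] by (auto intro: power_le_one)
    have "t ^ n * inverse (stieltjes_real B1 (1 / t)) ^ (2 * n) \<le> 1 * inverse G1 ^ (2 * n)"
      by (intro mult_mono le True t) auto
    moreover have "0 \<le> t ^ n * inverse (stieltjes_real B1 (1 / t)) ^ (2 * n)"
      by (intro mult_nonneg_nonneg le True t)
    moreover have "bulk n t = t ^ n * inverse (stieltjes_real B1 (1 / t)) ^ (2 * n)"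
      using True unfolding bulk_def by simp
    ultimately show ?thesis by simp
  next
    case False
    then show ?thesis using G1_pos unfolding bulk_def by simp
  qed
  then show "0 \<le> bulk n t" "bulk n t \<le> inverse G1 ^ (2 * n)" by auto
qed

text \<open>The residue is taken by subtraction. With h = F1^(-2n) and w = 1 / t, the function (h(z)
  - h(w)) / (1 - z t) is holomorphic across w, and its coefficient is estimated on the larger
  circle; h(w) / (1 - z t) has the n-th coefficient h(w) t^n, which is
  \<open>bulk n t\<close>.\<close>

lemma linear_coeff_near:
  assumes t: "t \<in> B3"
  shows "norm (fps_nth (inverse P1 ^ (2 * n) * geo t) n - of_real (bulk n t))
    \<le> inverse G1 ^ (2 * n) * (4800 / \<delta>) * inverse (1 + \<delta>/200) ^ n"
proof -
  define r where "r = 1 + \<delta>/200"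
  have r: "1 \<le> r" "r \<le> 1 + \<delta>/200" "r > 0" using \<delta> by (auto simp: r_def)
  define w where "w = complex_of_real (1 / t)"
  note tb = B3_inverse[OF t]
  define h where "h z = inverse (F1 z) ^ (2 * n)" for z
  \<comment> \<open>The factor comes from 1 / (1 - z t) = -w / (z - w); the derivative fills the
    removable singularity at w.\<close>
  define q where "q z = - w * (if z = w then deriv h w else (h z - h w) / (z - w))" for z
  have hw: "h w = of_real (inverse (stieltjes_real B1 (1 / t)) ^ (2 * n))"
    unfolding h_def w_def T.stieltjes_of_real by simp
  have hw_le: "norm (h w) \<le> inverse G1 ^ (2 * n)"
  proof -
    have "G1 \<le> stieltjes_real B1 (1 / t)" unfolding G1_def using tb \<delta> by (intro T_mono) auto
    then show ?thesis unfolding hw using G1_pos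
      by (simp only: norm_of_real) (auto intro!: power_mono le_imp_inverse_le)
  qed
  have q_eq: "q z = (h z - h w) * (1 / (1 - z * of_real t))" if "z \<noteq> w" for z
  proof -
    have "1 - z * of_real t = (w - z) * of_real t" using tb by (simp add: w_def field_simps)
    then show ?thesis using that tb by (simp add: q_def w_def divide_simps) (simp add: algebra_simps)
  qed
  have hol: "q holomorphic_on half_plane (1 - \<delta>)"
    unfolding q_def
    by (intro holomorphic_on_mult holomorphic_on_const pole_lemma_open open_half_plane)
       (simp add: h_def [abs_def] F1_power_holomorphic)
  have "(\<lambda>z. (h z - h w) * (1 / (1 - z * of_real t))) has_fps_expansion (inverse P1 ^ (2 * n) - fps_const (h w)) * geo t"
    using tb unfolding h_def [abs_def]
    by (intro has_fps_expansion_mult has_fps_expansion_diff F1_power_expansion has_fps_expansion_const geo_expansion) auto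
  note exp' = this
  have ev: "\<forall>\<^sub>F z in nhds 0. q z = (h z - h w) * (1 / (1 - z * of_real t))"
  proof -
    have "\<forall>\<^sub>F z in nhds 0. z \<in> - {w}" using tb by (intro eventually_nhds_in_open) (auto simp: w_def)
    then show ?thesis by eventually_elim (auto simp: q_eq)
  qed
  have exp: "q has_fps_expansion (inverse P1 ^ (2 * n) - fps_const (h w)) * geo t"
    by (rule has_fps_expansion_cong[OF ev refl, THEN iffD2]) (rule exp')
  have "norm (fps_nth ((inverse P1 ^ (2 * n) - fps_const (h w)) * geo t) n) \<le>
      3 * (inverse G1 ^ (2 * n) * (1600 / \<delta>)) * inverse r ^ n"
  proof (rule coeff_bound_circle[OF hol exp])
    show "r > 0" "r * (1 - \<delta>) < 1" "1 - \<delta> > 0" using r radius \<delta> by auto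
    show "0 \<le> inverse G1 ^ (2 * n) * (1600 / \<delta>)" using G1_pos \<delta> by simp
    fix z :: complex assume z: "norm (z + 2 * of_real r) = 3 * r"
    have zr: "1 \<le> (norm z / r) ^ n" using circle_facts(6)[OF r(3) z] r by (intro one_le_power) auto
    have "w + 2 * of_real r = of_real (1 / t + 2 * r)" by (simp add: w_def)
    then have "norm (w + 2 * of_real r) = 1 / t + 2 * r" using tb r by (simp only: norm_of_real) simp
    moreover have "norm (z + 2 * of_real r) \<le> norm (w + 2 * of_real r) + norm (z - w)"
      using norm_triangle_ineq[of "w + 2 * of_real r" "z - w"] by (simp add: add_ac)
    \<comment> \<open>w lies on the real diameter, at distance r - 1 / t >= \<delta>/400 from the
      circle. Together with t >= 1/2 this makes the denominator at least \<delta>/800.\<close>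
    ultimately have dist: "\<delta>/400 \<le> norm (z - w)" using z tb by (simp add: r_def)
    then have neq: "z \<noteq> w" using \<delta> by auto
    have "1 - z * of_real t = (w - z) * of_real t" using tb by (simp add: w_def field_simps)
    then have "norm (1 - z * of_real t) = norm (z - w) * t"
      using tb by (simp add: norm_mult norm_minus_commute)
    moreover have "norm (z - w) * t \<ge> \<delta>/400 * (1/2)"
    proof (intro mult_mono dist)
      have "1 / t \<le> 1 + \<delta>/400" "0 < t" using tb by blast+
      then have "1 \<le> (1 + \<delta>/400) * t" by (simp only: pos_divide_le_eq)
      then have "1 \<le> t * (1 + \<delta>/400)" by (simp only: mult.commute)
      also have "\<dots> \<le> t * 2" using tb \<delta> by (intro mult_left_mono) auto
      finally show "1/2 \<le> t" by simp
    qed (use \<delta> in auto)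
    ultimately have den: "\<delta>/800 \<le> norm (1 - z * of_real t)" by simp
    have "norm (q z) = norm (h z - h w) / norm (1 - z * of_real t)"
      by (simp add: q_eq[OF neq] norm_mult norm_divide)
    also have "\<dots> \<le> (inverse G1 ^ (2 * n) * (norm z / r) ^ n + inverse G1 ^ (2 * n) * (norm z / r) ^ n) / (\<delta>/800)"
    proof (rule frac_le)
      have "norm (h z - h w) \<le> norm (h z) + norm (h w)" by (rule norm_triangle_ineq4)
      also have "norm (h z) \<le> inverse G1 ^ (2 * n) * (norm z / r) ^ n"
        unfolding h_def by (rule F1_power_bound[OF r(1,2) z])
      also have "norm (h w) \<le> inverse G1 ^ (2 * n) * (norm z / r) ^ n"
      proof -
        have "inverse G1 ^ (2 * n) * 1 \<le> inverse G1 ^ (2 * n) * (norm z / r) ^ n"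
          using G1_pos by (intro mult_left_mono zr) auto
        then show ?thesis using hw_le by linarith
      qed
      finally show "norm (h z - h w) \<le> inverse G1 ^ (2 * n) * (norm z / r) ^ n + inverse G1 ^ (2 * n) * (norm z / r) ^ n"
        by simp
    qed (use den \<delta> G1_pos r in auto)
    also have "\<dots> = inverse G1 ^ (2 * n) * (1600 / \<delta>) * (norm z / r) ^ n"
      by (simp add: field_simps)
    finally show "norm (q z) \<le> inverse G1 ^ (2 * n) * (1600 / \<delta>) * (norm z / r) ^ n" .
  qed
  moreover have "fps_nth ((inverse P1 ^ (2 * n) - fps_const (h w)) * geo t) n = fps_nth (inverse P1 ^ (2 * n) * geo t) n - of_real (bulk n t)"
  proof -
    have "bulk n t = inverse (stieltjes_real B1 (1 / t)) ^ (2 * n) * t ^ n"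
      using t unfolding bulk_def by simp
    then show ?thesis
      unfolding left_diff_distrib fps_sub_nth fps_mult_left_const_nth fps_nth_Abs_fps hw by simp
  qed
  ultimately show ?thesis by (simp add: r_def mult_ac)
qed

text \<open>Now 1 / t > 1 + \<delta>/400, and the circle through 1 + \<delta>/800 keeps the pole
  outside at a distance of order \<delta>, so no residue arises. The smaller radius sets the rate in
  the combined estimate.\<close>

lemma linear_coeff_far:
  assumes t: "t \<in> B2" "t \<notin> B3"
  shows "norm (fps_nth (inverse P1 ^ (2 * n) * geo t) n) \<le> inverse G1 ^ (2 * n) * (4800 / \<delta>) * inverse (1 + \<delta>/800) ^ n"
proof -
  define r where "r = 1 + \<delta>/800"
  have r: "1 \<le> r" "r \<le> 1 + \<delta>/200" "r > 0" using \<delta> by (auto simp: r_def)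
  have t01: "0 < t" "t < 1" using t \<delta> by auto
  have t_lt: "t * (1 + \<delta>/400) < 1" using t \<delta> by (auto simp: field_simps)
  have tr: "\<delta>/1600 \<le> 1 - t * r"
  proof -
    have "t \<ge> 1/2" using t \<delta> by auto
    then have "1/2 * (\<delta>/800) \<le> t * (\<delta>/800)" using \<delta> by (intro mult_right_mono) auto
    moreover have "t * (1 + \<delta>/400) = t * r + t * (\<delta>/800)" by (simp add: r_def algebra_simps)
    ultimately show ?thesis using t_lt by simp
  qed
  let ?f = "\<lambda>z. inverse (F1 z) ^ (2 * n) * (1 / (1 - z * of_real t))"
  define \<tau> where "\<tau> = max t (1 - \<delta>)"
  have \<tau>: "0 < \<tau>" "r * \<tau> < 1" "1 - \<delta> \<le> \<tau>" "t \<le> \<tau>"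
    using t01 tr \<delta> radius[OF r(2)] by (auto simp: \<tau>_def max_def mult.commute)
  have sub: "half_plane \<tau> \<subseteq> half_plane s" if "0 \<le> s" "s \<le> \<tau>" for s
  proof
    fix z assume z: "z \<in> half_plane \<tau>"
    show "z \<in> half_plane s"
    proof (cases "Re z \<ge> 0")
      case True
      then have "s * Re z \<le> \<tau> * Re z" using that by (intro mult_right_mono)
      then show ?thesis using z by (simp add: half_plane_def)
    next
      case False
      then have "s * Re z \<le> 0" using that by (intro mult_nonneg_nonpos) auto
      then show ?thesis by (simp add: half_plane_def)
    qed
  qed
  have nz: "1 - z * of_real t \<noteq> 0" if "z \<in> half_plane \<tau>" for z
  proof
    assume "1 - z * of_real t = 0"
    then have "Re (1 - z * of_real t) = 0" by simp
    then have "t * Re z = 1" by (simp add: mult.commute)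
    then show False using sub[of t] \<tau> t01 that by (auto simp: half_plane_def)
  qed
  have hol: "?f holomorphic_on half_plane \<tau>"
    using nz sub[of "1 - \<delta>"] \<tau> \<delta>
    by (intro holomorphic_intros holomorphic_on_subset[OF F1_power_holomorphic]) auto
  have exp: "?f has_fps_expansion inverse P1 ^ (2 * n) * geo t"
    using t01 by (intro has_fps_expansion_mult F1_power_expansion geo_expansion) auto
  have "norm (fps_nth (inverse P1 ^ (2 * n) * geo t) n) \<le> 3 * (inverse G1 ^ (2 * n) * (1600 / \<delta>)) * inverse r ^ n"
  proof (rule coeff_bound_circle[OF hol exp])
    show "r > 0" "r * \<tau> < 1" "\<tau> > 0" using r \<tau> by auto
    show "0 \<le> inverse G1 ^ (2 * n) * (1600 / \<delta>)" using G1_pos \<delta> by simp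
    fix z :: complex assume z: "norm (z + 2 * of_real r) = 3 * r"
    have "t * Re z \<le> t * r" using t01 circle_facts(5)[OF r(3) z] by simp
    then have "\<delta>/1600 \<le> Re (1 - z * of_real t)" using tr by (simp add: mult.commute)
    also have "\<dots> \<le> norm (1 - z * of_real t)" by (rule complex_Re_le_cmod)
    finally have den: "norm (1 / (1 - z * of_real t)) \<le> 1 / (\<delta>/1600)"
      using \<delta> unfolding norm_divide norm_one by (intro frac_le) auto
    have "norm (?f z) = norm (inverse (F1 z) ^ (2 * n)) * norm (1 / (1 - z * of_real t))"
      by (rule norm_mult)
    also have "\<dots> \<le> (inverse G1 ^ (2 * n) * (norm z / r) ^ n) * (1 / (\<delta>/1600))"
      by (intro mult_mono F1_power_bound r z den) (use G1_pos r in auto)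
    finally show "norm (?f z) \<le> inverse G1 ^ (2 * n) * (1600 / \<delta>) * (norm z / r) ^ n"
      by (simp add: mult_ac)
  qed
  then show ?thesis by (simp add: r_def mult_ac)
qed

text \<open>P2 is the integral of \<open>geo t\<close> over B2, and the n-th coefficient of a
  product is a finite sum, so the estimates for single t can be integrated.\<close>

lemma linear_term_bound:
  "norm (fps_nth (inverse P1 ^ (2 * n) * P2) n - of_real (LINT t:B2|M. bulk n t))
    \<le> inverse G1 ^ (2 * n) * (4800 / \<delta>) * inverse (1 + \<delta>/800) ^ n"
proof -
  define H where "H = inverse P1 ^ (2 * n)"
  define K where "K = inverse G1 ^ (2 * n) * (4800 / \<delta>) * inverse (1 + \<delta>/800) ^ n"
  have K: "K \<ge> 0" using G1_pos \<delta> by (simp add: K_def)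
  have B2: "B2 \<in> sets borel" "B2 \<subseteq> {0..<1}" using \<delta> by auto
  have c_eq: "fps_nth (H * geo t) n = (\<Sum>i=0..n. fps_nth H i * of_real (t ^ (n - i)))" for t
    by (simp add: fps_mult_nth)
  have c_meas: "(\<lambda>t. fps_nth (H * geo t) n) \<in> borel_measurable borel"
    unfolding c_eq by measurable
  have int_i: "set_integrable M B2 (\<lambda>t. fps_nth H i * of_real (t ^ k))" for i k
    by (intro set_integrable_mult_right set_integrable_bounded[where K = 1])
       (use B2 in \<open>auto simp: norm_power intro!: power_le_one\<close>)
  have "(LINT t:B2|M. fps_nth (H * geo t) n) = (\<Sum>i=0..n. (LINT t:B2|M. fps_nth H i * of_real (t ^ (n - i))))"
    unfolding c_eq using int_i unfolding set_lebesgue_integral_def set_integrable_def scaleR_sum_right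
    by (intro Bochner_Integration.integral_sum) auto
  also have "\<dots> = fps_nth (H * P2) n"
    unfolding fps_mult_nth
    by (intro sum.cong refl) (simp only: set_integral_mult_right set_integral_complex_of_real fps_nth_Abs_fps)
  finally have 1: "fps_nth (H * P2) n = (LINT t:B2|M. fps_nth (H * geo t) n)" ..
  have int_c: "set_integrable M B2 (\<lambda>t. fps_nth (H * geo t) n)"
    unfolding c_eq using int_i unfolding set_integrable_def scaleR_sum_right
    by (intro Bochner_Integration.integrable_sum) auto
  have int_b: "set_integrable M B2 (\<lambda>t. complex_of_real (bulk n t))"
    by (rule set_integrable_bounded[where K = "inverse G1 ^ (2 * n)"]) (use bulk_bounds[of n] in \<open>auto simp: abs_le_iff intro: order_trans[of _ 0]\<close>)
  have "fps_nth (H * P2) n - of_real (LINT t:B2|M. bulk n t) = (LINT t:B2|M. fps_nth (H * geo t) n - of_real (bulk n t))"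
    by (subst 1, subst set_integral_complex_of_real [symmetric]) (rule set_integral_diff(2) [symmetric, OF int_c int_b])
  also have "norm \<dots> \<le> K * measure M B2"
  proof (rule set_integral_norm_le)
    show "(\<lambda>t. fps_nth (H * geo t) n - of_real (bulk n t)) \<in> borel_measurable borel"
      using c_meas by measurable
    fix t assume t: "t \<in> B2"
    show "norm (fps_nth (H * geo t) n - of_real (bulk n t)) \<le> K"
    proof (cases "t \<in> B3")
      case True
      have "norm (fps_nth (H * geo t) n - of_real (bulk n t)) \<le> inverse G1 ^ (2 * n) * (4800 / \<delta>) * inverse (1 + \<delta>/200) ^ n"
        unfolding H_def by (rule linear_coeff_near[OF True])
      also have "\<dots> \<le> K"
        unfolding K_def using \<delta> G1_pos by (intro mult_left_mono power_mono le_imp_inverse_le) auto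
      finally show ?thesis .
    next
      case False
      then show ?thesis using linear_coeff_far[OF t False] by (simp add: bulk_def H_def K_def)
    qed
  qed (use K in auto)
  also have "\<dots> \<le> K * 1" using K by (intro mult_left_mono measure_le_1 B2) auto
  finally show ?thesis by (simp add: H_def K_def)
qed

text \<open>The Lagrange factor 1 - 2n = -N meets the factor -N of the linear term. After division
  the linear term has coefficient 1 and the quadratic error has lost a power of n. Constants: 4806 =
  6 + 4800 and 9 N <= 18 n.\<close>

lemma main_estimate:
  assumes n: "n > 0"
  shows "\<bar>skeleton_count n / 16 ^ n - (LINT t:B2|M. bulk n t)\<bar>
    \<le> inverse G1 ^ (2 * n) * (4806 / \<delta> * inverse (1 + \<delta>/800) ^ n + 18 * real n * tail0 ^ 2)"
proof -
  define N where "N = 2 * n - 1"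
  have N: "N > 0" "Suc N = 2 * n" "real N = 2 * real n - 1" using n by (auto simp: N_def of_nat_diff)
  define s where "s = skeleton_count n / 16 ^ n"
  define L where "L = fps_nth (inverse P1 ^ (2 * n) * P2) n"
  define T where "T = fps_nth (inverse P1 ^ N) n"
  define Q where "Q = fps_nth (inverse gf_fps ^ N - inverse P1 ^ N + of_nat N * inverse P1 ^ Suc N * P2) n"
  define g where "g = inverse G1 ^ (2 * n)"
  have g: "g \<ge> 0" using G1_pos by (simp add: g_def)
  have f1: "of_real ((1 - 2 * real n) * s) = fps_nth (inverse gf_fps ^ N) n"
    unfolding s_def N_def by (rule skeleton_count_gf_fps[OF n])
  have f2: "Q = fps_nth (inverse gf_fps ^ N) n - T + of_nat N * L"
    unfolding Q_def T_def L_def N(2) by (simp add: fps_of_nat [symmetric] mult.assoc)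
  have f3: "of_real ((1 - 2 * real n) * s) = - (of_nat N * complex_of_real s)"
  proof -
    have "1 - 2 * real n = - real N" using N(3) by simp
    then have "(1 - 2 * real n) * s = - (real N * s)" by simp
    then show ?thesis by (simp only:) simp
  qed
  have "fps_nth (inverse gf_fps ^ N) n = - (of_nat N * complex_of_real s)"
    using f1 f3 by (simp only:)
  then have "of_nat N * (of_real s - L) = - (T + Q)"
    by (simp add: f2 algebra_simps)
  then have eq: "of_real s - L = - (T + Q) / of_nat N" using N(1) by (simp add: field_simps)
  have "norm (of_real s - L) = norm (T + Q) / real N"
    unfolding eq by (simp only: norm_divide norm_minus_cancel norm_of_nat)
  also have "\<dots> \<le> (norm T + norm Q) / real N"
    by (intro divide_right_mono norm_triangle_ineq) auto
  also have "\<dots> \<le> (g * (6 / \<delta>) * inverse (1 + \<delta>/200) ^ n + g * (9 * real N ^ 2 * tail0 ^ 2)) / real N"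
    unfolding T_def Q_def g_def N_def
    by (intro divide_right_mono add_mono first_term_bound quadratic_term_bound n) auto
  also have "\<dots> = g * (6 / \<delta>) * inverse (1 + \<delta>/200) ^ n / real N + g * (9 * real N * tail0 ^ 2)"
    using N(1) by (simp add: add_divide_distrib power2_eq_square)
  also have "\<dots> \<le> g * (6 / \<delta>) * inverse (1 + \<delta>/800) ^ n + g * (18 * real n * tail0 ^ 2)"
  proof (intro add_mono)
    have "g * (6 / \<delta>) * inverse (1 + \<delta>/200) ^ n / real N \<le> g * (6 / \<delta>) * inverse (1 + \<delta>/200) ^ n / 1"
      using N(1) g \<delta> by (intro divide_left_mono) auto
    also have "\<dots> \<le> g * (6 / \<delta>) * inverse (1 + \<delta>/800) ^ n"
      unfolding div_by_1 using \<delta> g by (intro mult_left_mono power_mono le_imp_inverse_le) auto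
    finally show "g * (6 / \<delta>) * inverse (1 + \<delta>/200) ^ n / real N \<le> g * (6 / \<delta>) * inverse (1 + \<delta>/800) ^ n" .
    show "g * (9 * real N * tail0 ^ 2) \<le> g * (18 * real n * tail0 ^ 2)"
      using N g by (intro mult_left_mono mult_right_mono) auto
  qed
  finally have 1: "norm (of_real s - L) \<le> g * (6 / \<delta>) * inverse (1 + \<delta>/800) ^ n + g * (18 * real n * tail0 ^ 2)" .
  have 2: "norm (L - of_real (LINT t:B2|M. bulk n t)) \<le> g * (4800 / \<delta>) * inverse (1 + \<delta>/800) ^ n"
    unfolding L_def g_def by (rule linear_term_bound)
  have "\<bar>s - (LINT t:B2|M. bulk n t)\<bar> = norm (of_real s - complex_of_real (LINT t:B2|M. bulk n t))"
    by (simp flip: of_real_diff)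
  also have "\<dots> \<le> norm (of_real s - L) + norm (L - of_real (LINT t:B2|M. bulk n t))"
    by (rule norm_diff_triangle_ineq[of _ L L, simplified])
  also have "\<dots> \<le> g * (4806 / \<delta> * inverse (1 + \<delta>/800) ^ n + 18 * real n * tail0 ^ 2)"
  proof -
    define a where "a = g * inverse (1 + \<delta>/800) ^ n / \<delta>"
    have e: "g * (6 / \<delta>) * inverse (1 + \<delta>/800) ^ n = 6 * a" "g * (4800 / \<delta>) * inverse (1 + \<delta>/800) ^ n = 4800 * a"
      "g * (4806 / \<delta> * inverse (1 + \<delta>/800) ^ n + 18 * real n * tail0 ^ 2) = 4806 * a + g * (18 * real n * tail0 ^ 2)"
      by (simp_all add: a_def algebra_simps)
    show ?thesis using 1 2 unfolding e by linarith
  qed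
  finally show ?thesis by (simp add: s_def g_def)
qed

end

section \<open>The Laplace integral\<close>

context gf_measure
begin

text \<open>\<open>tail0\<close> as a function of \<delta>, outside \<open>truncation\<close>
  because \<delta> will depend on n.\<close>

definition tail :: "real \<Rightarrow> real" where "tail \<delta> = (LINT t:{1-\<delta><..<1}|M. 1 / (1 - t))"

lemma tail_nonneg: "tail \<delta> \<ge> 0"
  unfolding tail_def set_lebesgue_integral_def
  by (rule Bochner_Integration.integral_nonneg) (auto simp: indicator_def)

text \<open>For K about 1 / \<delta> one has t^K >= exp (-2) on (1 - \<delta>, 1). Hence the tail is
  at most exp 2 times the integral of t^K / (1 - t), which is bounded by the sum of the moments from
  K on, of order K^(-4).\<close>

lemma tail_bound: "\<exists>C>0. \<forall>\<delta>. 0 < \<delta> \<and> \<delta> \<le> 1/2 \<longrightarrow> tail \<delta> \<le> C * \<delta> ^ 4"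
proof -
  obtain C where C: "C > 0" "\<And>n. real n ^ 5 * gf_coeff n \<le> C"
    using gf_coeff_bound by blast
  have "tail \<delta> \<le> (64 * exp 2 * C) * \<delta> ^ 4" if \<delta>: "0 < \<delta>" "\<delta> \<le> 1/2" for \<delta>
  proof -
    define K where "K = nat \<lfloor>1 / \<delta>\<rfloor>"
    have "1 / \<delta> \<ge> 2" using \<delta> by (simp add: field_simps)
    then have K: "real K \<le> 1 / \<delta>" "1 / \<delta> - 1 < real K"
      unfolding K_def by linarith+
    have K_half: "1 / (2 * \<delta>) \<le> real K" using K \<open>1 / \<delta> \<ge> 2\<close> by (simp add: field_simps)
    have K1: "real K \<ge> 1" using K_half \<open>1 / \<delta> \<ge> 2\<close> by (simp add: field_simps)
    have B: "{1-\<delta><..<1} \<in> sets borel" "{1-\<delta><..<1} \<subseteq> {0..<1}" using \<delta> by auto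
    have pow: "exp (-2) \<le> t ^ K" if "t \<in> {1-\<delta><..<1}" for t
    proof -
      have "- 2 * \<delta> \<le> - \<delta> - 2 * \<delta>\<^sup>2" using \<delta> by (simp add: power2_eq_square)
      also have "\<dots> \<le> ln (1 - \<delta>)" using \<delta> by (intro ln_one_minus_pos_lower_bound) auto
      finally have "real K * (- 2 * \<delta>) \<le> real K * ln (1 - \<delta>)" by (intro mult_left_mono) auto
      moreover have "real K * \<delta> \<le> 1" using K \<delta> by (simp add: field_simps)
      ultimately have "exp (-2) \<le> exp (real K * ln (1 - \<delta>))" by simp
      also have "\<dots> = (1 - \<delta>) ^ K" using \<delta> by (simp add: exp_of_nat_mult)
      also have "\<dots> \<le> t ^ K" using that \<delta> by (intro power_mono) auto
      finally show ?thesis .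
    qed
    have s: "(\<lambda>n. (if K \<le> n then 1 else 0) * t ^ n) sums (t ^ K / (1 - t))" if "0 \<le> t" "t < 1" for t :: real
    proof -
      have "(\<lambda>n. t ^ K * t ^ n) sums (t ^ K * (1 / (1 - t)))"
        using that geometric_sums[of t] by (intro sums_mult) auto
      then have "(\<lambda>n. (if K \<le> n + K then 1 else 0) * t ^ (n + K)) sums (t ^ K / (1 - t))"
        by (simp add: power_add mult.commute)
      then show ?thesis by (subst (asm) sums_iff_shift) simp
    qed
    have s': "(\<lambda>n. (if K \<le> n then 1 else 0) * gf_coeff n) sums (gf_sum - sum gf_coeff {..<K})"
    proof -
      have "(\<lambda>n. (if K \<le> n + K then 1 else 0) * gf_coeff (n + K)) sums (gf_sum - sum gf_coeff {..<K})"
        using gf_coeff_tail(1)[of K] by simp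
      then show ?thesis by (subst (asm) sums_iff_shift) simp
    qed
    have w: "0 \<le> (if K \<le> n then 1 else (0::real))" for n by simp
    note wm = weighted_moments[OF B w s sums_summable[OF s']]
    have "tail \<delta> \<le> (LINT t:{1-\<delta><..<1}|M. exp 2 * (t ^ K / (1 - t)))"
      unfolding tail_def
    proof (rule set_integral_mono)
      show "set_integrable M {1-\<delta><..<1} (\<lambda>t. 1 / (1 - t))" by (rule excess_integrals(1)[OF B])
      show "set_integrable M {1-\<delta><..<1} (\<lambda>t. exp 2 * (t ^ K / (1 - t)))"
        by (intro set_integrable_mult_right wm(1))
      fix t assume t: "t \<in> {1-\<delta><..<1}"
      have "exp 2 * exp (-2) \<le> exp 2 * t ^ K" using pow[OF t] by (intro mult_left_mono) auto
      then have "1 \<le> exp 2 * t ^ K" by (simp flip: exp_add)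
      then have "1 / (1 - t) \<le> (exp 2 * t ^ K) / (1 - t)" using t by (intro divide_right_mono) auto
      then show "1 / (1 - t) \<le> exp 2 * (t ^ K / (1 - t))" by simp
    qed
    also have "\<dots> = exp 2 * (LINT t:{1-\<delta><..<1}|M. t ^ K / (1 - t))" by (rule set_integral_mult_right)
    also have "\<dots> \<le> exp 2 * (gf_sum - sum gf_coeff {..<K})"
      using wm(3) sums_unique[OF s'] by (intro mult_left_mono) auto
    also have "gf_sum - sum gf_coeff {..<K} \<le> 4 * C * (1 / real K ^ 4)"
    proof -
      have "gf_sum - sum gf_coeff {..<K} \<le> (real K + 2) * (real K + 3) * gf_coeff K / (3 * real K + 21/4)"
        by (rule gf_coeff_tail(2))
      also have "\<dots> \<le> (3 * real K) * (4 * real K) * gf_coeff K / (3 * real K)"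
        using K1 gf_coeff_pos[of K] by (intro frac_le mult_mono mult_right_mono mult_nonneg_nonneg) auto
      also have "\<dots> = 4 * (real K ^ 5 * gf_coeff K) * (1 / real K ^ 4)"
        using K1 by (simp add: field_simps eval_nat_numeral)
      also have "\<dots> \<le> 4 * C * (1 / real K ^ 4)"
        using C(2)[of K] by (intro mult_right_mono mult_left_mono) auto
      finally show ?thesis .
    qed
    also have "1 / real K ^ 4 \<le> 1 / (1 / (2 * \<delta>)) ^ 4"
      using K_half \<delta> K1 by (intro divide_left_mono power_mono mult_pos_pos) auto
    finally show ?thesis using C(1) by (simp add: power_divide power_mult_distrib mult_ac)
  qed
  then show ?thesis using C(1) by (intro exI[of _ "64 * exp 2 * C"]) auto
qed

text \<open>Passing to the next power of 1 / (1 - t) gains a factor \<delta>; the additional t >=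
  1/2 costs a factor 2.\<close>

lemma tail1_bound:
  assumes "0 < \<delta>" "\<delta> \<le> 1/2"
  shows "(LINT t:{1-\<delta><..<1}|M. t / (1 - t)^2) \<le> \<delta> * (gf_sum2 - gf_sum1)"
proof -
  have B: "{1-\<delta><..<1} \<in> sets borel" "{1-\<delta><..<1} \<subseteq> {0..<1}" using assms by auto
  note ex = excess_integrals[OF B]
  have "(LINT t:{1-\<delta><..<1}|M. t / (1 - t)^2) \<le> (LINT t:{1-\<delta><..<1}|M. (2 * \<delta>) * (t^2 / (1 - t)^3))"
  proof (rule set_integral_mono[OF ex(4) set_integrable_mult_right[OF ex(6)]])
    fix t assume t: "t \<in> {1-\<delta><..<1}"
    have "t * (1 - t) \<le> (2 * t * t) * \<delta>"
      using t assms by (intro mult_mono) auto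
    then show "t / (1 - t)^2 \<le> (2 * \<delta>) * (t^2 / (1 - t)^3)"
      using t by (simp add: divide_simps power2_eq_square power3_eq_cube) (simp add: mult_ac)
  qed
  also have "\<dots> = (2 * \<delta>) * (LINT t:{1-\<delta><..<1}|M. t^2 / (1 - t)^3)"
    by (rule set_integral_mult_right)
  also have "\<dots> \<le> (2 * \<delta>) * ((gf_sum2 - gf_sum1) / 2)"
    using assms ex(7) by (intro mult_left_mono) auto
  finally show ?thesis by simp
qed

section \<open>Moments of real order\<close>

definition moment :: "real \<Rightarrow> real" where "moment s = (LINT t:{0..<1}|M. t powr s)"

lemma powr_integrable: "s > 0 \<Longrightarrow> B \<in> sets borel \<Longrightarrow> B \<subseteq> {0..<1} \<Longrightarrow> set_integrable M B (\<lambda>t. t powr s)"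
  by (rule set_integrable_bounded[where K = 1]) (auto simp: subset_iff intro!: powr_le1)

lemma moment_bounds:
  assumes "s > 0"
  shows "gf_coeff (Suc (nat \<lfloor>s\<rfloor>)) \<le> moment s" "moment s \<le> gf_coeff (nat \<lfloor>s\<rfloor>)"
proof -
  define m where "m = nat \<lfloor>s\<rfloor>"
  have m: "real m \<le> s" "s < real (Suc m)" using assms unfolding m_def by linarith+
  have U: "{0..<1::real} \<in> sets borel" "{0..<1::real} \<subseteq> {0..<1}" by auto
  show "gf_coeff (Suc (nat \<lfloor>s\<rfloor>)) \<le> moment s"
    unfolding moment_def unit_moment[symmetric] m_def [symmetric]
  proof (rule set_integral_mono[OF power_set_integrable[OF U] powr_integrable[OF assms U]])
    fix t :: real assume t: "t \<in> {0..<1}"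
    show "t ^ Suc m \<le> t powr s"
    proof (cases "t = 0")
      case False
      then have "t ^ Suc m = t powr real (Suc m)" using t by (simp add: powr_realpow del: of_nat_Suc power_Suc)
      also have "\<dots> \<le> t powr s" using t m False by (intro powr_mono') auto
      finally show ?thesis .
    qed simp
  qed
  show "moment s \<le> gf_coeff (nat \<lfloor>s\<rfloor>)"
    unfolding moment_def unit_moment[symmetric] m_def [symmetric]
  proof (rule set_integral_mono[OF powr_integrable[OF assms U] power_set_integrable[OF U]])
    fix t :: real assume t: "t \<in> {0..<1}"
    show "t powr s \<le> t ^ m"
    proof (cases "t = 0")
      case False
      have "t powr s \<le> t powr real m" using t m False by (intro powr_mono') auto
      then show ?thesis using False t by (simp add: powr_realpow)
    qed simp
  qed
qed

text \<open>A moment of real order lies between the two neighbouring integer moments, and rounding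
  the order changes it by a factor tending to 1.\<close>

lemma moment_asymp:
  assumes "\<alpha> > 0"
  shows "(\<lambda>n. real n ^ 5 * moment (real n * \<alpha>)) \<longlonglongrightarrow> 24 / pi / \<alpha> ^ 5"
proof -
  define m where "m n = nat \<lfloor>real n * \<alpha>\<rfloor>" for n
  have m_bounds: "real n * \<alpha> - 1 \<le> real (m n)" "real (m n) \<le> real n * \<alpha>" for n
    using assms unfolding m_def by (auto simp: of_nat_nat)
  have m_inf: "filterlim m at_top sequentially"
  proof -
    have "filterlim (\<lambda>n. real n * \<alpha> - 1) at_top sequentially" using assms by real_asymp
    then have "filterlim (\<lambda>n. real (m n)) at_top sequentially"
      by (rule filterlim_at_top_mono) (use m_bounds in auto)
    then show ?thesis by (simp add: filterlim_sequentially_iff_filterlim_real)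
  qed
  have ratio: "(\<lambda>n. real (m n) / real n) \<longlonglongrightarrow> \<alpha>"
  proof (rule tendsto_sandwich)
    show "(\<lambda>n. \<alpha> - 1 / real n) \<longlonglongrightarrow> \<alpha>" by real_asymp
    show "\<forall>\<^sub>F n in sequentially. \<alpha> - 1 / real n \<le> real (m n) / real n"
      using eventually_gt_at_top[of 0]
    proof eventually_elim
      case (elim n)
      then have "(real n * \<alpha> - 1) / real n \<le> real (m n) / real n"
        using m_bounds(1)[of n] by (intro divide_right_mono) auto
      then show ?case using elim by (simp add: diff_divide_distrib)
    qed
    show "\<forall>\<^sub>F n in sequentially. real (m n) / real n \<le> \<alpha>"
      using eventually_gt_at_top[of 0]
    proof eventually_elim
      case (elim n)
      then show ?case using m_bounds(2)[of n] by (simp add: field_simps)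
    qed
  qed simp
  have key: "(\<lambda>n. real n ^ 5 * gf_coeff (m n + j)) \<longlonglongrightarrow> 24 / pi / \<alpha> ^ 5" for j
  proof -
    have inf: "filterlim (\<lambda>n. m n + j) at_top sequentially"
      by (rule filterlim_at_top_mono[OF m_inf]) auto
    have "(\<lambda>n. real (m n + j) / real n) \<longlonglongrightarrow> \<alpha>"
    proof -
      have "(\<lambda>n. real (m n) / real n + real j / real n) \<longlonglongrightarrow> \<alpha> + 0"
        by (intro tendsto_add ratio) real_asymp
      then show ?thesis by (simp add: add_divide_distrib)
    qed
    moreover have "(\<lambda>n. real (m n + j) ^ 5 * gf_coeff (m n + j)) \<longlonglongrightarrow> 24 / pi"
      by (rule filterlim_compose[OF gf_coeff_asymp inf])
    ultimately have "(\<lambda>n. real (m n + j) ^ 5 * gf_coeff (m n + j) / (real (m n + j) / real n) ^ 5) \<longlonglongrightarrow> 24 / pi / \<alpha> ^ 5"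
      using assms by (intro tendsto_divide tendsto_power) auto
    moreover have "\<forall>\<^sub>F n in sequentially. real (m n + j) ^ 5 * gf_coeff (m n + j) / (real (m n + j) / real n) ^ 5 = real n ^ 5 * gf_coeff (m n + j)"
      using eventually_compose_filterlim[OF eventually_gt_at_top[of 0] inf] eventually_gt_at_top[of 0]
    proof eventually_elim
      case (elim n)
      then show ?case by (simp add: power_divide del: of_nat_add)
    qed
    ultimately show ?thesis by (rule Lim_transform_eventually)
  qed
  show ?thesis
  proof (rule tendsto_sandwich)
    show "(\<lambda>n. real n ^ 5 * gf_coeff (m n + 1)) \<longlonglongrightarrow> 24 / pi / \<alpha> ^ 5" by (rule key)
    show "(\<lambda>n. real n ^ 5 * gf_coeff (m n + 0)) \<longlonglongrightarrow> 24 / pi / \<alpha> ^ 5" by (rule key)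
    show "\<forall>\<^sub>F n in sequentially. real n ^ 5 * gf_coeff (m n + 1) \<le> real n ^ 5 * moment (real n * \<alpha>)"
      using eventually_gt_at_top[of 0]
    proof eventually_elim
      case (elim n)
      then show ?case using moment_bounds(1)[of "real n * \<alpha>"] assms by (intro mult_left_mono) (auto simp: m_def)
    qed
    show "\<forall>\<^sub>F n in sequentially. real n ^ 5 * moment (real n * \<alpha>) \<le> real n ^ 5 * gf_coeff (m n + 0)"
      using eventually_gt_at_top[of 0]
    proof eventually_elim
      case (elim n)
      then show ?case using moment_bounds(2)[of "real n * \<alpha>"] assms by (intro mult_left_mono) (auto simp: m_def)
    qed
  qed
qed

end

section \<open>Comparison of F1(1/t) with powers of t\<close>

context truncation
begin

lemma tail0_eq: "tail0 = tail \<delta>"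
  by (simp add: tail0_def tail_def)

lemma unit_split: "{0..<1} = B1 \<union> B2" "B1 \<inter> B2 = {}"
  using \<delta> by auto

lemma G1_eq: "G1 = gf_sum - tail0"
proof -
  have "gf_sum = (LINT t:B1 \<union> B2|M. 1 / (1 - t))"
    unfolding gf_sum_integral[symmetric] using unit_split by simp
  also have "\<dots> = (LINT t:B1|M. 1 / (1 - t)) + tail0"
    unfolding tail0_def using \<delta> unit_split(2) by (intro set_integral_Un excess_integrals) auto
  finally show ?thesis by (simp add: G1_def stieltjes_real_def)
qed

text \<open>The derivative of F1 at 1.\<close>

definition D1 :: real where "D1 = (LINT t:B1|M. t / (1 - t)^2)"

lemma D1_bounds: "gf_sum1 - \<delta> * (gf_sum2 - gf_sum1) \<le> D1" "D1 \<le> gf_sum1"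
proof -
  have "gf_sum1 = (LINT t:B1 \<union> B2|M. t / (1 - t)^2)"
    unfolding gf_sum1_integral[symmetric] using unit_split by simp
  also have "\<dots> = D1 + (LINT t:B2|M. t / (1 - t)^2)"
    unfolding D1_def using \<delta> unit_split(2) by (intro set_integral_Un excess_integrals) auto
  finally show "gf_sum1 - \<delta> * (gf_sum2 - gf_sum1) \<le> D1" using tail1_bound[OF \<delta>] by simp
  show "D1 \<le> gf_sum1" unfolding D1_def using \<delta> by (intro excess_integrals) auto
qed

text \<open>Integrates 1 / (a - b) = 1 / a + b / a^2 + b^2 / (a^2 (a - b)) with a = 1 - t and b = y
  t; here b <= a / 2 because a >= \<delta> on B1. The quadratic coefficient is bounded by that of
  the whole measure, hence independently of \<delta>.\<close>

lemma F1_taylor: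
  assumes y: "0 \<le> y" "y \<le> \<delta>/400"
  shows "G1 + y * D1 \<le> stieltjes_real B1 (1 + y)" "stieltjes_real B1 (1 + y) \<le> G1 + y * D1 + y^2 * (gf_sum2 - gf_sum1)"
proof -
  have B: "B1 \<in> sets borel" "B1 \<subseteq> {0..<1}" using \<delta> by auto
  note ex = excess_integrals[OF B]
  have int: "set_integrable M B1 (\<lambda>t. 1 / (1 - (1 + y) * t))"
    using y \<delta> by (intro kernel_real_integrable_T) auto
  have int1: "set_integrable M B1 (\<lambda>t. 1 / (1 - t) + y * (t / (1 - t)^2))"
    by (intro set_integral_add(1) set_integrable_mult_right ex)
  have int2: "set_integrable M B1 (\<lambda>t. 1 / (1 - t) + y * (t / (1 - t)^2) + 2 * y^2 * (t^2 / (1 - t)^3))"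
    by (intro set_integral_add(1) set_integrable_mult_right ex)
  have eq1: "G1 + y * D1 = (LINT t:B1|M. 1 / (1 - t) + y * (t / (1 - t)^2))"
    unfolding set_integral_add(2)[OF ex(1) set_integrable_mult_right[OF ex(4)]] set_integral_mult_right
    by (simp add: G1_def stieltjes_real_def D1_def)
  have kernel: "1 / (1 - t) + y * (t / (1 - t)^2) \<le> 1 / (1 - (1 + y) * t)
      \<and> 1 / (1 - (1 + y) * t) \<le> 1 / (1 - t) + y * (t / (1 - t)^2) + 2 * y^2 * (t^2 / (1 - t)^3)"
    if t: "t \<in> B1" for t
  proof -
    define a b where "a = 1 - t" and "b = y * t"
    have a: "a \<ge> \<delta>" "a > 0" using t \<delta> by (auto simp: a_def)
    have "b \<le> \<delta>/400 * 1" unfolding b_def using t y \<delta> by (intro mult_mono) auto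
    then have b: "0 \<le> b" "b \<le> a / 2" using a \<delta> t y by (auto simp: b_def)
    have ab: "a - b \<ge> a / 2" "a - b > 0" using a b by auto
    have "1 / (a - b) = 1 / a + b / a^2 + b^2 / (a^2 * (a - b))"
      using a ab by (simp add: divide_simps) (simp add: algebra_simps power2_eq_square)
    moreover have "0 \<le> b^2 / (a^2 * (a - b))" using ab by simp
    moreover have "b^2 / (a^2 * (a - b)) \<le> b^2 / (a^2 * (a / 2))"
      using a ab by (intro divide_left_mono mult_left_mono mult_pos_pos) auto
    moreover have "b^2 / (a^2 * (a / 2)) = 2 * y^2 * (t^2 / a^3)"
      by (simp add: b_def power_mult_distrib power3_eq_cube power2_eq_square)
    moreover have "b / a^2 = y * (t / a^2)" by (simp add: b_def)
    moreover have "1 - (1 + y) * t = a - b" by (simp add: a_def b_def algebra_simps)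
    ultimately show ?thesis unfolding a_def [symmetric] by auto
  qed
  show "G1 + y * D1 \<le> stieltjes_real B1 (1 + y)"
    unfolding eq1 stieltjes_real_def using kernel by (intro set_integral_mono int int1) auto
  have "stieltjes_real B1 (1 + y) \<le> (LINT t:B1|M. 1 / (1 - t) + y * (t / (1 - t)^2) + 2 * y^2 * (t^2 / (1 - t)^3))"
    unfolding stieltjes_real_def using kernel by (intro set_integral_mono int int2) auto
  also have "\<dots> = G1 + y * D1 + 2 * y^2 * (LINT t:B1|M. t^2 / (1 - t)^3)"
    unfolding set_integral_add(2)[OF int1 set_integrable_mult_right[OF ex(6)]] eq1 set_integral_mult_right by simp
  also have "\<dots> \<le> G1 + y * D1 + 2 * y^2 * ((gf_sum2 - gf_sum1) / 2)"
    using ex(7) by (intro add_left_mono mult_left_mono) auto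
  finally show "stieltjes_real B1 (1 + y) \<le> G1 + y * D1 + y^2 * (gf_sum2 - gf_sum1)" by simp
qed

text \<open>The logarithmic derivative of F at 1, so that A = 1 + 2 \<open>p1\<close>.\<close>

definition p1 :: real where "p1 = gf_sum1 / gf_sum"

lemma gf_constants: "gf_sum \<ge> 1" "gf_sum1 > 0" "1/10 \<le> p1" "p1 \<le> 2/10" "0 \<le> gf_sum2 - gf_sum1" "gf_sum2 - gf_sum1 \<le> 1"
proof -
  show S: "gf_sum \<ge> 1" using gf_sum_bounds by simp
  show "gf_sum1 > 0" "0 \<le> gf_sum2 - gf_sum1" "gf_sum2 - gf_sum1 \<le> 1"
    using gf_sum_bounds unfolding gf_sum2_eq gf_sum1_eq by (simp_all add: field_simps)
  have "1/10 * gf_sum \<le> gf_sum1" "gf_sum1 \<le> 2/10 * gf_sum"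
    using gf_sum_bounds unfolding gf_sum1_eq by simp_all
  then show "1/10 \<le> p1" "p1 \<le> 2/10" using S by (simp_all add: p1_def field_simps)
qed

lemma tail0_nonneg: "tail0 \<ge> 0"
  unfolding tail0_eq by (rule tail_nonneg)

text \<open>F1(1/t) is close to F(1) t^(-p1). The slack \<eta> absorbs the square of y = 1 / t - 1
  and the O(\<delta>) gap between D1 and F'(1); the factor 1 - \<open>tail0\<close> absorbs F(1) -
  F1(1).\<close>

lemma F1_powr_bounds:
  assumes t: "t \<in> B3" and \<eta>: "0 < \<eta>" "\<eta> \<le> 1/10" "3 * \<delta> \<le> \<eta>" and x: "tail0 < 1"
  shows "gf_sum * (1 - tail0) * t powr (- (p1 - \<eta>)) \<le> stieltjes_real B1 (1 / t)"
    and "stieltjes_real B1 (1 / t) \<le> gf_sum * t powr (- (p1 + \<eta>))"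
proof -
  define S where "S = gf_sum"
  define c where "c = gf_sum2 - gf_sum1"
  note gc = gf_constants[folded S_def c_def]
  have p1: "gf_sum1 = p1 * S" using gc by (simp add: p1_def S_def)
  define y where "y = 1 / t - 1"
  note tb = B3_inverse[OF t]
  have y: "0 \<le> y" "y \<le> \<delta>/400" "1 / t = 1 + y" using tb by (auto simp: y_def)
  have t_powr: "t powr (- a) = (1 + y) powr a" for a
    unfolding y(3) [symmetric] by (simp add: powr_minus powr_divide inverse_eq_divide)
  have G: "G1 = S - tail0" by (simp add: G1_eq S_def)
  have D: "p1 * S - \<delta> * c \<le> D1" "D1 \<le> p1 * S"
    using D1_bounds unfolding p1 [symmetric] c_def by auto
  have tl: "tail0 \<ge> 0" by (rule tail0_nonneg)
  \<comment> \<open>Bernoulli's inequality for an exponent in [0, 1], as the weighted mean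
    inequality for 1 + y and 1.\<close>
  have "(1 + y) powr (p1 - \<eta>) * 1 powr (1 - (p1 - \<eta>)) \<le> (p1 - \<eta>) * (1 + y) + (1 - (p1 - \<eta>)) * 1"
    using gc \<eta> y by (intro Youngs_inequality_0) auto
  then have bern: "(1 + y) powr (p1 - \<eta>) \<le> 1 + (p1 - \<eta>) * y" by (simp add: algebra_simps)
  have "S * (1 - tail0) * (1 + y) powr (p1 - \<eta>) \<le> S * (1 - tail0) * (1 + (p1 - \<eta>) * y)"
    using bern gc x by (intro mult_left_mono mult_nonneg_nonneg) auto
  also have "\<dots> \<le> S * (1 + (p1 - \<eta>) * y) - tail0 * 1"
  proof -
    have "1 * 1 \<le> S * (1 + (p1 - \<eta>) * y)" using gc \<eta> y by (intro mult_mono) auto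
    then have "tail0 * 1 \<le> tail0 * (S * (1 + (p1 - \<eta>) * y))" using tl by (intro mult_left_mono) auto
    then show ?thesis by (simp add: algebra_simps)
  qed
  also have "\<dots> \<le> G1 + y * D1"
  proof -
    have "\<delta> * c \<le> \<eta> * 1" using gc \<eta> \<delta> by (intro mult_mono) auto
    also have "\<dots> \<le> \<eta> * S" using gc \<eta> by (intro mult_left_mono) auto
    finally have "p1 * S - \<eta> * S \<le> D1" using D(1) by linarith
    then have "y * (p1 * S - \<eta> * S) \<le> y * D1" using y by (intro mult_left_mono)
    then show ?thesis by (simp add: G algebra_simps)
  qed
  also have "\<dots> \<le> stieltjes_real B1 (1 / t)" unfolding y(3) by (rule F1_taylor(1)[OF y(1,2)])
  finally show "gf_sum * (1 - tail0) * t powr (- (p1 - \<eta>)) \<le> stieltjes_real B1 (1 / t)"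
    unfolding t_powr S_def .
  define a where "a = p1 + \<eta>"
  have a: "0 \<le> a" "a \<le> 1" using gc \<eta> by (auto simp: a_def)
  have "stieltjes_real B1 (1 / t) \<le> G1 + y * D1 + y^2 * c" unfolding y(3) c_def by (rule F1_taylor(2)[OF y(1,2)])
  also have "\<dots> \<le> S + y * (p1 * S) + y^2 * 1"
    using tl D(2) y gc by (intro add_mono mult_left_mono) (auto simp: G)
  also have "\<dots> \<le> S * (1 + p1 * y + y^2)"
    using gc mult_right_mono[of 1 S "y^2"] by (simp add: algebra_simps)
  also have "\<dots> \<le> S * (1 + a * (y - y^2))"
  proof (intro mult_left_mono)
    have "y * 2 \<le> \<eta>" using y \<eta> by simp
    then have "y * (y * 2) \<le> y * \<eta>" using y by (intro mult_left_mono) auto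
    moreover have "a * y^2 \<le> 1 * y^2" using a by (intro mult_right_mono) auto
    ultimately show "1 + p1 * y + y^2 \<le> 1 + a * (y - y^2)" by (simp add: a_def algebra_simps power2_eq_square)
  qed (use gc in auto)
  also have "\<dots> \<le> S * (1 + y) powr a"
  proof (intro mult_left_mono)
    have "y - y^2 \<le> ln (1 + y)" using y \<delta> by (intro ln_one_plus_pos_lower_bound) auto
    then have "1 + a * (y - y^2) \<le> 1 + a * ln (1 + y)" using a by (intro add_left_mono mult_left_mono)
    also have "\<dots> \<le> exp (a * ln (1 + y))" by (rule exp_ge_add_one_self)
    also have "\<dots> = (1 + y) powr a" using y by (simp add: powr_def)
    finally show "1 + a * (y - y^2) \<le> (1 + y) powr a" .
  qed (use gc in auto)
  finally show "stieltjes_real B1 (1 / t) \<le> gf_sum * t powr (- (p1 + \<eta>))"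
    unfolding t_powr S_def a_def .
qed

lemma bulk_powr_bounds:
  assumes t: "t \<in> B3" and \<eta>: "0 < \<eta>" "\<eta> \<le> 1/10" "3 * \<delta> \<le> \<eta>" and x: "tail0 < 1"
  shows "bulk n t \<le> inverse (gf_sum * (1 - tail0)) ^ (2 * n) * t powr (real n * (1 + 2 * p1 - 2 * \<eta>))"
    and "inverse gf_sum ^ (2 * n) * t powr (real n * (1 + 2 * p1 + 2 * \<eta>)) \<le> bulk n t"
proof -
  note tb = B3_inverse[OF t]
  note F = F1_powr_bounds[OF assms]
  have S: "gf_sum > 0" using gf_constants(1) by simp
  have bulk: "bulk n t = t ^ n * inverse (stieltjes_real B1 (1 / t)) ^ (2 * n)"
    using t unfolding bulk_def by simp
  have conv: "t ^ n * inverse (K * t powr (- a)) ^ (2 * n) = inverse K ^ (2 * n) * t powr (real n * (1 + 2 * a))" for K a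
  proof -
    have 1: "t ^ n = t powr real n" using tb by (simp add: powr_realpow)
    have 2: "inverse (K * t powr (- a)) ^ (2 * n) = inverse K ^ (2 * n) * t powr (real (2 * n) * a)"
    proof -
      have "inverse (K * t powr (- a)) = inverse K * t powr a" using tb by (simp add: powr_minus)
      moreover have "(t powr a) ^ (2 * n) = t powr (real (2 * n) * a)" using tb by (intro powr_power) auto
      ultimately show ?thesis by (simp only: power_mult_distrib)
    qed
    have "t powr real n * (inverse K ^ (2 * n) * t powr (real (2 * n) * a)) =
        inverse K ^ (2 * n) * (t powr real n * t powr (real (2 * n) * a))"
      by (rule mult.left_commute)
    also have "t powr real n * t powr (real (2 * n) * a) = t powr (real n * (1 + 2 * a))"
      by (simp add: algebra_simps flip: powr_add)
    finally show ?thesis unfolding 1 2 .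
  qed
  have pos: "0 < gf_sum * (1 - tail0) * t powr (- (p1 - \<eta>))" using S x tb by simp
  have "t ^ n * inverse (stieltjes_real B1 (1 / t)) ^ (2 * n) \<le>
      t ^ n * inverse (gf_sum * (1 - tail0) * t powr (- (p1 - \<eta>))) ^ (2 * n)"
    using F(1) pos tb by (intro mult_left_mono power_mono le_imp_inverse_le) auto
  then show "bulk n t \<le> inverse (gf_sum * (1 - tail0)) ^ (2 * n) * t powr (real n * (1 + 2 * p1 - 2 * \<eta>))"
    unfolding bulk conv by (simp add: algebra_simps)
  have "t ^ n * inverse (gf_sum * t powr (- (p1 + \<eta>))) ^ (2 * n) \<le> t ^ n * inverse (stieltjes_real B1 (1 / t)) ^ (2 * n)"
    using F pos S tb by (intro mult_left_mono power_mono le_imp_inverse_le) (auto intro: less_le_trans)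
  then show "inverse gf_sum ^ (2 * n) * t powr (real n * (1 + 2 * p1 + 2 * \<eta>)) \<le> bulk n t"
    unfolding bulk conv by (simp add: algebra_simps)
qed

text \<open>Extending the integral of the power from B3 to [0, 1) is free for the upper bound. For
  the lower one it costs at most (1 + \<delta>/400)^(-n), since t <= 1 / (1 + \<delta>/400) off B3
  and the exponent is at least n.\<close>

lemma bulk_integral_bounds:
  assumes \<eta>: "0 < \<eta>" "\<eta> \<le> 1/10" "3 * \<delta> \<le> \<eta>" and x: "tail0 < 1" and n: "n > 0"
  shows "(LINT t:B2|M. bulk n t) \<le> inverse (gf_sum * (1 - tail0)) ^ (2 * n) * moment (real n * (1 + 2 * p1 - 2 * \<eta>))"
    and "inverse gf_sum ^ (2 * n) * (moment (real n * (1 + 2 * p1 + 2 * \<eta>)) - inverse (1 + \<delta>/400) ^ n) \<le> (LINT t:B2|M. bulk n t)"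
proof -
  have S: "gf_sum > 0" using gf_constants(1) by simp
  have p: "1/10 \<le> p1" by (rule gf_constants(3))
  have U: "{0..<1::real} \<in> sets borel" "{0..<1::real} \<subseteq> {0..<1}" by auto
  have "B2 \<subseteq> {0..<1}" using \<delta> by auto
  have "indicator B2 t *\<^sub>R bulk n t = indicator {0..<1} t *\<^sub>R bulk n t" for t
  proof (cases "t \<in> B3")
    case True
    then have "t \<in> B2" "t \<in> {0..<1}" using B3_sub_B2 \<open>B2 \<subseteq> {0..<1}\<close> by blast+
    then show ?thesis by (simp only: indicator_simps)
  next
    case False
    then have "bulk n t = 0" by (simp add: bulk_def del: atLeastLessThan_iff)
    then show ?thesis by simp
  qed
  then have eq: "(LINT t:B2|M. bulk n t) = (LINT t:{0..<1}|M. bulk n t)"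
    unfolding set_lebesgue_integral_def by (simp only:)
  have int_b: "set_integrable M {0..<1} (bulk n)"
    by (rule set_integrable_bounded[where K = "inverse G1 ^ (2 * n)"])
       (use bulk_bounds[of n] in \<open>auto simp: abs_le_iff intro: order_trans[of _ 0]\<close>)
  have s1: "real n * (1 + 2 * p1 - 2 * \<eta>) > 0" "real n * (1 + 2 * p1 + 2 * \<eta>) > 0" using n p \<eta> by simp_all
  define K where "K = inverse (gf_sum * (1 - tail0)) ^ (2 * n)"
  have K: "K \<ge> 0" using S x by (simp add: K_def)
  have "(LINT t:{0..<1}|M. bulk n t) \<le> (LINT t:{0..<1}|M. K * t powr (real n * (1 + 2 * p1 - 2 * \<eta>)))"
  proof (rule set_integral_mono[OF int_b set_integrable_mult_right[OF powr_integrable[OF s1(1) U]]])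
    fix t :: real
    show "bulk n t \<le> K * t powr (real n * (1 + 2 * p1 - 2 * \<eta>))"
    proof (cases "t \<in> B3")
      case True
      then show ?thesis unfolding K_def by (rule bulk_powr_bounds(1)[OF _ \<eta> x])
    next
      case False
      then have "bulk n t = 0" by (simp add: bulk_def del: atLeastLessThan_iff)
      then show ?thesis using K by simp
    qed
  qed
  also have "\<dots> = K * moment (real n * (1 + 2 * p1 - 2 * \<eta>))"
    unfolding moment_def by (rule set_integral_mult_right)
  finally show "(LINT t:B2|M. bulk n t) \<le> inverse (gf_sum * (1 - tail0)) ^ (2 * n) * moment (real n * (1 + 2 * p1 - 2 * \<eta>))"
    unfolding eq K_def .
  define L where "L = inverse gf_sum ^ (2 * n)"
  have L: "L \<ge> 0" using S by (simp add: L_def)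
  define e where "e = inverse (1 + \<delta>/400) ^ n"
  have e: "e \<ge> 0" using \<delta> by (simp add: e_def)
  have int_e: "set_integrable M {0..<1} (\<lambda>t. L * e)"
    by (rule set_integrable_bounded[where K = "L * e"]) (use L e in auto)
  have "L * moment (real n * (1 + 2 * p1 + 2 * \<eta>)) = (LINT t:{0..<1}|M. L * t powr (real n * (1 + 2 * p1 + 2 * \<eta>)))"
    unfolding moment_def by (rule set_integral_mult_right [symmetric])
  also have "\<dots> \<le> (LINT t:{0..<1}|M. bulk n t + L * e)"
  proof (rule set_integral_mono[OF set_integrable_mult_right[OF powr_integrable[OF s1(2) U]] set_integral_add(1)[OF int_b int_e]])
    fix t :: real assume t: "t \<in> {0..<1}"
    show "L * t powr (real n * (1 + 2 * p1 + 2 * \<eta>)) \<le> bulk n t + L * e"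
    proof (cases "t \<in> B3")
      case True
      then have "L * t powr (real n * (1 + 2 * p1 + 2 * \<eta>)) \<le> bulk n t" unfolding L_def by (rule bulk_powr_bounds(2)[OF _ \<eta> x])
      then show ?thesis using mult_nonneg_nonneg[OF L e] by linarith
    next
      case False
      then have t_lt: "t \<le> inverse (1 + \<delta>/400)" using t by (auto simp: inverse_eq_divide)
      have "t powr (real n * (1 + 2 * p1 + 2 * \<eta>)) \<le> e"
      proof (cases "t = 0")
        case True
        then show ?thesis using e by simp
      next
        case False
        have "t powr (real n * (1 + 2 * p1 + 2 * \<eta>)) \<le> t powr (real n * 1)"
          using t False p \<eta> by (intro powr_mono' mult_left_mono) auto
        also have "\<dots> = t ^ n" using t False by (simp add: powr_realpow)
        also have "\<dots> \<le> e" unfolding e_def using t t_lt by (intro power_mono) auto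
        finally show ?thesis .
      qed
      then have "L * t powr (real n * (1 + 2 * p1 + 2 * \<eta>)) \<le> L * e" using L by (intro mult_left_mono)
      then show ?thesis using bulk_bounds(1)[of n t] by linarith
    qed
  qed
  also have "\<dots> = (LINT t:{0..<1}|M. bulk n t) + L * e"
    unfolding set_integral_add(2)[OF int_b int_e] using measure_unit by (simp add: set_lebesgue_integral_def)
  finally show "inverse gf_sum ^ (2 * n) * (moment (real n * (1 + 2 * p1 + 2 * \<eta>)) - inverse (1 + \<delta>/400) ^ n) \<le> (LINT t:B2|M. bulk n t)"
    unfolding eq L_def e_def by (simp add: algebra_simps)
qed

text \<open>The normalisation changes from F1(1) to F(1). As F1(1) >= F(1) (1 -
  \<open>tail0\<close>), this costs (1 - \<open>tail0\<close>)^(-2n), which Bernoulli's inequality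
  bounds by \<open>R\<close>; R tends to 1 once n \<open>tail0\<close> tends to 0.\<close>

lemma skeleton_sandwich:
  fixes n :: nat
  assumes \<eta>: "0 < \<eta>" "\<eta> \<le> 1/10" "3 * \<delta> \<le> \<eta>" and x: "2 * real n * tail0 < 1" and n: "n > 0"
  defines "V \<equiv> gf_sum ^ (2 * n) * (skeleton_count n / 16 ^ n)"
    and "R \<equiv> 1 / (1 - 2 * real n * tail0)"
    and "E \<equiv> 4806 / \<delta> * inverse (1 + \<delta>/800) ^ n + 18 * real n * tail0 ^ 2"
  shows "V \<le> R * (moment (real n * (1 + 2 * p1 - 2 * \<eta>)) + E)"
    and "moment (real n * (1 + 2 * p1 + 2 * \<eta>)) - inverse (1 + \<delta>/400) ^ n - R * E \<le> V"
proof -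
  define S where "S = gf_sum"
  have S: "S \<ge> 1" using gf_constants(1) by (simp add: S_def)
  have tl: "tail0 \<ge> 0" by (rule tail0_nonneg)
  have "1 * tail0 \<le> (2 * real n) * tail0" using tl n by (intro mult_right_mono) auto
  with x have x1: "tail0 < 1" by simp
  have bern: "1 - 2 * real n * tail0 \<le> (1 - tail0) ^ (2 * n)"
    using Bernoulli_inequality[of "- tail0" "2 * n"] x1 by simp
  have R: "inverse (1 - tail0) ^ (2 * n) \<le> R" "R \<ge> 0"
  proof -
    have "inverse (1 - tail0) ^ (2 * n) = 1 / (1 - tail0) ^ (2 * n)" by (simp only: power_inverse) (simp only: inverse_eq_divide)
    also have "\<dots> \<le> R" unfolding R_def using bern x x1 by (intro divide_left_mono mult_pos_pos) auto
    finally show "inverse (1 - tail0) ^ (2 * n) \<le> R" .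
    show "R \<ge> 0" using x by (simp add: R_def)
  qed
  have E: "E \<ge> 0" using \<delta> by (simp add: E_def)
  have G: "S ^ (2 * n) * inverse G1 ^ (2 * n) \<le> R"
  proof -
    have "S * (1 - tail0) \<le> G1" using S mult_right_mono[OF S tl] by (simp add: G1_eq S_def algebra_simps)
    then have "inverse G1 \<le> inverse (S * (1 - tail0))" using S x1 by (intro le_imp_inverse_le) auto
    then have "inverse G1 ^ (2 * n) \<le> inverse (S * (1 - tail0)) ^ (2 * n)" using G1_pos by (intro power_mono) auto
    then have "S ^ (2 * n) * inverse G1 ^ (2 * n) \<le> S ^ (2 * n) * inverse (S * (1 - tail0)) ^ (2 * n)"
      using S by (intro mult_left_mono) auto
    also have "\<dots> = (S * inverse (S * (1 - tail0))) ^ (2 * n)" by (simp only: power_mult_distrib)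
    also have "S * inverse (S * (1 - tail0)) = inverse (1 - tail0)" using S by simp
    also have "inverse (1 - tail0) ^ (2 * n) \<le> R" by (rule R)
    finally show ?thesis .
  qed
  define I where "I = (LINT t:B2|M. bulk n t)"
  note I = bulk_integral_bounds[OF \<eta> x1 n, folded I_def S_def]
  have Spos: "S ^ (2 * n) > 0" using S by simp
  have "S ^ (2 * n) * \<bar>skeleton_count n / 16 ^ n - I\<bar> \<le> S ^ (2 * n) * (inverse G1 ^ (2 * n) * E)"
    using main_estimate[OF n] Spos by (intro mult_left_mono) (auto simp: E_def I_def)
  also have "\<dots> \<le> R * E" using mult_right_mono[OF G E] by (simp add: mult_ac)
  finally have "S ^ (2 * n) * \<bar>skeleton_count n / 16 ^ n - I\<bar> \<le> R * E" .
  then have diff: "\<bar>V - S ^ (2 * n) * I\<bar> \<le> R * E"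
  proof -
    have "V - S ^ (2 * n) * I = S ^ (2 * n) * (skeleton_count n / 16 ^ n - I)"
      unfolding V_def S_def by (rule right_diff_distrib [symmetric])
    then have "\<bar>V - S ^ (2 * n) * I\<bar> = S ^ (2 * n) * \<bar>skeleton_count n / 16 ^ n - I\<bar>"
      using Spos by (simp only: abs_mult abs_of_pos)
    then show ?thesis using \<open>S ^ (2 * n) * \<bar>skeleton_count n / 16 ^ n - I\<bar> \<le> R * E\<close> by simp
  qed
  define m where "m = moment (real n * (1 + 2 * p1 - 2 * \<eta>))"
  have "real n * (1 + 2 * p1 - 2 * \<eta>) > 0" using n \<eta> gf_constants(3) by simp
  then have m: "m \<ge> 0" unfolding m_def using moment_bounds(1) gf_coeff_pos by (meson less_imp_le order_trans)
  have "S ^ (2 * n) * I \<le> S ^ (2 * n) * (inverse (S * (1 - tail0)) ^ (2 * n) * m)"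
    using I(1) Spos unfolding m_def by (intro mult_left_mono) auto
  also have "\<dots> = (S * inverse (S * (1 - tail0))) ^ (2 * n) * m" by (simp only: power_mult_distrib mult.assoc)
  also have "S * inverse (S * (1 - tail0)) = inverse (1 - tail0)" using S by simp
  also have "inverse (1 - tail0) ^ (2 * n) * m \<le> R * m" using R m by (intro mult_right_mono)
  finally show "V \<le> R * (moment (real n * (1 + 2 * p1 - 2 * \<eta>)) + E)"
    using diff unfolding m_def by (simp add: algebra_simps)
  have "moment (real n * (1 + 2 * p1 + 2 * \<eta>)) - inverse (1 + \<delta>/400) ^ n =
      (S * inverse S) ^ (2 * n) * (moment (real n * (1 + 2 * p1 + 2 * \<eta>)) - inverse (1 + \<delta>/400) ^ n)"
    using S by simp
  also have "\<dots> = S ^ (2 * n) * (inverse S ^ (2 * n) * (moment (real n * (1 + 2 * p1 + 2 * \<eta>)) - inverse (1 + \<delta>/400) ^ n))"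
    by (simp only: power_mult_distrib mult.assoc)
  also have "\<dots> \<le> S ^ (2 * n) * I" using I(2) Spos by (intro mult_left_mono) auto
  finally show "moment (real n * (1 + 2 * p1 + 2 * \<eta>)) - inverse (1 + \<delta>/400) ^ n - R * E \<le> V"
    using diff by linarith
qed

end

section \<open>Asymptotics of the skeleton counts\<close>

context gf_measure
begin

text \<open>Follows from 1 <= 1 / (1 - t), and supplies the mass condition of
  \<open>truncation\<close> once the tail is below 1/100.\<close>

lemma tail_B2_measure:
  assumes "0 < \<delta>" "\<delta> \<le> 1/2"
  shows "1 - tail \<delta> \<le> measure M {0..1-\<delta>}"
proof -
  have B: "{1-\<delta><..<1} \<in> sets borel" "{1-\<delta><..<1} \<subseteq> {0..<1}" using assms by auto
  have "1 * measure M {1-\<delta><..<1} = (LINT t:{1-\<delta><..<1}|M. 1)"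
    by (simp add: set_lebesgue_integral_def)
  also have "\<dots> \<le> tail \<delta>"
    unfolding tail_def
  proof (rule set_integral_mono[OF _ excess_integrals(1)[OF B]])
    show "set_integrable M {1-\<delta><..<1} (\<lambda>t. 1 :: real)"
      by (rule set_integrable_bounded[where K = 1]) auto
  qed (use assms in auto)
  finally have "measure M {1-\<delta><..<1} \<le> tail \<delta>" by simp
  moreover have "{0..<1} = {0..1-\<delta>} \<union> {1-\<delta><..<1}" using assms by auto
  then have "measure M {0..<1} \<le> measure M {0..1-\<delta>} + measure M {1-\<delta><..<1}"
    using measure_Un_le[of "{0..1-\<delta>}" M "{1-\<delta><..<1}"] by simp
  ultimately show ?thesis by (simp add: measure_unit)
qed

text \<open>Two limits in this order: for fixed \<eta> the two sides of the sandwich converge as n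
  grows, with A changed by 2 \<eta> either way; then \<eta> tends to 0. The condition 3 \<delta> <=
  \<eta> holds for large n since \<delta> tends to 0.\<close>

lemma skeleton_limit:
  defines "p \<equiv> gf_sum1 / gf_sum"
  shows "(\<lambda>n. real n ^ 5 * (gf_sum ^ (2 * n) * (skeleton_count n / 16 ^ n))) \<longlonglongrightarrow> 24 / pi / (1 + 2 * p) ^ 5"
proof -
  obtain C where C: "C > 0" "\<And>\<delta>. 0 < \<delta> \<Longrightarrow> \<delta> \<le> 1/2 \<Longrightarrow> tail \<delta> \<le> C * \<delta> ^ 4"
    using tail_bound by blast
  define d where "d n = real n powr (-4/5)" for n
  define x where "x n = tail (d n)" for n
  define V where "V n = real n ^ 5 * (gf_sum ^ (2 * n) * (skeleton_count n / 16 ^ n))" for n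
  define R where "R n = 1 / (1 - 2 * real n * x n)" for n
  define E where "E n = 4806 / d n * inverse (1 + d n / 800) ^ n + 18 * real n * x n ^ 2" for n
  have d0: "d \<longlonglongrightarrow> 0" unfolding d_def by real_asymp
  have d_pos: "\<forall>\<^sub>F n in sequentially. 0 < d n"
    using eventually_gt_at_top[of 0] by eventually_elim (simp add: d_def)
  have d_half: "\<forall>\<^sub>F n in sequentially. d n \<le> 1/2"
    using order_tendstoD(2)[OF d0, of "1/2"] by (auto elim!: eventually_mono)
  have x_le: "\<forall>\<^sub>F n in sequentially. x n \<le> C * d n ^ 4"
    using d_pos d_half by eventually_elim (simp add: x_def C)
  have x_nonneg: "0 \<le> x n" for n unfolding x_def by (rule tail_nonneg)
  have nx: "(\<lambda>n. 2 * real n * x n) \<longlonglongrightarrow> 0"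
  proof (rule tendsto_sandwich[OF _ _ tendsto_const])
    show "\<forall>\<^sub>F n in sequentially. 0 \<le> 2 * real n * x n" using x_nonneg by simp
    show "\<forall>\<^sub>F n in sequentially. 2 * real n * x n \<le> 2 * real n * (C * d n ^ 4)"
      using x_le by eventually_elim (intro mult_left_mono, auto)
    show "(\<lambda>n. 2 * real n * (C * d n ^ 4)) \<longlonglongrightarrow> 0" unfolding d_def by real_asymp
  qed
  have R1: "R \<longlonglongrightarrow> 1"
    unfolding R_def using tendsto_divide[OF tendsto_const[of 1] tendsto_diff[OF tendsto_const[of 1] nx]] by simp
  have E0: "(\<lambda>n. real n ^ 5 * E n) \<longlonglongrightarrow> 0"
  proof (rule tendsto_sandwich[OF _ _ tendsto_const])
    show "\<forall>\<^sub>F n in sequentially. 0 \<le> real n ^ 5 * E n"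
      using d_pos by eventually_elim (simp add: E_def)
    show "\<forall>\<^sub>F n in sequentially. real n ^ 5 * E n \<le>
        real n ^ 5 * (4806 / d n * inverse (1 + d n / 800) ^ n) + 18 * C ^ 2 * (real n ^ 6 * (d n ^ 4) ^ 2)"
      using x_le
    proof eventually_elim
      case (elim n)
      have "x n ^ 2 \<le> (C * d n ^ 4) ^ 2" using elim x_nonneg by (intro power_mono) auto
      then have "real n ^ 5 * (18 * real n * x n ^ 2) \<le> real n ^ 5 * (18 * real n * (C * d n ^ 4) ^ 2)"
        by (intro mult_left_mono) auto
      also have "\<dots> = 18 * C ^ 2 * (real n ^ 6 * (d n ^ 4) ^ 2)"
        by (simp add: power_mult_distrib eval_nat_numeral mult_ac)
      finally show ?case by (simp add: E_def distrib_left)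
    qed
    have "(\<lambda>n. real n ^ 5 * (4806 / d n * inverse (1 + d n / 800) ^ n)) \<longlonglongrightarrow> 0"
      unfolding d_def by real_asymp
    \<comment> \<open>The power is 6 - 32/5 = -2/5; here the exponent 4/5 has to exceed 3/4.\<close>
    moreover have "(\<lambda>n. real n ^ 6 * (d n ^ 4) ^ 2) \<longlonglongrightarrow> 0" unfolding d_def by real_asymp
    ultimately show "(\<lambda>n. real n ^ 5 * (4806 / d n * inverse (1 + d n / 800) ^ n) + 18 * C ^ 2 * (real n ^ 6 * (d n ^ 4) ^ 2)) \<longlonglongrightarrow> 0"
      using tendsto_add[OF _ tendsto_mult[OF tendsto_const[of "18 * C ^ 2"]]] by fastforce
  qed
  have p: "1/10 \<le> p"
  proof -
    have "1/10 * gf_sum \<le> gf_sum1" "gf_sum > 0" using gf_sum_bounds unfolding gf_sum1_eq by simp_all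
    then show ?thesis by (simp add: p_def field_simps)
  qed
  have both: "\<forall>\<^sub>F n in sequentially.
      V n \<le> R n * (real n ^ 5 * moment (real n * (1 + 2 * p - 2 * \<eta>)) + real n ^ 5 * E n) \<and>
      real n ^ 5 * moment (real n * (1 + 2 * p + 2 * \<eta>)) - real n ^ 5 * inverse (1 + d n / 400) ^ n - R n * (real n ^ 5 * E n) \<le> V n"
    if \<eta>: "0 < \<eta>" "\<eta> \<le> 1/10" for \<eta>
  proof -
    have "\<forall>\<^sub>F n in sequentially. 3 * d n \<le> \<eta>"
      using order_tendstoD(2)[OF d0, of "\<eta> / 3"] \<eta> by (auto elim!: eventually_mono)
    moreover have "\<forall>\<^sub>F n in sequentially. 2 * real n * x n < 1/100"
      using order_tendstoD(2)[OF nx, of "1/100"] by auto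
    ultimately show ?thesis
      using d_pos d_half eventually_gt_at_top[of 0]
    proof eventually_elim
      case (elim n)
      have "1 * x n \<le> 2 * real n * x n" using elim x_nonneg[of n] by (intro mult_right_mono) auto
      then have "x n \<le> 1/100" using elim by simp
      then have "99/100 \<le> measure M {0..1 - d n}"
        using tail_B2_measure[of "d n"] elim by (simp add: x_def)
      then interpret truncation M "d n"
        using elim by unfold_locales auto
      have x_eq: "tail0 = x n" by (simp add: tail0_eq x_def)
      have "2 * real n * tail0 < 1" using elim by (simp add: x_eq)
      note sw = skeleton_sandwich[OF \<eta> elim(1) this elim(5), unfolded x_eq p1_def, folded p_def, folded R_def E_def]
      have n5: "0 \<le> real n ^ 5" by simp
      show ?case
        using mult_left_mono[OF sw(1) n5] mult_left_mono[OF sw(2) n5] unfolding V_def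
        by (simp add: algebra_simps)
    qed
  qed
  define c where "c = 24 / pi"
  have up: "(\<lambda>n. R n * (real n ^ 5 * moment (real n * (1 + 2 * p - 2 * \<eta>)) + real n ^ 5 * E n)) \<longlonglongrightarrow> c / (1 + 2 * p - 2 * \<eta>) ^ 5"
    if \<eta>: "0 < \<eta>" "\<eta> \<le> 1/10" for \<eta>
    using tendsto_mult[OF R1 tendsto_add[OF moment_asymp[of "1 + 2 * p - 2 * \<eta>"] E0]] p \<eta> by (simp add: c_def)
  have lo: "(\<lambda>n. real n ^ 5 * moment (real n * (1 + 2 * p + 2 * \<eta>)) - real n ^ 5 * inverse (1 + d n / 400) ^ n - R n * (real n ^ 5 * E n)) \<longlonglongrightarrow> c / (1 + 2 * p + 2 * \<eta>) ^ 5"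
    if \<eta>: "0 < \<eta>" "\<eta> \<le> 1/10" for \<eta>
  proof -
    have "(\<lambda>n. real n ^ 5 * inverse (1 + d n / 400) ^ n) \<longlonglongrightarrow> 0" unfolding d_def by real_asymp
    from tendsto_diff[OF tendsto_diff[OF moment_asymp[of "1 + 2 * p + 2 * \<eta>"] this] tendsto_mult[OF R1 E0]] p \<eta>
    show ?thesis by (simp add: c_def)
  qed
  have "V \<longlonglongrightarrow> c / (1 + 2 * p) ^ 5"
  proof (rule order_tendstoI)
    fix u assume u: "c / (1 + 2 * p) ^ 5 < u"
    have "((\<lambda>\<eta>. c / (1 + 2 * p - 2 * \<eta>) ^ 5) \<longlongrightarrow> c / (1 + 2 * p - 2 * 0) ^ 5) (at_right 0)"
      using p by (intro tendsto_intros) auto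
    then have "\<forall>\<^sub>F \<eta> in at_right 0. c / (1 + 2 * p - 2 * \<eta>) ^ 5 < u"
      using u by (auto dest: order_tendstoD)
    moreover have "\<forall>\<^sub>F \<eta> in at_right 0. \<eta> \<in> {0<..<1/10::real}"
      by (rule eventually_at_right_real) simp
    ultimately have "\<forall>\<^sub>F \<eta> in at_right 0. c / (1 + 2 * p - 2 * \<eta>) ^ 5 < u \<and> \<eta> \<in> {0<..<1/10::real}"
      by (rule eventually_conj)
    then obtain \<eta> where \<eta>: "c / (1 + 2 * p - 2 * \<eta>) ^ 5 < u" "0 < \<eta>" "\<eta> \<le> 1/10"
      using eventually_happens[of _ "at_right (0::real)"] by fastforce
    show "\<forall>\<^sub>F n in sequentially. V n < u"
      using order_tendstoD(2)[OF up[OF \<eta>(2,3)] \<eta>(1)] both[OF \<eta>(2,3)]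
      by eventually_elim auto
  next
    fix u assume u: "u < c / (1 + 2 * p) ^ 5"
    have "((\<lambda>\<eta>. c / (1 + 2 * p + 2 * \<eta>) ^ 5) \<longlongrightarrow> c / (1 + 2 * p + 2 * 0) ^ 5) (at_right 0)"
      using p by (intro tendsto_intros) auto
    then have "\<forall>\<^sub>F \<eta> in at_right 0. u < c / (1 + 2 * p + 2 * \<eta>) ^ 5"
      using u by (auto dest: order_tendstoD)
    moreover have "\<forall>\<^sub>F \<eta> in at_right 0. \<eta> \<in> {0<..<1/10::real}"
      by (rule eventually_at_right_real) simp
    ultimately have "\<forall>\<^sub>F \<eta> in at_right 0. u < c / (1 + 2 * p + 2 * \<eta>) ^ 5 \<and> \<eta> \<in> {0<..<1/10::real}"
      by (rule eventually_conj)
    then obtain \<eta> where \<eta>: "u < c / (1 + 2 * p + 2 * \<eta>) ^ 5" "0 < \<eta>" "\<eta> \<le> 1/10"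
      using eventually_happens[of _ "at_right (0::real)"] by fastforce
    show "\<forall>\<^sub>F n in sequentially. u < V n"
      using order_tendstoD(1)[OF lo[OF \<eta>(2,3)] \<eta>(1)] both[OF \<eta>(2,3)]
      by eventually_elim auto
  qed
  then show ?thesis by (simp add: V_def [abs_def] c_def)
qed

end

section \<open>The constants of the theorem\<close>

lemma F0_const_eq: "F0_const = gf_sum"
  unfolding F0_const_def eval_fps_def rho_def noncrossing3_gf_nth_gf_coeff gf_sum_def
  by (simp add: power_divide)

lemma A_const_eq: "A_const = 1 + 2 * (gf_sum1 / gf_sum)"
proof -
  have "(\<lambda>n. real (Suc n) * gf_coeff (Suc n)) sums gf_sum1"
    using gf_sum1_sums by (subst sums_Suc_iff) simp
  then have "(\<lambda>n. 16 * (real (Suc n) * gf_coeff (Suc n))) sums (16 * gf_sum1)" by (rule sums_mult)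
  moreover have "fps_nth (fps_deriv noncrossing3_gf) n * rho ^ n = 16 * (real (Suc n) * gf_coeff (Suc n))" for n
    by (simp add: noncrossing3_gf_nth_gf_coeff rho_def power_divide)
  ultimately have "eval_fps (fps_deriv noncrossing3_gf) rho = 16 * gf_sum1"
    unfolding eval_fps_def by (simp only: sums_unique [symmetric])
  then show ?thesis by (simp add: A_const_def F0_const_eq rho_def)
qed

text \<open>By \<open>gf_sum1_eq\<close>, A = 4 / F(1) - 5/2. The sign of 165 pi - 512 is read off
  from F(1) > 0.\<close>

lemma A_const_closed_form: "A_const = (1280 - 405 * pi) / (165 * pi - 512)"
proof -
  have S: "gf_sum * (15 * pi) = 8 * (165 * pi - 512)"
    by (simp add: gf_sum_closed_form field_simps)
  have pos: "gf_sum > 0" using gf_sum_bounds by simp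
  then have "gf_sum * (15 * pi) > 0" by simp
  then have den: "165 * pi - 512 > 0" unfolding S by simp
  have "A_const = 4 / gf_sum - 5/2"
    using pos by (simp add: A_const_eq gf_sum1_eq field_simps)
  also have "gf_sum = 8 * (165 * pi - 512) / (15 * pi)" using S by (simp add: field_simps)
  finally show ?thesis using den by (simp add: field_simps)
qed

theorem theorem2p1:
  shows "skeleton_count \<sim>[at_top]
           (\<lambda>n. 24 / (pi * A_const ^ 5) * sigma_const powi (- int n) * real n powi (- 5))
         \<and> (\<forall>n. 24 / (pi * A_const ^ 5) * sigma_const powi (- int n) * real n powi (- 5) =
                24 * (165 * pi - 512) ^ 5 / (pi * (1280 - 405 * pi) ^ 5)
                  * sigma_const powi (- int n) * real n powi (- 5))"
proof (intro conjI allI)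
  obtain M :: "real measure" where M: "finite_measure M" "sets M = sets borel" "AE t in M. 0 < t \<and> t < 1"
      "\<And>n. (\<integral>\<^sup>+t. ennreal (\<bar>t\<bar> ^ n) \<partial>M) = ennreal (gf_coeff n)"
    using gf_coeff_moments by blast
  then interpret gf_measure M
    by (intro gf_measure.intro finite_borel_measure.intro finite_borel_measure_axioms.intro gf_measure_axioms.intro)
  have S: "gf_sum > 0" "gf_sum1 > 0" using gf_sum_bounds unfolding gf_sum1_eq by simp_all
  have A: "A_const > 0" using S by (simp add: A_const_eq add_pos_pos)
  define c where "c = 24 / (pi * A_const ^ 5)"
  have c: "c > 0" using A by (simp add: c_def)
  have lim: "(\<lambda>n. real n ^ 5 * (gf_sum ^ (2 * n) * (skeleton_count n / 16 ^ n))) \<longlonglongrightarrow> c"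
    using skeleton_limit by (simp add: A_const_eq c_def)
  show "skeleton_count \<sim>[at_top] (\<lambda>n. 24 / (pi * A_const ^ 5) * sigma_const powi (- int n) * real n powi (- 5))"
  proof (rule asymp_equivI')
    have "(\<lambda>n. real n ^ 5 * (gf_sum ^ (2 * n) * (skeleton_count n / 16 ^ n)) / c) \<longlonglongrightarrow> c / c"
      using c by (intro tendsto_divide lim tendsto_const) auto
    then have "(\<lambda>n. real n ^ 5 * (gf_sum ^ (2 * n) * (skeleton_count n / 16 ^ n)) / c) \<longlonglongrightarrow> 1"
      using c by simp
    \<comment> \<open>This also covers n = 0: the left side is 0, and on the right 0 powi (- 5) = 0,
      so the quotient is a division by 0 with value 0.\<close>
    moreover have "real n ^ 5 * (gf_sum ^ (2 * n) * (skeleton_count n / 16 ^ n)) / c =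
        skeleton_count n / (24 / (pi * A_const ^ 5) * sigma_const powi (- int n) * real n powi (- 5))" for n
    proof -
      have sigma: "sigma_const = gf_sum ^ 2 / 16" by (simp add: sigma_const_def rho_def F0_const_eq)
      have "sigma_const ^ n = gf_sum ^ (2 * n) / 16 ^ n" unfolding sigma by (simp only: power_divide power_mult)
      then have "sigma_const powi (- int n) = inverse (gf_sum ^ (2 * n) / 16 ^ n)"
        by (simp only: power_int_minus power_int_of_nat)
      moreover have "real n powi (- 5) = inverse (real n ^ 5)" by (simp add: power_int_minus)
      ultimately show ?thesis by (simp add: c_def field_simps)
    qed
    ultimately show "(\<lambda>n. skeleton_count n / (24 / (pi * A_const ^ 5) * sigma_const powi (- int n) * real n powi (- 5))) \<longlonglongrightarrow> 1"
      by simp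
  qed
  fix n
  show "24 / (pi * A_const ^ 5) * sigma_const powi (- int n) * real n powi (- 5) =
      24 * (165 * pi - 512) ^ 5 / (pi * (1280 - 405 * pi) ^ 5) * sigma_const powi (- int n) * real n powi (- 5)"
    by (simp add: A_const_closed_form power_divide)
qed

end
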